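(* Let $\mathcal{A}$ be a category and $\mathcal{E}$ a class of morphisms in $\mathcal{A}$ such that $(\mathcal{A},\mathcal{E})$ satisfies (E1)--(E3). Let $\mathbb{A}$ be an augmented semi-simplicial object in $\mathcal{A}$. Then $\mathbb{A}$ is an $\mathcal{E}$-resolution if and only if, for every $n\geq 1$, the induced $n$-fold arrow $\mathsf{arr}_{n}\mathbb{A}$ is an $n$-fold $\mathcal{E}$-extension.
   Context: Axioms: (E1) $\mathcal{E}$ contains all isomorphisms; (E2) pullbacks of morphisms in $\mathcal{E}$ (along arbitrary morphisms) exist in $\mathcal{A}$ and are in $\mathcal{E}$; (E3) $\mathcal{E}$ is closed under composition. Higher arrows and cubes: $n=\{0,\dots,n-1\}$ and $2^n$ is the poset of subsets of $n$, viewed as a category. An $n$-cube in $\mathcal{A}$ is a functor $A\colon (2^n)^{\mathrm{op}}\to\mathcal{A}$, written $S\mapsto A_S$. $\mathsf{Arr}\,\mathcal{A}$ is the category of arrows of $\mathcal{A}$ (morphisms are commutative squares), $\mathsf{Arr}^0\mathcal{A}=\mathcal{A}$ and $\mathsf{Arr}^{n+1}\mathcal{A}=\mathsf{Arr}\,\mathsf{Arr}^{n}\mathcal{A}$; objects of $\mathsf{Arr}^n\mathcal{A}$ are $n$-fold arrows. An $n$-cube $A$ ($n\geq 1$) is identified with an $n$-fold arrow by viewing it as the arrow from the $(n-1)$-cube $S\mapsto A_{S\cup\{n-1\}}$ to the $(n-1)$-cube $S\mapsto A_S$ ($S\subseteq n-1$), and inductively. Extensions: $\mathsf{Ext}\,\mathcal{A}$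 is the full subcategory of $\mathsf{Arr}\,\mathcal{A}$ on the arrows in $\mathcal{E}$. $\mathcal{E}^1$ is the class of morphisms $(f_1,f_0)\colon a\to b$ in $\mathsf{Arr}\,\mathcal{A}$ (with $a\colon A_1\to A_0$, $b\colon B_1\to B_0$, $f_0 a=b f_1$) such that $a,b,f_1,f_0$ and the comparison morphism $\langle a,f_1\rangle\colon A_1\to A_0\times_{B_0}B_1$ are all in $\mathcal{E}$. The pair $(\mathsf{Ext}\,\mathcal{A},\mathcal{E}^1)$ again satisfies (E1)--(E3). Put $\mathcal{E}^0=\mathcal{E}$, $\mathcal{E}^n=(\mathcal{E}^{n-1})^1$, and let $\mathsf{Ext}^n\mathcal{A}$ be the full subcategory of $\mathsf{Arr}^n\mathcal{A}$ determined by the elements of $\mathcal{E}^{n-1}$. An element of $\mathcal{E}^{n-1}$ is called an $n$-fold ($\mathcal{E}$-)extension. Augmented semi-simplicial object $\mathbb{A}$: objects $(A_n)_{n\geq -1}$ with faces $\partial_i\colon A_n\to A_{n-1}$, $0\leq i\leq n$, $n\geq 0$, such that $\partial_i\partial_j=\partial_{j-1}\partial_i$ for $i<j$. Equivalently, it is a contravariant functor on the category of finite ordinals $n\geq 0$ and injective order-preserving maps, the ordinal $n$ being sent to $A_{n-1}$ and the injection $n\to n+1$ missing $i$ to $\partial_i$. The $n$-fold arrow $\mathsf{arr}_n\mathbb{A}$ is the $n$-cube with $(\mathsf{arr}_n\mathbb{A})_S=A_{|S|-1}$ for $S\subseteq n$, where for $S\subseteq T$ the morphism $A_{|T|-1}\to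 A_{|S|-1}$ is the image under $\mathbb{A}$ of the injective order-preserving map $|S|\to|T|$ obtained from the inclusion $S\subseteq T$ by enumerating $S$ and $T$ increasingly. (For example $\mathsf{arr}_1\mathbb{A}=\partial_0\colon A_0\to A_{-1}$.) Simplicial kernels: a simplicial kernel of morphisms $f_0,\dots,f_n\colon X\to Y$ is a sequence $(k_i\colon K\to X)_{0\leq i\leq n+1}$ with $f_ik_j=f_{j-1}k_i$ for $0\leq i<j\leq n+1$, universal with this property. Write $K_0\mathbb{A}=A_{-1}$ and, for $n\geq 1$, $K_n\mathbb{A}$ for the simplicial kernel (if it exists) of $\partial_0,\dots,\partial_{n-1}\colon A_{n-1}\to A_{n-2}$. $\mathbb{A}$ is an $\mathcal{E}$-resolution when for every $n\geq 0$ the object $K_n\mathbb{A}$ exists and the induced morphism $A_n\to K_n\mathbb{A}$ (which is $\partial_0$ for $n=0$, and is induced by $\partial_0,\dots,\partial_n$ for $n\geq 1$) is in $\mathcal{E}$. *)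

theory Defs
  imports Main
begin

section \<open>Categories\<close>

record ('o, 'a) category =
  Ob :: "'o set"
  Ar :: "'a set"
  src :: "'a \<Rightarrow> 'o"
  tgt :: "'a \<Rightarrow> 'o"
  ident :: "'o \<Rightarrow> 'a"
  cmp :: "'a \<Rightarrow> 'a \<Rightarrow> 'a"  \<comment> \<open>\<open>cmp C g f\<close> is \<open>g\<close> after \<open>f\<close>\<close>

definition hom :: "('o, 'a) category \<Rightarrow> 'o \<Rightarrow> 'o \<Rightarrow> 'a set" where
  "hom C x y = {f \<in> Ar C. src C f = x \<and> tgt C f = y}"

locale category =
  fixes C :: "('o, 'a) category"
  assumes src_Ob: "f \<in> Ar C \<Longrightarrow> src C f \<in> Ob C"
    and tgt_Ob: "f \<in> Ar C \<Longrightarrow> tgt C f \<in> Ob C"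
    and ident_hom: "x \<in> Ob C \<Longrightarrow> ident C x \<in> hom C x x"
    and cmp_hom: "f \<in> hom C x y \<Longrightarrow> g \<in> hom C y z \<Longrightarrow> cmp C g f \<in> hom C x z"
    and cmp_ident_left: "f \<in> hom C x y \<Longrightarrow> cmp C (ident C y) f = f"
    and cmp_ident_right: "f \<in> hom C x y \<Longrightarrow> cmp C f (ident C x) = f"
    and cmp_assoc: "f \<in> hom C w x \<Longrightarrow> g \<in> hom C x y \<Longrightarrow> h \<in> hom C y z \<Longrightarrow>
      cmp C h (cmp C g f) = cmp C (cmp C h g) f"

definition is_iso :: "('o, 'a) category \<Rightarrow> 'a \<Rightarrow> bool" where
  "is_iso C f \<longleftrightarrow> f \<in> Ar C \<and>
    (\<exists>g \<in> hom C (tgt C f) (src C f).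
      cmp C g f = ident C (src C f) \<and> cmp C f g = ident C (tgt C f))"

definition full_subcat :: "('o, 'a) category \<Rightarrow> 'o set \<Rightarrow> ('o, 'a) category" where
  "full_subcat C D = C\<lparr>Ob := Ob C \<inter> D,
     Ar := {f \<in> Ar C. src C f \<in> D \<and> tgt C f \<in> D}\<rparr>"

text \<open>\<open>P\<close> with projections \<open>p\<close> (to the source of \<open>f\<close>) and \<open>q\<close> (to the source of \<open>g\<close>) is a
  pullback of \<open>f\<close> and \<open>g\<close>.\<close>

definition is_pullback ::
    "('o, 'a) category \<Rightarrow> 'a \<Rightarrow> 'a \<Rightarrow> 'o \<Rightarrow> 'a \<Rightarrow> 'a \<Rightarrow> bool" where
  "is_pullback C f g P p q \<longleftrightarrow>
     f \<in> Ar C \<and> g \<in> Ar C \<and> tgt C f = tgt C g \<and>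
     P \<in> Ob C \<and> p \<in> hom C P (src C f) \<and> q \<in> hom C P (src C g) \<and> cmp C f p = cmp C g q \<and>
     (\<forall>Z \<in> Ob C. \<forall>s \<in> hom C Z (src C f). \<forall>t \<in> hom C Z (src C g). cmp C f s = cmp C g t \<longrightarrow>
        (\<exists>!u. u \<in> hom C Z P \<and> cmp C p u = s \<and> cmp C q u = t))"

locale extension_class = category C for C :: "('o, 'a) category" +
  fixes E :: "'a set"
  assumes E_Ar: "E \<subseteq> Ar C"
    and E1: "is_iso C f \<Longrightarrow> f \<in> E"
    and E2_exists: "f \<in> E \<Longrightarrow> g \<in> Ar C \<Longrightarrow> tgt C g = tgt C f \<Longrightarrow> \<exists>P p q. is_pullback C f g P p q"
    and E2_stable: "f \<in> E \<Longrightarrow> is_pullback C f g P p q \<Longrightarrow> q \<in> E"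
    and E3: "f \<in> E \<Longrightarrow> g \<in> E \<Longrightarrow> tgt C f = src C g \<Longrightarrow> cmp C g f \<in> E"


section \<open>Higher arrows\<close>

text \<open>All objects and arrows of the iterated arrow categories of a category live in one type.
  \<open>Sq a b f\<^sub>1 f\<^sub>0\<close> is the commutative square \<open>(f\<^sub>1, f\<^sub>0) : a \<rightarrow> b\<close>, so \<open>f\<^sub>1\<close> goes between the sources of
  \<open>a\<close> and \<open>b\<close>, and \<open>f\<^sub>0\<close> between their targets. The category itself is embedded by \<open>base_cat\<close>, and
  an object of \<open>arr_cat C\<close> is literally an arrow of \<open>C\<close>. The equations not given for the
  projections below concern no arrow of the categories in question.\<close>

datatype ('o, 'a) tower =
    Obj 'o
  | Mor 'a
  | Sq "('o, 'a) tower" "('o, 'a) tower" "('o, 'a) tower" "('o, 'a) tower"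

type_synonym ('o, 'a) tower_cat = "(('o, 'a) tower, ('o, 'a) tower) category"

primrec un_Obj :: "('o, 'a) tower \<Rightarrow> 'o" where
  "un_Obj (Obj x) = x"

primrec un_Mor :: "('o, 'a) tower \<Rightarrow> 'a" where
  "un_Mor (Mor f) = f"

primrec sq_src :: "('o, 'a) tower \<Rightarrow> ('o, 'a) tower" where
  "sq_src (Sq a b f1 f0) = a"

primrec sq_tgt :: "('o, 'a) tower \<Rightarrow> ('o, 'a) tower" where
  "sq_tgt (Sq a b f1 f0) = b"

primrec sq_upper :: "('o, 'a) tower \<Rightarrow> ('o, 'a) tower" where
  "sq_upper (Sq a b f1 f0) = f1"

primrec sq_lower :: "('o, 'a) tower \<Rightarrow> ('o, 'a) tower" where
  "sq_lower (Sq a b f1 f0) = f0"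

definition base_cat :: "('o, 'a) category \<Rightarrow> ('o, 'a) tower_cat" where
  "base_cat C =
    \<lparr>Ob = Obj ` Ob C,
     Ar = Mor ` Ar C,
     src = (\<lambda>f. Obj (src C (un_Mor f))),
     tgt = (\<lambda>f. Obj (tgt C (un_Mor f))),
     ident = (\<lambda>x. Mor (ident C (un_Obj x))),
     cmp = (\<lambda>g f. Mor (cmp C (un_Mor g) (un_Mor f)))\<rparr>"

definition arr_cat :: "('o, 'a) tower_cat \<Rightarrow> ('o, 'a) tower_cat" where
  "arr_cat C =
    \<lparr>Ob = Ar C,
     Ar = {Sq a b f1 f0 | a b f1 f0. a \<in> Ar C \<and> b \<in> Ar C \<and>
             f1 \<in> hom C (src C a) (src C b) \<and> f0 \<in> hom C (tgt C a) (tgt C b) \<and>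
             cmp C f0 a = cmp C b f1},
     src = sq_src,
     tgt = sq_tgt,
     ident = (\<lambda>a. Sq a a (ident C (src C a)) (ident C (tgt C a))),
     cmp = (\<lambda>g f. Sq (sq_src f) (sq_tgt g)
             (cmp C (sq_upper g) (sq_upper f)) (cmp C (sq_lower g) (sq_lower f)))\<rparr>"

primrec Arr :: "('o, 'a) category \<Rightarrow> nat \<Rightarrow> ('o, 'a) tower_cat" where
  "Arr C 0 = base_cat C"
| "Arr C (Suc n) = arr_cat (Arr C n)"

lemma category_base_cat: "category C \<Longrightarrow> category (base_cat C)"
  by (auto simp: category_def base_cat_def hom_def)

lemma category_arr_cat:
  assumes "category C"
  shows "category (arr_cat C)"
proof -
  interpret category C by fact
  have par: "a \<in> hom C (src C a) (tgt C a)" if "a \<in> Ar C" for a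
    using that by (simp add: hom_def)
  have sq: "cmp C (cmp C g0 f0) a = cmp C c (cmp C g1 f1)"
    if "a \<in> Ar C" "b \<in> Ar C" "c \<in> Ar C"
      and f: "f1 \<in> hom C (src C a) (src C b)" "f0 \<in> hom C (tgt C a) (tgt C b)"
        "cmp C f0 a = cmp C b f1"
      and g: "g1 \<in> hom C (src C b) (src C c)" "g0 \<in> hom C (tgt C b) (tgt C c)"
        "cmp C g0 b = cmp C c g1"
    for a b c f1 f0 g1 g0
  proof -
    have "cmp C (cmp C g0 f0) a = cmp C g0 (cmp C b f1)"
      using cmp_assoc[OF par f(2) g(2)] that(1) f(3) by simp
    also have "\<dots> = cmp C (cmp C c g1) f1"
      using cmp_assoc[OF f(1) par g(2)] that(2) g(3) by simp
    also have "\<dots> = cmp C c (cmp C g1 f1)"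
      using cmp_assoc[OF f(1) g(1) par] that(3) by simp
    finally show ?thesis .
  qed
  have ob: "src C a \<in> Ob C" "tgt C a \<in> Ob C" if "a \<in> Ar C" for a
    using that src_Ob tgt_Ob by auto
  have homD: "(f \<in> hom (arr_cat C) a b) \<longleftrightarrow> (\<exists>f1 f0. f = Sq a b f1 f0 \<and> a \<in> Ar C \<and> b \<in> Ar C \<and>
      f1 \<in> hom C (src C a) (src C b) \<and> f0 \<in> hom C (tgt C a) (tgt C b) \<and> cmp C f0 a = cmp C b f1)"
    for f a b by (auto simp: hom_def arr_cat_def)
  show ?thesis
  proof
    show "src (arr_cat C) f \<in> Ob (arr_cat C)" "tgt (arr_cat C) f \<in> Ob (arr_cat C)"
      if "f \<in> Ar (arr_cat C)" for f
      using that by (auto simp: arr_cat_def)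
    show "ident (arr_cat C) x \<in> hom (arr_cat C) x x" if "x \<in> Ob (arr_cat C)" for x
      using that ob ident_hom cmp_ident_left[OF par] cmp_ident_right[OF par]
      unfolding homD by (simp add: arr_cat_def)
    show "cmp (arr_cat C) g f \<in> hom (arr_cat C) x z"
      if "f \<in> hom (arr_cat C) x y" "g \<in> hom (arr_cat C) y z" for f g x y z
      using that sq unfolding homD by (auto simp: arr_cat_def intro: cmp_hom)
    show "cmp (arr_cat C) (ident (arr_cat C) y) f = f" "cmp (arr_cat C) f (ident (arr_cat C) x) = f"
      if "f \<in> hom (arr_cat C) x y" for f x y
      using that cmp_ident_left cmp_ident_right unfolding homD by (auto simp: arr_cat_def)
    show "cmp (arr_cat C) h (cmp (arr_cat C) g f) = cmp (arr_cat C) (cmp (arr_cat C) h g) f"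
      if "f \<in> hom (arr_cat C) w x" "g \<in> hom (arr_cat C) x y" "h \<in> hom (arr_cat C) y z"
      for f g h w x y z
      using that cmp_assoc unfolding homD by (auto simp: arr_cat_def)
  qed
qed

lemma category_Arr: "category C \<Longrightarrow> category (Arr C n)"
  by (induction n) (simp_all add: category_base_cat category_arr_cat)


section \<open>Higher extensions\<close>

text \<open>The class \<open>\<E>\<^sup>1\<close> for a pair \<open>(C, \<E>)\<close>. The arrow \<open>u\<close> is the comparison morphism
  \<open>\<langle>a, f\<^sub>1\<rangle> : A\<^sub>1 \<rightarrow> A\<^sub>0 \<times>\<^bsub>B\<^sub>0\<^esub> B\<^sub>1\<close> to the pullback of \<open>f\<^sub>0\<close> and \<open>b\<close>.\<close>

definition higher_class ::
    "('o, 'a) tower_cat \<Rightarrow> ('o, 'a) tower set \<Rightarrow> ('o, 'a) tower set" where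
  "higher_class C E =
    {Sq a b f1 f0 | a b f1 f0. Sq a b f1 f0 \<in> Ar (arr_cat C) \<and>
       a \<in> E \<and> b \<in> E \<and> f1 \<in> E \<and> f0 \<in> E \<and>
       (\<exists>P p q u. is_pullback C f0 b P p q \<and>
          u \<in> hom C (src C a) P \<and> cmp C p u = a \<and> cmp C q u = f1 \<and> u \<in> E)}"

text \<open>\<open>E_iter C E n\<close> is the class \<open>\<E>\<^sup>n\<close> of arrows of \<open>Ext C E n\<close>, formed from the pair
  \<open>(Ext\<^sup>n\<^sup>-\<^sup>1, \<E>\<^sup>n\<^sup>-\<^sup>1)\<close>.\<close>

fun E_iter :: "('o, 'a) category \<Rightarrow> 'a set \<Rightarrow> nat \<Rightarrow> ('o, 'a) tower set"
  and Ext :: "('o, 'a) category \<Rightarrow> 'a set \<Rightarrow> nat \<Rightarrow> ('o, 'a) tower_cat" where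
  "E_iter C E 0 = Mor ` E"
| "E_iter C E (Suc n) = higher_class (Ext C E n) (E_iter C E n)"
| "Ext C E 0 = Arr C 0"
| "Ext C E (Suc n) = full_subcat (Arr C (Suc n)) (E_iter C E n)"

definition is_extension ::
    "('o, 'a) category \<Rightarrow> 'a set \<Rightarrow> nat \<Rightarrow> ('o, 'a) tower \<Rightarrow> bool" where
  "is_extension C E n t \<longleftrightarrow> n \<ge> 1 \<and> t \<in> E_iter C E (n - 1)"


section \<open>Cubes\<close>

record ('o, 'a) cube =
  vert :: "nat set \<Rightarrow> 'o"
  edge :: "nat set \<Rightarrow> nat set \<Rightarrow> 'a"  \<comment> \<open>\<open>edge A S T : A\<^sub>T \<rightarrow> A\<^sub>S\<close> for \<open>S \<subseteq> T\<close>\<close>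

definition is_cube :: "('o, 'a) category \<Rightarrow> nat \<Rightarrow> ('o, 'a) cube \<Rightarrow> bool" where
  "is_cube C n A \<longleftrightarrow>
     (\<forall>S \<subseteq> {..<n}. vert A S \<in> Ob C \<and> edge A S S = ident C (vert A S)) \<and>
     (\<forall>T \<subseteq> {..<n}. \<forall>S \<subseteq> T. edge A S T \<in> hom C (vert A T) (vert A S)) \<and>
     (\<forall>U \<subseteq> {..<n}. \<forall>T \<subseteq> U. \<forall>S \<subseteq> T. edge A S U = cmp C (edge A S T) (edge A T U))"

definition cube_map ::
    "('o, 'a) category \<Rightarrow> nat \<Rightarrow> ('o, 'a) cube \<Rightarrow> ('o, 'a) cube \<Rightarrow> (nat set \<Rightarrow> 'a) \<Rightarrow> bool" where
  "cube_map C n A B t \<longleftrightarrow>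
     (\<forall>S \<subseteq> {..<n}. t S \<in> hom C (vert A S) (vert B S)) \<and>
     (\<forall>T \<subseteq> {..<n}. \<forall>S \<subseteq> T. cmp C (t S) (edge A S T) = cmp C (edge B S T) (t T))"

definition upper_cube :: "nat \<Rightarrow> ('o, 'a) cube \<Rightarrow> ('o, 'a) cube" where
  "upper_cube n A =
    \<lparr>vert = (\<lambda>S. vert A (insert n S)),
     edge = (\<lambda>S T. edge A (insert n S) (insert n T))\<rparr>"

text \<open>The arrow of \<open>Arr C n\<close> and the object of \<open>Arr C n\<close> with which a natural transformation
  \<open>t : A \<rightarrow> B\<close> of \<open>n\<close>-cubes and an \<open>n\<close>-cube are identified: an \<open>(n+1)\<close>-cube \<open>A\<close> is the natural
  transformation \<open>S \<mapsto> (A\<^bsub>S \<union> {n}\<^esub> \<rightarrow> A\<^sub>S)\<close> from \<open>upper_cube n A\<close> to the restriction of \<open>A\<close> to the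
  subsets of \<open>n\<close> (the latter needs no notation, as nothing else is evaluated).\<close>

fun tower_of_map ::
    "nat \<Rightarrow> ('o, 'a) cube \<Rightarrow> ('o, 'a) cube \<Rightarrow> (nat set \<Rightarrow> 'a) \<Rightarrow> ('o, 'a) tower" where
  "tower_of_map 0 A B t = Mor (t {})"
| "tower_of_map (Suc n) A B t =
     Sq (tower_of_map n (upper_cube n A) A (\<lambda>S. edge A S (insert n S)))
        (tower_of_map n (upper_cube n B) B (\<lambda>S. edge B S (insert n S)))
        (tower_of_map n (upper_cube n A) (upper_cube n B) (\<lambda>S. t (insert n S)))
        (tower_of_map n A B t)"

fun tower_of_cube :: "nat \<Rightarrow> ('o, 'a) cube \<Rightarrow> ('o, 'a) tower" where
  "tower_of_cube 0 A = Obj (vert A {})"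
| "tower_of_cube (Suc n) A =
     tower_of_map n (upper_cube n A) A (\<lambda>S. edge A S (insert n S))"

lemma upper_cube_is_cube:
  assumes "is_cube C (Suc n) A"
  shows "is_cube C n (upper_cube n A)" "is_cube C n A"
    "cube_map C n (upper_cube n A) A (\<lambda>S. edge A S (insert n S))"
proof -
  have sub: "insert n S \<subseteq> {..<Suc n}" "S \<subseteq> {..<Suc n}" if "S \<subseteq> {..<n}" for S :: "nat set"
    using that by auto
  have v: "vert A S \<in> Ob C" "edge A S S = ident C (vert A S)" if "S \<subseteq> {..<Suc n}" for S
    using assms that unfolding is_cube_def by simp_all
  have e: "edge A S T \<in> hom C (vert A T) (vert A S)" if "T \<subseteq> {..<Suc n}" "S \<subseteq> T" for S T
    using assms that unfolding is_cube_def by metis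
  have c: "edge A S U = cmp C (edge A S T) (edge A T U)"
    if "U \<subseteq> {..<Suc n}" "T \<subseteq> U" "S \<subseteq> T" for S T U
    using assms that unfolding is_cube_def by metis
  show "is_cube C n (upper_cube n A)"
    unfolding is_cube_def upper_cube_def cube.select_convs
    by (intro conjI allI impI v e c sub insert_mono)
  show "is_cube C n A"
    unfolding is_cube_def by (intro conjI allI impI v e c sub)
  have "cmp C (edge A S (insert n S)) (edge A (insert n S) (insert n T)) =
      cmp C (edge A S T) (edge A T (insert n T))" if "T \<subseteq> {..<n}" "S \<subseteq> T" for S T
    using c[OF sub(1)[OF that(1)], of "insert n S" S] c[OF sub(1)[OF that(1)], of T S] that(2)
    by (metis insert_mono subset_insertI)
  then show "cube_map C n (upper_cube n A) A (\<lambda>S. edge A S (insert n S))"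
    unfolding cube_map_def upper_cube_def cube.select_convs by (intro conjI allI impI e sub subset_insertI) auto
qed

lemma cube_map_upper:
  assumes "cube_map C (Suc n) A B t"
  shows "cube_map C n (upper_cube n A) (upper_cube n B) (\<lambda>S. t (insert n S))" "cube_map C n A B t"
    and "S \<subseteq> {..<n} \<Longrightarrow>
      cmp C (t S) (edge A S (insert n S)) = cmp C (edge B S (insert n S)) (t (insert n S))"
proof -
  have sub: "insert n S \<subseteq> {..<Suc n}" "S \<subseteq> {..<Suc n}" if "S \<subseteq> {..<n}" for S :: "nat set"
    using that by auto
  have h: "t S \<in> hom C (vert A S) (vert B S)" if "S \<subseteq> {..<Suc n}" for S
    using assms that unfolding cube_map_def by metis
  have c: "cmp C (t S) (edge A S T) = cmp C (edge B S T) (t T)"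
    if "T \<subseteq> {..<Suc n}" "S \<subseteq> T" for S T
    using assms that unfolding cube_map_def by metis
  show "cube_map C n (upper_cube n A) (upper_cube n B) (\<lambda>S. t (insert n S))"
    unfolding cube_map_def upper_cube_def cube.select_convs
    by (intro conjI allI impI h c sub insert_mono)
  show "cube_map C n A B t"
    unfolding cube_map_def by (intro conjI allI impI h c sub)
  show "S \<subseteq> {..<n} \<Longrightarrow>
      cmp C (t S) (edge A S (insert n S)) = cmp C (edge B S (insert n S)) (t (insert n S))"
    by (rule c[OF sub(1)]) auto
qed

lemma tower_of_map_cmp:
  "cmp (Arr C n) (tower_of_map n B D s) (tower_of_map n A B t) =
   tower_of_map n A D (\<lambda>S. cmp C (s S) (t S))"
  by (induction n arbitrary: A B D s t) (simp_all add: base_cat_def arr_cat_def)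

lemma tower_of_map_cong:
  "(\<And>S. S \<subseteq> {..<n} \<Longrightarrow> s S = t S) \<Longrightarrow> tower_of_map n A B s = tower_of_map n A B t"
proof (induction n arbitrary: A B s t)
  case (Suc n)
  have 1: "tower_of_map n A B s = tower_of_map n A B t"
    by (rule Suc.IH, rule Suc.prems) auto
  have 2: "tower_of_map n (upper_cube n A) (upper_cube n B) (\<lambda>S. s (insert n S)) =
    tower_of_map n (upper_cube n A) (upper_cube n B) (\<lambda>S. t (insert n S))"
    by (rule Suc.IH, rule Suc.prems) auto
  show ?case using 1 2 by simp
qed simp

lemma tower_of_map_hom:
  assumes "category C" "is_cube C n A" "is_cube C n B" "cube_map C n A B t"
  shows "tower_of_map n A B t \<in> hom (Arr C n) (tower_of_cube n A) (tower_of_cube n B)"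
  using assms(2-)
proof (induction n arbitrary: A B t)
  case 0
  then show ?case by (simp add: base_cat_def hom_def cube_map_def)
next
  case (Suc n)
  note A = upper_cube_is_cube[OF Suc.prems(1)] and B = upper_cube_is_cube[OF Suc.prems(2)]
    and t = cube_map_upper[OF Suc.prems(3)]
  have a: "tower_of_map n (upper_cube n A) A (\<lambda>S. edge A S (insert n S)) \<in>
      hom (Arr C n) (tower_of_cube n (upper_cube n A)) (tower_of_cube n A)"
    by (rule Suc.IH) (rule A)+
  have b: "tower_of_map n (upper_cube n B) B (\<lambda>S. edge B S (insert n S)) \<in>
      hom (Arr C n) (tower_of_cube n (upper_cube n B)) (tower_of_cube n B)"
    by (rule Suc.IH) (rule B)+
  have f1: "tower_of_map n (upper_cube n A) (upper_cube n B) (\<lambda>S. t (insert n S)) \<in>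
      hom (Arr C n) (tower_of_cube n (upper_cube n A)) (tower_of_cube n (upper_cube n B))"
    by (rule Suc.IH) (rule A B t)+
  have f0: "tower_of_map n A B t \<in> hom (Arr C n) (tower_of_cube n A) (tower_of_cube n B)"
    by (rule Suc.IH) (rule A B t)+
  have sq: "tower_of_map n (upper_cube n A) B (\<lambda>S. cmp C (t S) (edge A S (insert n S))) =
    tower_of_map n (upper_cube n A) B (\<lambda>S. cmp C (edge B S (insert n S)) (t (insert n S)))"
    by (rule tower_of_map_cong) (rule t)
  show ?case
    using a b f1 f0 sq by (auto simp: arr_cat_def hom_def tower_of_map_cmp)
qed

lemma tower_of_cube_Ob:
  assumes "category C" "is_cube C n A"
  shows "tower_of_cube n A \<in> Ob (Arr C n)"
proof (cases n)
  case 0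
  then show ?thesis using assms by (simp add: base_cat_def is_cube_def)
next
  case (Suc m)
  then show ?thesis
    using tower_of_map_hom[OF assms(1)] upper_cube_is_cube[of C m A] assms(2)
    by (auto simp: arr_cat_def hom_def)
qed


section \<open>Augmented semi-simplicial objects\<close>

text \<open>Objects are indexed by finite ordinals: \<open>pt A n\<close> is \<open>A\<^bsub>n-1\<^esub>\<close>, so that \<open>pt A 0\<close> is the
  augmentation \<open>A\<^bsub>-1\<^esub>\<close>. The faces keep their usual index: \<open>face A n i\<close> is
  \<open>\<partial>\<^sub>i : A\<^sub>n \<rightarrow> A\<^bsub>n-1\<^esub>\<close> for \<open>i \<le> n\<close>.\<close>

record ('o, 'a) semisimplicial =
  pt :: "nat \<Rightarrow> 'o"
  face :: "nat \<Rightarrow> nat \<Rightarrow> 'a"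

locale augmented_semisimplicial = category C for C :: "('o, 'a) category" +
  fixes A :: "('o, 'a) semisimplicial"
  assumes pt_Ob: "pt A n \<in> Ob C"
    and face_hom: "i \<le> n \<Longrightarrow> face A n i \<in> hom C (pt A (Suc n)) (pt A n)"
    and face_face: "i < j \<Longrightarrow> j \<le> Suc n \<Longrightarrow>
      cmp C (face A n i) (face A (Suc n) j) = cmp C (face A n (j - 1)) (face A (Suc n) i)"

text \<open>An injective order-preserving map \<open>\<phi> : m \<rightarrow> n\<close> of finite ordinals missing exactly
  \<open>i\<^sub>1 < \<dots> < i\<^sub>k\<close> is \<open>\<delta>\<^bsub>i\<^sub>k\<^esub> \<circ> \<dots> \<circ> \<delta>\<^bsub>i\<^sub>1\<^esub>\<close>, where \<open>\<delta>\<^sub>i\<close> misses \<open>i\<close> only; its image is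
  \<open>\<partial>\<^bsub>i\<^sub>1\<^esub> \<circ> \<dots> \<circ> \<partial>\<^bsub>i\<^sub>k\<^esub>\<close>. The lemmas \<open>act_ident\<close>, \<open>act_face\<close> and \<open>act_comp\<close> below show that this
  is the contravariant functor on finite ordinals and injective order-preserving maps
  corresponding to the object.\<close>

primrec faces :: "('o, 'a) category \<Rightarrow> ('o, 'a) semisimplicial \<Rightarrow> nat \<Rightarrow> nat list \<Rightarrow> 'a" where
  "faces C A m [] = ident C (pt A m)"
| "faces C A m (i # is) = cmp C (face A m i) (faces C A (Suc m) is)"

definition act ::
    "('o, 'a) category \<Rightarrow> ('o, 'a) semisimplicial \<Rightarrow> nat \<Rightarrow> nat \<Rightarrow> (nat \<Rightarrow> nat) \<Rightarrow> 'a" where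
  "act C A m n \<phi> = faces C A m (sorted_list_of_set ({..<n} - \<phi> ` {..<m}))"

definition ord_inj :: "nat \<Rightarrow> nat \<Rightarrow> (nat \<Rightarrow> nat) \<Rightarrow> bool" where
  "ord_inj m n \<phi> \<longleftrightarrow> strict_mono_on {..<m} \<phi> \<and> \<phi> ` {..<m} \<subseteq> {..<n}"

text \<open>The map \<open>|S| \<rightarrow> |T|\<close> obtained from \<open>S \<subseteq> T\<close>: it sends \<open>k\<close> to the position in \<open>T\<close> of the
  \<open>k\<close>-th element of \<open>S\<close>.\<close>

definition incl_map :: "nat set \<Rightarrow> nat set \<Rightarrow> nat \<Rightarrow> nat" where
  "incl_map S T k = card {y \<in> T. y < sorted_list_of_set S ! k}"

text \<open>This cube does not depend on \<open>n\<close>, which only determines at which sets it is evaluated.\<close>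

definition arr_cube ::
    "('o, 'a) category \<Rightarrow> ('o, 'a) semisimplicial \<Rightarrow> ('o, 'a) cube" where
  "arr_cube C A =
    \<lparr>vert = (\<lambda>S. pt A (card S)),
     edge = (\<lambda>S T. act C A (card S) (card T) (incl_map S T))\<rparr>"

definition arr :: "('o, 'a) category \<Rightarrow> nat \<Rightarrow> ('o, 'a) semisimplicial \<Rightarrow> ('o, 'a) tower" where
  "arr C n A = tower_of_cube n (arr_cube C A)"

text \<open>\<open>skip L i\<close> is the \<open>i\<close>-th natural number outside the increasing list \<open>L\<close>. Thus \<open>ins i L\<close>
  lists the numbers missed by \<open>\<psi> \<circ> \<delta>\<^sub>i\<close> if \<open>L\<close> lists those missed by \<open>\<psi>\<close>.\<close>

primrec skip :: "nat list \<Rightarrow> nat \<Rightarrow> nat" where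
  "skip [] i = i"
| "skip (j # L) i = (if i < j then i else skip L (Suc i))"

primrec ins :: "nat \<Rightarrow> nat list \<Rightarrow> nat list" where
  "ins i [] = [i]"
| "ins i (j # L) = (if i < j then i # j # L else j # ins (Suc i) L)"

lemma skip_ge: "i \<le> skip L i"
proof (induction L arbitrary: i)
  case (Cons j L)
  show ?case using Cons[of "Suc i"] by auto
qed simp

lemma set_ins: "set (ins i L) = insert (skip L i) (set L)"
  by (induction L arbitrary: i) auto

lemma sorted_ins: "sorted_wrt (<) L \<Longrightarrow> sorted_wrt (<) (ins i L)"
proof (induction L arbitrary: i)
  case (Cons j L)
  then show ?case using skip_ge[of "Suc i" L] by (fastforce simp: set_ins)
qed simp

lemma skip_notin: "sorted_wrt (<) L \<Longrightarrow> skip L i \<notin> set L"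
proof (induction L arbitrary: i)
  case (Cons j L)
  then show ?case using skip_ge[of "Suc i" L] Cons.IH[of "Suc i"] by auto
qed simp

lemma card_skip: "sorted_wrt (<) L \<Longrightarrow> card ({..<skip L i} - set L) = i"
proof (induction L arbitrary: i)
  case (Cons j L)
  show ?case
  proof (cases "i < j")
    case True
    then have "{..<i} - set (j # L) = {..<i}" using Cons.prems by fastforce
    then show ?thesis using True by simp
  next
    case False
    let ?B = "{..<skip L (Suc i)} - set L"
    have "j \<in> ?B" using False Cons.prems skip_ge[of "Suc i" L] by fastforce
    moreover have "{..<skip L (Suc i)} - set (j # L) = ?B - {j}" by auto
    moreover have "card ?B = Suc i" using Cons by simp
    ultimately show ?thesis using False by (simp add: card_Diff_singleton)
  qed
qed simp

lemma rank_unique: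
  fixes x y :: nat
  assumes "x \<notin> M" "y \<notin> M" "card ({..<x} - M) = card ({..<y} - M)"
  shows "x = y"
proof -
  have *: "card ({..<x} - M) < card ({..<y} - M)" if "x < y" "x \<notin> M" for x y :: nat
    by (rule psubset_card_mono) (use that in auto)
  show ?thesis using *[of x y] *[of y x] assms by (metis less_irrefl linorder_neqE_nat)
qed

lemma skip_eqI: "sorted_wrt (<) L \<Longrightarrow> x \<notin> set L \<Longrightarrow> card ({..<x} - set L) = i \<Longrightarrow> skip L i = x"
  by (rule rank_unique[of _ "set L"]) (simp_all add: skip_notin card_skip)

lemma ord_inj_rank:
  assumes "ord_inj m n \<phi>" "i < m"
  shows "card ({..<\<phi> i} - ({..<n} - \<phi> ` {..<m})) = i"
proof -
  have sm: "strict_mono_on {..<m} \<phi>" and im: "\<phi> ` {..<m} \<subseteq> {..<n}"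
    using assms by (auto simp: ord_inj_def)
  have less: "\<phi> k < \<phi> i \<longleftrightarrow> k < i" if "k < m" for k
    using that assms(2) strict_mono_onD[OF sm, of k i] strict_mono_onD[OF sm, of i k]
    by (cases k i rule: linorder_cases) auto
  have "{..<\<phi> i} - ({..<n} - \<phi> ` {..<m}) = \<phi> ` {..<i}" (is "?L = ?R")
  proof
    show "?L \<subseteq> ?R"
    proof
      fix y assume y: "y \<in> ?L"
      have "\<phi> i < n" using im assms(2) by auto
      then obtain k where k: "k < m" "y = \<phi> k" using y by auto
      have "k < i"
        using y k less by auto
      then show "y \<in> ?R" using k by auto
    qed
    show "?R \<subseteq> ?L"
    proof
      fix y assume "y \<in> ?R"
      then obtain k where k: "k < i" "y = \<phi> k" by blast
      then have "k < m" using assms(2) by simp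
      then show "y \<in> ?L" using k less[of k] by simp
    qed
  qed
  moreover have "inj_on \<phi> {..<i}"
    by (rule inj_on_subset[OF strict_mono_on_imp_inj_on[OF sm]]) (use assms(2) in auto)
  ultimately show ?thesis by (simp add: card_image)
qed

lemma ord_inj_skip:
  assumes "ord_inj m n \<phi>" "i < m"
  shows "\<phi> i = skip (sorted_list_of_set ({..<n} - \<phi> ` {..<m})) i"
  by (rule skip_eqI[symmetric]) (use assms ord_inj_rank[OF assms] in auto)

lemma skip_strict_mono: 
  assumes "sorted_wrt (<) L" "i < j" shows "skip L i < skip L j"
proof (rule ccontr)
  assume "\<not> ?thesis"
  then have "card ({..<skip L j} - set L) \<le> card ({..<skip L i} - set L)"
    by (intro card_mono) auto
  then show False using assms by (simp add: card_skip)
qed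

lemma ord_inj_card:
  assumes "ord_inj m n \<phi>" shows "m + card ({..<n} - \<phi> ` {..<m}) = n"
proof -
  have "inj_on \<phi> {..<m}" "\<phi> ` {..<m} \<subseteq> {..<n}"
    using assms strict_mono_on_imp_inj_on by (auto simp: ord_inj_def)
  moreover from this have "m \<le> n"
    by (metis card_image card_lessThan card_mono finite_lessThan)
  ultimately show ?thesis by (simp add: card_Diff_subset card_image)
qed

context augmented_semisimplicial
begin

lemma faces_hom:
  assumes "sorted_wrt (<) L" "set L \<subseteq> {..<m + length L}"
  shows "faces C A m L \<in> hom C (pt A (m + length L)) (pt A m)"
  using assms
proof (induction L arbitrary: m)
  case Nil
  then show ?case by (simp add: ident_hom pt_Ob)
next
  case (Cons i L)
  have "i \<le> m"
  proof -
    have "card (set (i # L)) = length (i # L)"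
      using Cons.prems(1) by (metis distinct_card strict_sorted_iff)
    moreover have "set (i # L) \<subseteq> {i..<m + length (i # L)}"
      using Cons.prems by fastforce
    ultimately have "length (i # L) \<le> m + length (i # L) - i"
      by (metis card_mono finite_atLeastLessThan card_atLeastLessThan)
    then show ?thesis by simp
  qed
  moreover have "faces C A (Suc m) L \<in> hom C (pt A (Suc m + length L)) (pt A (Suc m))"
    by (rule Cons.IH) (use Cons.prems in auto)
  ultimately show ?case by (auto intro: cmp_hom face_hom)
qed

lemma face_faces:
  assumes "sorted_wrt (<) L" "set L \<subseteq> {..<Suc m + length L}" "i \<le> m"
  shows "cmp C (face A m i) (faces C A (Suc m) L) = faces C A m (ins i L)"
  using assms
proof (induction L arbitrary: m i)
  case (Cons j L)
  show ?case
  proof (cases "i < j")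
    case False
    have L: "faces C A (Suc (Suc m)) L \<in> hom C (pt A (Suc (Suc m) + length L)) (pt A (Suc (Suc m)))"
      by (rule faces_hom) (use Cons.prems in auto)
    have "cmp C (face A m i) (faces C A (Suc m) (j # L)) =
        cmp C (cmp C (face A m i) (face A (Suc m) j)) (faces C A (Suc (Suc m)) L)"
      using Cons.prems False L cmp_assoc[OF L face_hom face_hom, of j i] by simp
    also have "\<dots> = cmp C (cmp C (face A m j) (face A (Suc m) (Suc i))) (faces C A (Suc (Suc m)) L)"
      using face_face[of j "Suc i" m] Cons.prems False by simp
    also have "\<dots> = cmp C (face A m j) (cmp C (face A (Suc m) (Suc i)) (faces C A (Suc (Suc m)) L))"
      using Cons.prems False L cmp_assoc[OF L face_hom face_hom, of "Suc i" j] by simp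
    also have "cmp C (face A (Suc m) (Suc i)) (faces C A (Suc (Suc m)) L) = faces C A (Suc m) (ins (Suc i) L)"
      by (rule Cons.IH) (use Cons.prems in auto)
    finally show ?thesis using False by simp
  qed simp
qed simp

lemma faces_faces:
  assumes "sorted_wrt (<) L" "set L \<subseteq> {..<m + length L}"
    and "sorted_wrt (<) M" "set M \<subseteq> {..<m + length L + length M}"
  shows "cmp C (faces C A m L) (faces C A (m + length L) M) =
    faces C A m (sorted_list_of_set (skip M ` set L \<union> set M))"
  using assms
proof (induction L arbitrary: m)
  case Nil
  moreover have "faces C A m M \<in> hom C (pt A (m + length M)) (pt A m)"
    by (rule faces_hom) (use Nil in auto)
  ultimately show ?case
    by (simp add: cmp_ident_left sorted_list_of_set.idem_if_sorted_distinct strict_sorted_iff)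
next
  case (Cons i L)
  let ?S = "skip M ` set L \<union> set M"
  let ?N = "sorted_list_of_set ?S"
  have cL: "card (set (i # L)) = length (i # L)"
    using Cons.prems(1) by (metis distinct_card strict_sorted_iff)
  have im: "i \<le> m"
  proof -
    have "set (i # L) \<subseteq> {i..<m + length (i # L)}"
      using Cons.prems by fastforce
    then have "length (i # L) \<le> m + length (i # L) - i"
      using cL by (metis card_mono finite_atLeastLessThan card_atLeastLessThan)
    then show ?thesis by simp
  qed
  have less: "skip M i < skip M l" if "l \<in> set L" for l
    using that Cons.prems skip_strict_mono by auto
  have hL: "faces C A (Suc m) L \<in> hom C (pt A (m + length (i # L))) (pt A (Suc m))"
    using faces_hom[of L "Suc m"] Cons.prems by simp
  have hM: "faces C A (m + length (i # L)) M \<in>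
      hom C (pt A (m + length (i # L) + length M)) (pt A (m + length (i # L)))"
    using faces_hom[of M "m + length (i # L)"] Cons.prems by simp
  have IH: "cmp C (faces C A (Suc m) L) (faces C A (m + length (i # L)) M) = faces C A (Suc m) ?N"
    using Cons.IH[of "Suc m"] Cons.prems by simp
  have inj: "inj_on (skip M) X" for X
    using skip_strict_mono[OF Cons.prems(3)] by (metis inj_onI linorder_neqE_nat less_irrefl)
  have disj: "skip M ` X \<inter> set M = {}" for X
    using skip_notin[OF Cons.prems(3)] by auto
  have cS: "card ?S = length L + length M"
  proof -
    have "card (set M) = length M" "card (set L) = length L"
      using Cons.prems by (metis distinct_card strict_sorted_iff) (use cL Cons.prems in auto)
    then show ?thesis using disj[of "set L"] inj by (simp add: card_Un_disjoint card_image)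
  qed
  have skip_bound: "skip M l < n + length M" if "l < n" for l n
  proof -
    have "skip M l \<le> l + card (set M)"
    proof -
      have "card {..<skip M l} \<le> card (({..<skip M l} - set M) \<union> set M)"
        by (rule card_mono) auto
      also have "\<dots> \<le> l + card (set M)"
        using card_Un_le[of "{..<skip M l} - set M" "set M"] card_skip[OF Cons.prems(3), of l] by simp
      finally show ?thesis by simp
    qed
    then show ?thesis using that card_length[of M] by linarith
  qed
  have SB: "?S \<subseteq> {..<Suc m + length ?N}"
    using Cons.prems skip_bound[of _ "Suc m + length L"] cS by (auto simp: add.assoc)
  have sk: "skip ?N i = skip M i"
  proof (rule skip_eqI)
    have "{..<skip M i} - set ?N = {..<skip M i} - set M"
      using less by fastforce
    then show "card ({..<skip M i} - set ?N) = i"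
      using card_skip Cons.prems by simp
    show "skip M i \<notin> set ?N" using less skip_notin[OF Cons.prems(3)] by fastforce
  qed simp
  have "cmp C (faces C A m (i # L)) (faces C A (m + length (i # L)) M) =
      cmp C (face A m i) (faces C A (Suc m) ?N)"
    using cmp_assoc[OF hM hL face_hom[OF im]] IH by simp
  also have "\<dots> = faces C A m (ins i ?N)"
    by (rule face_faces) (use SB im in simp_all)
  also have "ins i ?N = sorted_list_of_set (skip M ` set (i # L) \<union> set M)"
  proof -
    have "set (ins i ?N) = skip M ` set (i # L) \<union> set M"
      using sk by (simp add: set_ins)
    moreover have "sorted_wrt (<) (ins i ?N)" by (simp add: sorted_ins)
    ultimately show ?thesis
      by (metis sorted_list_of_set.idem_if_sorted_distinct strict_sorted_iff)
  qed
  finally show ?case .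
qed

lemma act_hom:
  assumes "ord_inj m n \<phi>"
  shows "act C A m n \<phi> \<in> hom C (pt A n) (pt A m)"
  using faces_hom[of "sorted_list_of_set ({..<n} - \<phi> ` {..<m})" m] ord_inj_card[OF assms]
  by (auto simp: act_def)

lemma act_ident: "act C A n n (\<lambda>k. k) = ident C (pt A n)"
  by (simp add: act_def)

lemma act_face:
  assumes "i \<le> n"
  shows "act C A n (Suc n) (\<lambda>k. if k < i then k else Suc k) = face A n i"
proof -
  let ?f = "\<lambda>k. if k < i then k else Suc k"
  have "{..<Suc n} - ?f ` {..<n} = {i}"
  proof -
    have "x \<in> ?f ` {..<n}" if "x < Suc n" "x \<noteq> i" for x
    proof (cases "x < i")
      case True
      then show ?thesis using assms by (intro image_eqI[of _ _ x]) auto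
    next
      case False
      then show ?thesis using that by (intro image_eqI[of _ _ "x - 1"]) auto
    qed
    then show ?thesis using assms by (auto split: if_splits)
  qed
  then show ?thesis using cmp_ident_right[OF face_hom[OF assms]] by (simp add: act_def)
qed

lemma act_comp:
  assumes "ord_inj m n \<phi>" "ord_inj n p \<psi>"
  shows "act C A m p (\<psi> \<circ> \<phi>) = cmp C (act C A m n \<phi>) (act C A n p \<psi>)"
proof -
  let ?L = "sorted_list_of_set ({..<n} - \<phi> ` {..<m})"
  let ?M = "sorted_list_of_set ({..<p} - \<psi> ` {..<n})"
  have n: "m + length ?L = n" and p: "n + length ?M = p"
    using assms[THEN ord_inj_card] by simp_all
  have im: "\<phi> ` {..<m} \<subseteq> {..<n}" "\<psi> ` {..<n} \<subseteq> {..<p}" and inj: "inj_on \<psi> {..<n}"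
    using assms strict_mono_on_imp_inj_on by (auto simp: ord_inj_def)
  have "skip ?M ` set ?L = \<psi> ` set ?L"
    by (intro image_cong refl ord_inj_skip[OF assms(2), symmetric]) simp
  also have "\<dots> = \<psi> ` {..<n} - \<psi> ` \<phi> ` {..<m}"
    using im by (simp add: inj_on_image_set_diff[OF inj])
  finally have "skip ?M ` set ?L \<union> set ?M = {..<p} - (\<psi> \<circ> \<phi>) ` {..<m}"
    using im by (auto simp: image_comp)
  then show ?thesis using faces_faces[of ?L m ?M] n p by (auto simp: act_def)
qed

lemma act_cong:
  assumes "\<And>k. k < m \<Longrightarrow> \<phi> k = \<psi> k"
  shows "act C A m n \<phi> = act C A m n \<psi>"
  using assms by (simp add: act_def cong: image_cong_simp)

end

lemma sorted_list_nth_rank: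
  assumes "finite S" "x \<in> S"
  shows "sorted_list_of_set S ! card {y \<in> S. y < x} = x"
proof -
  let ?L = "sorted_list_of_set S"
  have set: "set ?L = S" using assms by simp
  obtain k where k: "k < length ?L" "?L ! k = x"
    using assms(2) by (metis set in_set_conv_nth)
  have less: "?L ! l < ?L ! k \<longleftrightarrow> l < k" if "l < length ?L" for l
    using that k sorted_wrt_nth_less[OF sorted_list_of_set.strict_sorted_key_list_of_set, of l k S]
      sorted_wrt_nth_less[OF sorted_list_of_set.strict_sorted_key_list_of_set, of k l S]
    by (cases l k rule: linorder_cases) auto
  have "{y \<in> S. y < x} = (!) ?L ` {..<k}"
  proof (intro equalityI subsetI)
    fix y assume "y \<in> {y \<in> S. y < x}"
    then have "y \<in> set ?L" "y < x" by (simp_all add: set)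
    then obtain l where "l < length ?L" "?L ! l = y"
      unfolding in_set_conv_nth by blast
    then show "y \<in> (!) ?L ` {..<k}" using less[of l] k \<open>y < x\<close> by blast
  next
    fix y assume "y \<in> (!) ?L ` {..<k}"
    then obtain l where l: "l < k" "y = ?L ! l" by blast
    then have "l < length ?L" using k by simp
    then have "y \<in> set ?L" "y < x" using l less[of l] k by simp_all
    then show "y \<in> {y \<in> S. y < x}" by (simp add: set)
  qed
  moreover have "inj_on ((!) ?L) {..<k}"
    using k by (intro inj_on_nth) auto
  ultimately show ?thesis using k by (simp add: card_image)
qed

lemma incl_map_ord_inj:
  assumes "finite T" "S \<subseteq> T"
  shows "ord_inj (card S) (card T) (incl_map S T)"
proof -
  have fS: "finite S" using assms finite_subset by auto
  have in_S: "sorted_list_of_set S ! k \<in> T" if "k < card S" for k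
    using that fS assms nth_mem[of k "sorted_list_of_set S"] by auto
  have "incl_map S T k < incl_map S T l" if "k < l" "l < card S" for k l
    unfolding incl_map_def
  proof (rule psubset_card_mono)
    have "sorted_list_of_set S ! k < sorted_list_of_set S ! l"
      using that fS sorted_wrt_nth_less[of "(<)" "sorted_list_of_set S" k l] by simp
    then show "{y \<in> T. y < sorted_list_of_set S ! k} \<subset> {y \<in> T. y < sorted_list_of_set S ! l}"
      using in_S[of k] that by force
  qed (use assms in simp)
  moreover have "incl_map S T k < card T" if "k < card S" for k
    unfolding incl_map_def by (rule psubset_card_mono) (use assms in_S[OF that] in auto)
  ultimately show ?thesis by (auto simp: ord_inj_def strict_mono_on_def)
qed

lemma sorted_list_nth_incl_map:
  assumes "finite T" "S \<subseteq> T" "k < card S"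
  shows "sorted_list_of_set T ! incl_map S T k = sorted_list_of_set S ! k"
proof -
  have "finite S" using assms finite_subset by auto
  then have "sorted_list_of_set S ! k \<in> T"
    using assms nth_mem[of k "sorted_list_of_set S"] by auto
  then show ?thesis unfolding incl_map_def by (rule sorted_list_nth_rank[OF assms(1)])
qed

lemma incl_map_comp:
  assumes "finite T" "S \<subseteq> T" "k < card S"
  shows "incl_map S U k = incl_map T U (incl_map S T k)"
  using sorted_list_nth_incl_map[OF assms] by (simp add: incl_map_def)

lemma incl_map_refl:
  assumes "finite S" "k < card S"
  shows "incl_map S S k = k"
  using sorted_list_nth_incl_map[OF assms(1) order_refl assms(2)] assms
    incl_map_ord_inj[OF assms(1) order_refl]
  by (auto simp: ord_inj_def nth_eq_iff_index_eq)

lemma (in augmented_semisimplicial) arr_cube_is_cube: "is_cube C n (arr_cube C A)"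
proof -
  have fin: "finite T" if "T \<subseteq> {..<n}" for T :: "nat set"
    using that finite_subset by auto
  have "act C A (card S) (card S) (incl_map S S) = ident C (pt A (card S))"
    if "S \<subseteq> {..<n}" for S
    using act_cong[of "card S" "incl_map S S" "\<lambda>k. k"] incl_map_refl[OF fin[OF that]]
    by (simp add: act_ident)
  moreover have "act C A (card S) (card T) (incl_map S T) \<in> hom C (pt A (card T)) (pt A (card S))"
    if "T \<subseteq> {..<n}" "S \<subseteq> T" for S T
    using that fin act_hom incl_map_ord_inj by blast
  moreover have "act C A (card S) (card U) (incl_map S U) =
      cmp C (act C A (card S) (card T) (incl_map S T)) (act C A (card T) (card U) (incl_map T U))"
    if "U \<subseteq> {..<n}" "T \<subseteq> U" "S \<subseteq> T" for S T U
  proof -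
    have "finite U" "finite T" using that fin by auto
    then show ?thesis
      using act_comp[OF incl_map_ord_inj[of T S] incl_map_ord_inj[of U T]] that
        act_cong[of "card S" "incl_map S U" "incl_map T U \<circ> incl_map S T" "card U"]
        incl_map_comp[of T S _ U]
      by simp
  qed
  ultimately show ?thesis
    unfolding is_cube_def arr_cube_def cube.select_convs by (intro conjI allI impI pt_Ob)
qed


section \<open>Resolutions\<close>

text \<open>\<open>K\<close> with \<open>k\<^sub>0, \<dots>, k\<^bsub>n+1\<^esub>\<close> is a simplicial kernel of \<open>f\<^sub>0, \<dots>, f\<^sub>n : X \<rightarrow> Y\<close>.\<close>

definition kernel_cone :: "('o, 'a) category \<Rightarrow> 'o \<Rightarrow> nat \<Rightarrow> (nat \<Rightarrow> 'a) \<Rightarrow>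
    'o \<Rightarrow> (nat \<Rightarrow> 'a) \<Rightarrow> bool" where
  "kernel_cone C X n f K k \<longleftrightarrow>
     K \<in> Ob C \<and> (\<forall>i \<le> n + 1. k i \<in> hom C K X) \<and>
     (\<forall>i j. i < j \<and> j \<le> n + 1 \<longrightarrow> cmp C (f i) (k j) = cmp C (f (j - 1)) (k i))"

definition simplicial_kernel :: "('o, 'a) category \<Rightarrow> 'o \<Rightarrow> 'o \<Rightarrow> nat \<Rightarrow> (nat \<Rightarrow> 'a) \<Rightarrow>
    'o \<Rightarrow> (nat \<Rightarrow> 'a) \<Rightarrow> bool" where
  "simplicial_kernel C X Y n f K k \<longleftrightarrow>
     (\<forall>i \<le> n. f i \<in> hom C X Y) \<and> kernel_cone C X n f K k \<and>
     (\<forall>Z g. kernel_cone C X n f Z g \<longrightarrow>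
        (\<exists>!u. u \<in> hom C Z K \<and> (\<forall>i \<le> n + 1. cmp C (k i) u = g i)))"

text \<open>The second conjunct is the condition on \<open>A\<^sub>n \<rightarrow> K\<^sub>n\<close> for \<open>n = m + 1\<close>, where \<open>K\<^sub>n\<close> is the
  simplicial kernel of \<open>\<partial>\<^sub>0, \<dots>, \<partial>\<^sub>m : A\<^sub>m \<rightarrow> A\<^bsub>m-1\<^esub>\<close>.\<close>

definition is_resolution ::
    "('o, 'a) category \<Rightarrow> 'a set \<Rightarrow> ('o, 'a) semisimplicial \<Rightarrow> bool" where
  "is_resolution C E A \<longleftrightarrow>
     face A 0 0 \<in> E \<and>
     (\<forall>m. \<exists>K k u. simplicial_kernel C (pt A (Suc m)) (pt A m) m (face A m) K k \<and>
        u \<in> hom C (pt A (Suc (Suc m))) K \<and>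
        (\<forall>i \<le> m + 1. cmp C (k i) u = face A (Suc m) i) \<and> u \<in> E)"

end

theory Submission
  imports Defs
begin

text \<open>An \<open>n\<close>-cube \<open>A\<close> is an \<open>n\<close>-fold extension if and only if, for every nonempty \<open>S \<subseteq> n\<close>, the limit of
  \<open>A\<close> over the proper subsets of \<open>S\<close> exists and the comparison of \<open>A\<^sub>S\<close> with it lies in \<open>E\<close>. This is
  shown by induction on \<open>n\<close>: splitting off two directions writes a cube as a square of smaller
  cubes, and the limit belonging to the comparison morphism of the square is the limit over the
  boundary of the whole cube. For the cube of a semi-simplicial object the limit over the boundary
  of \<open>S\<close> is the simplicial kernel \<open>K\<^bsub>|S|-1\<^esub>\<close>.\<close>


section \<open>Cubes on finite sets and limits over their boundary\<close>

text \<open>\<open>E_iter C E (Suc n)\<close> refers to a pullback in the full subcategory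
  \<open>Ext C E n\<close>, which a priori need not be computed pointwise. So the pointwise pullback
  is constructed and shown to be an extension again; it is then a pullback in
  \<open>Ext C E n\<close>, and any other one is isomorphic to it.

  Two facts about comparisons make this work with (E1)--(E3) alone. For a map of cubes
  \<open>t\<close> from \<open>A\<close> to \<open>B\<close>, the comparison at \<open>S\<close>
  goes to the pullback of \<open>vert B S\<close> and the boundary of \<open>A\<close> over the
  boundary of \<open>B\<close>. The projection of this pullback to the boundary of \<open>A\<close>
  is a base change of the comparison of \<open>B\<close>, so goodness passes from the target and the
  map to the source. And when a map of cubes is pulled back, its comparisons are pulled back too, so
  goodness of maps is stable under base change.

  Iterated arrows single out the last direction, whereas the condition on subsets is symmetric in
  all directions. This symmetry is what gives the condition for the upper side of a square.\<close>

definition cube_on :: "('o, 'a) category \<Rightarrow> nat set \<Rightarrow> ('o, 'a) cube \<Rightarrow> bool" where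
  "cube_on C V A \<longleftrightarrow>
     (\<forall>S \<subseteq> V. vert A S \<in> Ob C \<and> edge A S S = ident C (vert A S)) \<and>
     (\<forall>T \<subseteq> V. \<forall>S \<subseteq> T. edge A S T \<in> hom C (vert A T) (vert A S)) \<and>
     (\<forall>U \<subseteq> V. \<forall>T \<subseteq> U. \<forall>S \<subseteq> T. edge A S U = cmp C (edge A S T) (edge A T U))"

definition map_on ::
    "('o, 'a) category \<Rightarrow> nat set \<Rightarrow> ('o, 'a) cube \<Rightarrow> ('o, 'a) cube \<Rightarrow> (nat set \<Rightarrow> 'a) \<Rightarrow> bool" where
  "map_on C V A B t \<longleftrightarrow>
     (\<forall>S \<subseteq> V. t S \<in> hom C (vert A S) (vert B S)) \<and>
     (\<forall>T \<subseteq> V. \<forall>S \<subseteq> T. cmp C (t S) (edge A S T) = cmp C (edge B S T) (t T))"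

text \<open>The inductions below remove an arbitrary direction from an arbitrary subset, so cubes
  are indexed by any set of directions; initial segments return only where towers enter.\<close>

lemma is_cube_iff_cube_on: "is_cube C n A \<longleftrightarrow> cube_on C {..<n} A"
  by (simp add: is_cube_def cube_on_def)

lemma cube_map_iff_map_on: "cube_map C n A B t \<longleftrightarrow> map_on C {..<n} A B t"
  by (simp add: cube_map_def map_on_def)

lemma cube_onD:
  assumes "cube_on C V A"
  shows "S \<subseteq> V \<Longrightarrow> vert A S \<in> Ob C"
    and "S \<subseteq> V \<Longrightarrow> edge A S S = ident C (vert A S)"
    and "T \<subseteq> V \<Longrightarrow> S \<subseteq> T \<Longrightarrow> edge A S T \<in> hom C (vert A T) (vert A S)"
    and "U \<subseteq> V \<Longrightarrow> T \<subseteq> U \<Longrightarrow> S \<subseteq> T \<Longrightarrow> cmp C (edge A S T) (edge A T U) = edge A S U"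
  using assms unfolding cube_on_def by (simp, simp, metis, metis)

lemma cube_onI:
  assumes "\<And>S. S \<subseteq> V \<Longrightarrow> vert A S \<in> Ob C"
    and "\<And>S. S \<subseteq> V \<Longrightarrow> edge A S S = ident C (vert A S)"
    and "\<And>S T. T \<subseteq> V \<Longrightarrow> S \<subseteq> T \<Longrightarrow> edge A S T \<in> hom C (vert A T) (vert A S)"
    and "\<And>S T U. U \<subseteq> V \<Longrightarrow> T \<subseteq> U \<Longrightarrow> S \<subseteq> T \<Longrightarrow>
      cmp C (edge A S T) (edge A T U) = edge A S U"
  shows "cube_on C V A"
  using assms unfolding cube_on_def by simp

lemma map_onD:
  assumes "map_on C V A B t"
  shows "S \<subseteq> V \<Longrightarrow> t S \<in> hom C (vert A S) (vert B S)"
    and "T \<subseteq> V \<Longrightarrow> S \<subseteq> T \<Longrightarrow> cmp C (t S) (edge A S T) = cmp C (edge B S T) (t T)"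
  using assms unfolding map_on_def by (metis, metis)

lemma map_onI:
  assumes "\<And>S. S \<subseteq> V \<Longrightarrow> t S \<in> hom C (vert A S) (vert B S)"
    and "\<And>S T. T \<subseteq> V \<Longrightarrow> S \<subseteq> T \<Longrightarrow> cmp C (t S) (edge A S T) = cmp C (edge B S T) (t T)"
  shows "map_on C V A B t"
  using assms unfolding map_on_def by simp

section \<open>Faces of a cube and the map in a chosen direction\<close>

lemma cube_on_subset: "cube_on C V A \<Longrightarrow> W \<subseteq> V \<Longrightarrow> cube_on C W A"
  by (rule cube_onI) (auto intro: cube_onD)

lemma map_on_subset: "map_on C V A B t \<Longrightarrow> W \<subseteq> V \<Longrightarrow> map_on C W A B t"
  by (rule map_onI) (auto intro: map_onD)

lemma vert_upper_cube [simp]: "vert (upper_cube k A) S = vert A (insert k S)"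
  and edge_upper_cube [simp]: "edge (upper_cube k A) S T = edge A (insert k S) (insert k T)"
  by (simp_all add: upper_cube_def)

lemma cube_on_upper_cube: "cube_on C (insert k V) A \<Longrightarrow> cube_on C V (upper_cube k A)"
  by (rule cube_onI) (auto intro!: cube_onD)

lemma map_on_edge:
  assumes "cube_on C (insert k V) A"
  shows "map_on C V (upper_cube k A) A (\<lambda>S. edge A S (insert k S))"
proof (rule map_onI)
  show "edge A S (insert k S) \<in> hom C (vert (upper_cube k A) S) (vert A S)" if "S \<subseteq> V" for S
    using that cube_onD(3)[OF assms, of "insert k S" S] by auto
  show "cmp C (edge A S (insert k S)) (edge (upper_cube k A) S T) =
    cmp C (edge A S T) (edge A T (insert k T))" if "T \<subseteq> V" "S \<subseteq> T" for S T
  proof -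
    have *: "insert k T \<subseteq> insert k V" "insert k S \<subseteq> insert k T" "T \<subseteq> insert k T"
      "S \<subseteq> insert k S" using that by auto
    show ?thesis
      using cube_onD(4)[OF assms *(1,2,4)] cube_onD(4)[OF assms *(1,3) that(2)] by simp
  qed
qed

text \<open>Cones on the boundary of the cube of subsets of \<open>S\<close>, given by their components at the
  maximal proper subsets. Since two of these meet in a set of codimension two, this amounts to a
  cone on all proper subsets if \<open>S\<close> has at least two elements.\<close>

definition bd_cone :: "('o, 'a) category \<Rightarrow> ('o, 'a) cube \<Rightarrow> nat set \<Rightarrow> 'o \<Rightarrow> (nat \<Rightarrow> 'a) \<Rightarrow> bool"
  where
  "bd_cone C A S Z z \<longleftrightarrow>
     Z \<in> Ob C \<and> (\<forall>i \<in> S. z i \<in> hom C Z (vert A (S - {i}))) \<and>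
     (\<forall>i \<in> S. \<forall>j \<in> S. i \<noteq> j \<longrightarrow>
        cmp C (edge A (S - {i, j}) (S - {i})) (z i) = cmp C (edge A (S - {i, j}) (S - {j})) (z j))"

definition bd_lim :: "('o, 'a) category \<Rightarrow> ('o, 'a) cube \<Rightarrow> nat set \<Rightarrow> 'o \<Rightarrow> (nat \<Rightarrow> 'a) \<Rightarrow> bool"
  where
  "bd_lim C A S L l \<longleftrightarrow> bd_cone C A S L l \<and>
     (\<forall>Z z. bd_cone C A S Z z \<longrightarrow> (\<exists>!u. u \<in> hom C Z L \<and> (\<forall>i \<in> S. cmp C (l i) u = z i)))"

definition good :: "('o, 'a) category \<Rightarrow> 'a set \<Rightarrow> ('o, 'a) cube \<Rightarrow> nat set \<Rightarrow> bool" where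
  "good C E A S \<longleftrightarrow> (\<exists>L l u. bd_lim C A S L l \<and> u \<in> hom C (vert A S) L \<and>
     (\<forall>i \<in> S. cmp C (l i) u = edge A (S - {i}) S) \<and> u \<in> E)"

text \<open>The same for the cube obtained from a map \<open>t : A \<rightarrow> B\<close> by adding a new element to \<open>S\<close>;
  \<open>z0\<close> is the component at the face \<open>B\<close>.\<close>

definition rel_cone :: "('o, 'a) category \<Rightarrow> ('o, 'a) cube \<Rightarrow> ('o, 'a) cube \<Rightarrow> (nat set \<Rightarrow> 'a) \<Rightarrow>
    nat set \<Rightarrow> 'o \<Rightarrow> 'a \<Rightarrow> (nat \<Rightarrow> 'a) \<Rightarrow> bool" where
  "rel_cone C A B t S Z z0 z \<longleftrightarrow>
     bd_cone C A S Z z \<and> z0 \<in> hom C Z (vert B S) \<and>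
     (\<forall>i \<in> S. cmp C (t (S - {i})) (z i) = cmp C (edge B (S - {i}) S) z0)"

definition rel_lim :: "('o, 'a) category \<Rightarrow> ('o, 'a) cube \<Rightarrow> ('o, 'a) cube \<Rightarrow> (nat set \<Rightarrow> 'a) \<Rightarrow>
    nat set \<Rightarrow> 'o \<Rightarrow> 'a \<Rightarrow> (nat \<Rightarrow> 'a) \<Rightarrow> bool" where
  "rel_lim C A B t S L l0 l \<longleftrightarrow> rel_cone C A B t S L l0 l \<and>
     (\<forall>Z z0 z. rel_cone C A B t S Z z0 z \<longrightarrow>
        (\<exists>!u. u \<in> hom C Z L \<and> cmp C l0 u = z0 \<and> (\<forall>i \<in> S. cmp C (l i) u = z i)))"

definition rel_good :: "('o, 'a) category \<Rightarrow> 'a set \<Rightarrow> ('o, 'a) cube \<Rightarrow> ('o, 'a) cube \<Rightarrow>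
    (nat set \<Rightarrow> 'a) \<Rightarrow> nat set \<Rightarrow> bool" where
  "rel_good C E A B t S \<longleftrightarrow> (\<exists>L l0 l u. rel_lim C A B t S L l0 l \<and> u \<in> hom C (vert A S) L \<and>
     cmp C l0 u = t S \<and> (\<forall>i \<in> S. cmp C (l i) u = edge A (S - {i}) S) \<and> u \<in> E)"

text \<open>Among the maximal faces of \<open>insert k S\<close>, the one without \<open>k\<close>
  is \<open>S\<close>, with component \<open>z k\<close>; the others form the boundary of the upper
  face. Pairs of directions inside \<open>S\<close> give the cone condition on that boundary, and
  pairs containing \<open>k\<close> give the compatibility with \<open>z k\<close>.\<close>

lemma bd_cone_insert:
  assumes "k \<notin> S"
  shows "bd_cone C A (insert k S) Z z \<longleftrightarrow>
    rel_cone C (upper_cube k A) A (\<lambda>S. edge A S (insert k S)) S Z (z k) z"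
proof -
  have 1: "insert k S - {i} = insert k (S - {i})" if "i \<in> S" for i using assms that by auto
  have 2: "insert k S - {k} = S" using assms by auto
  have 3: "insert k S - {i, j} = insert k (S - {i, j})" if "i \<in> S" "j \<in> S" for i j
    using assms that by auto
  have 4: "insert k S - {i, k} = S - {i}" "insert k S - {k, i} = S - {i}" for i
    using assms by auto
  have 5: "i \<noteq> k" "k \<noteq> i" if "i \<in> S" for i using assms that by auto
  show ?thesis
    unfolding bd_cone_def rel_cone_def by (auto simp: 1 2 3 4 5)
qed

lemma bd_cone_cong:
  "(\<And>i. i \<in> S \<Longrightarrow> z i = z' i) \<Longrightarrow> bd_cone C A S Z z \<longleftrightarrow> bd_cone C A S Z z'"
  unfolding bd_cone_def by simp

lemma rel_cone_cong:
  assumes "\<And>i. i \<in> S \<Longrightarrow> z i = z' i"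
  shows "rel_cone C A B t S Z z0 z \<longleftrightarrow> rel_cone C A B t S Z z0 z'"
  unfolding rel_cone_def by (intro conj_cong ball_cong bd_cone_cong assms refl) (simp_all add: assms)

lemma bd_lim_insert:
  assumes "k \<notin> S"
  shows "bd_lim C A (insert k S) L l \<longleftrightarrow>
    rel_lim C (upper_cube k A) A (\<lambda>S. edge A S (insert k S)) S L (l k) l" (is "?L \<longleftrightarrow> ?R")
proof
  assume ?L
  show ?R
    unfolding rel_lim_def
  proof (intro conjI allI impI)
    show "rel_cone C (upper_cube k A) A (\<lambda>S. edge A S (insert k S)) S L (l k) l"
      using \<open>?L\<close> unfolding bd_lim_def bd_cone_insert[OF assms] by simp
    fix Z z0 z
    assume z: "rel_cone C (upper_cube k A) A (\<lambda>S. edge A S (insert k S)) S Z z0 z"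
    \<comment> \<open>A cone on \<open>insert k S\<close> stores the component at the lower face
      under the index \<open>k\<close>, where the given family \<open>z\<close> is
      unconstrained.\<close>
    let ?z = "z(k := z0)"
    have "rel_cone C (upper_cube k A) A (\<lambda>S. edge A S (insert k S)) S Z z0 ?z"
      using z assms rel_cone_cong[of S z ?z] by (metis fun_upd_other)
    then have "bd_cone C A (insert k S) Z ?z"
      unfolding bd_cone_insert[OF assms] by simp
    then have "\<exists>!u. u \<in> hom C Z L \<and> (\<forall>i \<in> insert k S. cmp C (l i) u = ?z i)"
      using \<open>?L\<close> unfolding bd_lim_def by blast
    moreover have "(\<forall>i \<in> insert k S. cmp C (l i) u = ?z i) \<longleftrightarrow>
        cmp C (l k) u = z0 \<and> (\<forall>i \<in> S. cmp C (l i) u = z i)" for u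
      using assms by auto
    ultimately show "\<exists>!u. u \<in> hom C Z L \<and> cmp C (l k) u = z0 \<and> (\<forall>i \<in> S. cmp C (l i) u = z i)"
      by simp
  qed
next
  assume ?R
  then show ?L
    unfolding bd_lim_def rel_lim_def bd_cone_insert[OF assms] by simp
qed

lemma rel_lim_cong:
  assumes "\<And>i. i \<in> S \<Longrightarrow> l i = l' i"
  shows "rel_lim C A B t S L l0 l \<longleftrightarrow> rel_lim C A B t S L l0 l'"
  unfolding rel_lim_def
  by (intro conj_cong rel_cone_cong assms refl) (simp_all add: assms)

text \<open>The dictionary used throughout: conditions on subsets containing \<open>k\<close> are
  conditions on the map from the upper to the lower face in direction \<open>k\<close>.\<close>

lemma good_insert:
  assumes "k \<notin> S"
  shows "good C E A (insert k S) \<longleftrightarrow>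
    rel_good C E (upper_cube k A) A (\<lambda>S. edge A S (insert k S)) S" (is "?L \<longleftrightarrow> ?R")
proof -
  have 1: "insert k S - {i} = insert k (S - {i})" if "i \<in> S" for i using assms that by auto
  have 2: "insert k S - {k} = S" using assms by auto
  show ?thesis
  proof
    assume ?L
    then show ?R
      unfolding good_def rel_good_def bd_lim_insert[OF assms] using 1 2 by auto
  next
    assume ?R
    then obtain L l0 l u where
      *: "rel_lim C (upper_cube k A) A (\<lambda>S. edge A S (insert k S)) S L l0 l"
      "u \<in> hom C (vert A (insert k S)) L" "cmp C l0 u = edge A S (insert k S)"
      "\<forall>i \<in> S. cmp C (l i) u = edge A (insert k (S - {i})) (insert k S)" "u \<in> E"
      unfolding rel_good_def by auto
    let ?l = "l(k := l0)"
    have "rel_lim C (upper_cube k A) A (\<lambda>S. edge A S (insert k S)) S L (?l k) ?l"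
      using *(1) assms rel_lim_cong[of S l ?l] by (metis fun_upd_other fun_upd_same)
    then show ?L
      unfolding good_def bd_lim_insert[OF assms] using * 1 2
      by (intro exI[of _ L] exI[of _ ?l] exI[of _ u]) (use assms in auto)
  qed
qed

section \<open>Factorization and joint monicity for pullbacks and boundary limits\<close>

context category
begin

abbreviation comp (infixr "\<cdot>" 70) where "g \<cdot> f \<equiv> cmp C g f"

lemma hom_Ob: "f \<in> hom C x y \<Longrightarrow> x \<in> Ob C" "f \<in> hom C x y \<Longrightarrow> y \<in> Ob C"
  using src_Ob tgt_Ob by (auto simp: hom_def)

lemma pullback_eq:
  assumes "is_pullback C f g P p q" "u \<in> hom C Z P" "v \<in> hom C Z P" "p \<cdot> u = p \<cdot> v" "q \<cdot> u = q \<cdot> v"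
  shows "u = v"
proof -
  have h: "p \<in> hom C P (src C f)" "q \<in> hom C P (src C g)" "f \<cdot> p = g \<cdot> q"
    "f \<in> hom C (src C f) (tgt C f)" "g \<in> hom C (src C g) (tgt C f)"
    using assms(1) unfolding is_pullback_def hom_def by auto
  have "f \<cdot> p \<cdot> u = g \<cdot> q \<cdot> u"
    using cmp_assoc[OF assms(2) h(1,4)] cmp_assoc[OF assms(2) h(2,5)] h(3) by simp
  moreover have "p \<cdot> u \<in> hom C Z (src C f)" "q \<cdot> u \<in> hom C Z (src C g)" "Z \<in> Ob C"
    using assms(2) h cmp_hom hom_Ob by auto
  ultimately have "\<exists>!w. w \<in> hom C Z P \<and> p \<cdot> w = p \<cdot> u \<and> q \<cdot> w = q \<cdot> u"
    using assms(1) unfolding is_pullback_def by blast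
  then show ?thesis using assms by metis
qed

lemma pullback_ex:
  assumes "is_pullback C f g P p q" "s \<in> hom C Z (src C f)" "t \<in> hom C Z (src C g)" "f \<cdot> s = g \<cdot> t"
  shows "\<exists>u. u \<in> hom C Z P \<and> p \<cdot> u = s \<and> q \<cdot> u = t"
  using assms hom_Ob(1)[OF assms(2)] unfolding is_pullback_def by blast

lemma pullbackD:
  assumes "is_pullback C f g P p q" "f \<in> hom C X W" "g \<in> hom C Y W'"
  shows "p \<in> hom C P X" "q \<in> hom C P Y" "f \<cdot> p = g \<cdot> q" "P \<in> Ob C"
  using assms unfolding is_pullback_def hom_def by auto

lemma pullbackI:
  assumes "f \<in> hom C X W" "g \<in> hom C Y W" "p \<in> hom C P X" "q \<in> hom C P Y" "f \<cdot> p = g \<cdot> q"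
    and "\<And>Z s t. s \<in> hom C Z X \<Longrightarrow> t \<in> hom C Z Y \<Longrightarrow> f \<cdot> s = g \<cdot> t \<Longrightarrow>
      \<exists>u. u \<in> hom C Z P \<and> p \<cdot> u = s \<and> q \<cdot> u = t"
    and "\<And>Z u v. u \<in> hom C Z P \<Longrightarrow> v \<in> hom C Z P \<Longrightarrow> p \<cdot> u = p \<cdot> v \<Longrightarrow> q \<cdot> u = q \<cdot> v \<Longrightarrow> u = v"
  shows "is_pullback C f g P p q"
proof -
  have st: "src C f = X" "src C g = Y" "f \<in> Ar C" "g \<in> Ar C" "tgt C f = tgt C g"
    using assms(1,2) by (auto simp: hom_def)
  have "\<exists>!u. u \<in> hom C Z P \<and> p \<cdot> u = s \<and> q \<cdot> u = t"
    if "s \<in> hom C Z X" "t \<in> hom C Z Y" "f \<cdot> s = g \<cdot> t" for Z s t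
    using assms(6)[OF that] assms(7)[of _ Z] by (metis (no_types, lifting))
  then show ?thesis
    unfolding is_pullback_def st using st assms(3-5) hom_Ob[OF assms(3)] by auto
qed

lemma pullback_sym: "is_pullback C f g P p q \<Longrightarrow> is_pullback C g f P q p"
  unfolding is_pullback_def by metis

lemma bd_cone_precomp:
  assumes "cube_on C S A" "bd_cone C A S Z z" "w \<in> hom C Y Z"
  shows "bd_cone C A S Y (\<lambda>i. z i \<cdot> w)"
  unfolding bd_cone_def
proof (intro conjI ballI impI)
  show "Y \<in> Ob C" using hom_Ob assms(3) by simp
  fix i assume i: "i \<in> S"
  have z: "z i \<in> hom C Z (vert A (S - {i}))" if "i \<in> S" for i
    using assms(2) that unfolding bd_cone_def by simp
  show "z i \<cdot> w \<in> hom C Y (vert A (S - {i}))"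
    using cmp_hom[OF assms(3) z] i .
  fix j assume j: "j \<in> S" "i \<noteq> j"
  have e: "edge A (S - {i, j}) (S - {i}) \<in> hom C (vert A (S - {i})) (vert A (S - {i, j}))"
    "edge A (S - {i, j}) (S - {j}) \<in> hom C (vert A (S - {j})) (vert A (S - {i, j}))"
    by (rule cube_onD(3)[OF assms(1)]; auto)+
  have "edge A (S - {i, j}) (S - {i}) \<cdot> z i = edge A (S - {i, j}) (S - {j}) \<cdot> z j"
    using assms(2) i j unfolding bd_cone_def by blast
  then show "edge A (S - {i, j}) (S - {i}) \<cdot> z i \<cdot> w = edge A (S - {i, j}) (S - {j}) \<cdot> z j \<cdot> w"
    using cmp_assoc[OF assms(3) z e(1)] cmp_assoc[OF assms(3) z e(2)] i j by simp
qed

lemma bd_lim_eq: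
  assumes "cube_on C S A" "bd_lim C A S L l" "u \<in> hom C Z L" "v \<in> hom C Z L"
    and "\<And>i. i \<in> S \<Longrightarrow> l i \<cdot> u = l i \<cdot> v"
  shows "u = v"
proof -
  have "bd_cone C A S Z (\<lambda>i. l i \<cdot> u)"
    using bd_cone_precomp assms unfolding bd_lim_def by blast
  then have "\<exists>!w. w \<in> hom C Z L \<and> (\<forall>i \<in> S. l i \<cdot> w = l i \<cdot> u)"
    using assms(2) unfolding bd_lim_def by blast
  then show ?thesis using assms by metis
qed

lemma rel_cone_precomp:
  assumes "cube_on C S A" "cube_on C S B" "map_on C S A B t"
    and "rel_cone C A B t S Z z0 z" "w \<in> hom C Y Z"
  shows "rel_cone C A B t S Y (z0 \<cdot> w) (\<lambda>i. z i \<cdot> w)"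
  unfolding rel_cone_def
proof (intro conjI ballI)
  show "bd_cone C A S Y (\<lambda>i. z i \<cdot> w)"
    using bd_cone_precomp assms unfolding rel_cone_def by blast
  have z0: "z0 \<in> hom C Z (vert B S)" using assms(4) unfolding rel_cone_def by blast
  show "z0 \<cdot> w \<in> hom C Y (vert B S)" using cmp_hom[OF assms(5) z0] .
  fix i assume i: "i \<in> S"
  have z: "z i \<in> hom C Z (vert A (S - {i}))"
    using assms(4) i unfolding rel_cone_def bd_cone_def by simp
  have t: "t (S - {i}) \<in> hom C (vert A (S - {i})) (vert B (S - {i}))"
    using map_onD(1)[OF assms(3)] by auto
  have e: "edge B (S - {i}) S \<in> hom C (vert B S) (vert B (S - {i}))"
    using cube_onD(3)[OF assms(2)] by auto
  have "t (S - {i}) \<cdot> z i = edge B (S - {i}) S \<cdot> z0"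
    using assms(4) i unfolding rel_cone_def by blast
  then show "t (S - {i}) \<cdot> z i \<cdot> w = edge B (S - {i}) S \<cdot> z0 \<cdot> w"
    using cmp_assoc[OF assms(5) z t] cmp_assoc[OF assms(5) z0 e] by simp
qed

lemma rel_lim_eq:
  assumes "cube_on C S A" "cube_on C S B" "map_on C S A B t"
    and "rel_lim C A B t S L l0 l" "u \<in> hom C Z L" "v \<in> hom C Z L"
    and "l0 \<cdot> u = l0 \<cdot> v" "\<And>i. i \<in> S \<Longrightarrow> l i \<cdot> u = l i \<cdot> v"
  shows "u = v"
proof -
  have "rel_cone C A B t S Z (l0 \<cdot> u) (\<lambda>i. l i \<cdot> u)"
    using rel_cone_precomp assms unfolding rel_lim_def by blast
  then have "\<exists>!w. w \<in> hom C Z L \<and> l0 \<cdot> w = l0 \<cdot> u \<and> (\<forall>i \<in> S. l i \<cdot> w = l i \<cdot> u)"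
    using assms(4) unfolding rel_lim_def by blast
  then show ?thesis using assms by metis
qed

lemma rel_lim_ex:
  assumes "rel_lim C A B t S L l0 l" "rel_cone C A B t S Z z0 z"
  obtains u where "u \<in> hom C Z L" "l0 \<cdot> u = z0" "\<And>i. i \<in> S \<Longrightarrow> l i \<cdot> u = z i"
  using assms unfolding rel_lim_def by blast

lemma bd_lim_ex:
  assumes "bd_lim C A S L l" "bd_cone C A S Z z"
  obtains u where "u \<in> hom C Z L" "\<And>i. i \<in> S \<Longrightarrow> l i \<cdot> u = z i"
  using assms unfolding bd_lim_def by blast

lemma rel_limI:
  assumes "rel_cone C A B t S L l0 l"
    and "\<And>Z z0 z. rel_cone C A B t S Z z0 z \<Longrightarrow>
      \<exists>u. u \<in> hom C Z L \<and> l0 \<cdot> u = z0 \<and> (\<forall>i \<in> S. l i \<cdot> u = z i)"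
    and "\<And>Z u v. u \<in> hom C Z L \<Longrightarrow> v \<in> hom C Z L \<Longrightarrow> l0 \<cdot> u = l0 \<cdot> v \<Longrightarrow>
      (\<And>i. i \<in> S \<Longrightarrow> l i \<cdot> u = l i \<cdot> v) \<Longrightarrow> u = v"
  shows "rel_lim C A B t S L l0 l"
proof -
  have "\<exists>!u. u \<in> hom C Z L \<and> l0 \<cdot> u = z0 \<and> (\<forall>i \<in> S. l i \<cdot> u = z i)"
    if "rel_cone C A B t S Z z0 z" for Z z0 z
    using assms(2)[OF that] assms(3)[of _ Z] by (metis (no_types, lifting))
  then show ?thesis using assms(1) unfolding rel_lim_def by blast
qed

lemma rel_coneD:
  assumes "rel_cone C A B t S Z z0 z"
  shows "Z \<in> Ob C" "z0 \<in> hom C Z (vert B S)"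
    "i \<in> S \<Longrightarrow> z i \<in> hom C Z (vert A (S - {i}))"
    "i \<in> S \<Longrightarrow> t (S - {i}) \<cdot> z i = edge B (S - {i}) S \<cdot> z0"
    "i \<in> S \<Longrightarrow> j \<in> S \<Longrightarrow> i \<noteq> j \<Longrightarrow>
      edge A (S - {i, j}) (S - {i}) \<cdot> z i = edge A (S - {i, j}) (S - {j}) \<cdot> z j"
    "bd_cone C A S Z z"
  using assms unfolding rel_cone_def bd_cone_def by blast+

lemma bd_coneD:
  assumes "bd_cone C A S Z z"
  shows "Z \<in> Ob C" "i \<in> S \<Longrightarrow> z i \<in> hom C Z (vert A (S - {i}))"
    "i \<in> S \<Longrightarrow> j \<in> S \<Longrightarrow> i \<noteq> j \<Longrightarrow>
      edge A (S - {i, j}) (S - {i}) \<cdot> z i = edge A (S - {i, j}) (S - {j}) \<cdot> z j"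
  using assms unfolding bd_cone_def by blast+

lemma bd_cone_vert:
  assumes "cube_on C S A"
  shows "bd_cone C A S (vert A S) (\<lambda>i. edge A (S - {i}) S)"
  unfolding bd_cone_def
proof (intro conjI ballI impI)
  show "vert A S \<in> Ob C" using assms by (auto intro: cube_onD)
  fix i j
  show "edge A (S - {i}) S \<in> hom C (vert A S) (vert A (S - {i}))"
    using assms by (auto intro: cube_onD)
  have "edge A (S - {i, j}) (S - {i}) \<cdot> edge A (S - {i}) S = edge A (S - {i, j}) S"
    "edge A (S - {i, j}) (S - {j}) \<cdot> edge A (S - {j}) S = edge A (S - {i, j}) S"
    using assms by (auto intro!: cube_onD)
  then show "edge A (S - {i, j}) (S - {i}) \<cdot> edge A (S - {i}) S =
    edge A (S - {i, j}) (S - {j}) \<cdot> edge A (S - {j}) S" by simp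
qed

lemma rel_cone_vert:
  assumes "cube_on C S A" "map_on C S A B t"
  shows "rel_cone C A B t S (vert A S) (t S) (\<lambda>i. edge A (S - {i}) S)"
  using bd_cone_vert[OF assms(1)] map_onD[OF assms(2)] unfolding rel_cone_def
  by (metis Diff_subset order_refl)

text \<open>Naturality moves \<open>t\<close> past the edges into the faces of codimension two. This
  produces the induced arrow between the boundary limits of \<open>A\<close> and
  \<open>B\<close>.\<close>

lemma bd_cone_map:
  assumes "cube_on C S A" "cube_on C S B" "map_on C S A B t" "bd_cone C A S Z z"
  shows "bd_cone C B S Z (\<lambda>i. t (S - {i}) \<cdot> z i)"
  unfolding bd_cone_def
proof (intro conjI ballI impI)
  note zD = bd_coneD[OF assms(4)]
  show "Z \<in> Ob C" by fact
  have t: "t T \<in> hom C (vert A T) (vert B T)" if "T \<subseteq> S" for T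
    using map_onD(1)[OF assms(3)] that .
  fix i assume i: "i \<in> S"
  show "t (S - {i}) \<cdot> z i \<in> hom C Z (vert B (S - {i}))"
    using cmp_hom[OF zD(2) t] i by blast
  fix j assume j: "j \<in> S" "i \<noteq> j"
  have *: "edge B (S - {i, j}) (S - {x}) \<cdot> t (S - {x}) \<cdot> z x =
      t (S - {i, j}) \<cdot> edge A (S - {i, j}) (S - {x}) \<cdot> z x" if "x = i \<or> x = j" for x
  proof -
    have x: "x \<in> S" "S - {i, j} \<subseteq> S - {x}" "S - {x} \<subseteq> S" using that i j by auto
    have eB: "edge B (S - {i, j}) (S - {x}) \<in> hom C (vert B (S - {x})) (vert B (S - {i, j}))"
      and eA: "edge A (S - {i, j}) (S - {x}) \<in> hom C (vert A (S - {x})) (vert A (S - {i, j}))"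
      using cube_onD(3) assms x by blast+
    have tij: "t (S - {i, j}) \<in> hom C (vert A (S - {i, j})) (vert B (S - {i, j}))"
      using t by blast
    have "edge B (S - {i, j}) (S - {x}) \<cdot> t (S - {x}) = t (S - {i, j}) \<cdot> edge A (S - {i, j}) (S - {x})"
      using map_onD(2)[OF assms(3) x(3,2)] by simp
    then show ?thesis
      using cmp_assoc[OF zD(2) t eB] cmp_assoc[OF zD(2) eA tij] x by simp
  qed
  show "edge B (S - {i, j}) (S - {i}) \<cdot> t (S - {i}) \<cdot> z i =
      edge B (S - {i, j}) (S - {j}) \<cdot> t (S - {j}) \<cdot> z j"
    using * zD(3)[OF i j] by simp
qed

text \<open>The boundary of a map is the pullback \<open>B\<^sub>S \<times>\<^bsub>\<partial>B\<^esub> \<partial>A\<close>.\<close>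

lemma rel_lim_pullback:
  assumes A: "cube_on C S A" and B: "cube_on C S B" and t: "map_on C S A B t"
    and M: "bd_lim C A S M m" and L: "bd_lim C B S L l"
    and e: "e \<in> hom C (vert B S) L" "\<And>i. i \<in> S \<Longrightarrow> l i \<cdot> e = edge B (S - {i}) S"
    and c: "c \<in> hom C M L" "\<And>i. i \<in> S \<Longrightarrow> l i \<cdot> c = t (S - {i}) \<cdot> m i"
    and P: "is_pullback C e c P p q"
  shows "rel_lim C A B t S P p (\<lambda>i. m i \<cdot> q)"
proof -
  note PD = pullbackD[OF P e(1) c(1)]
  have Mc: "bd_cone C A S M m" and Lc: "bd_cone C B S L l"
    using M L unfolding bd_lim_def by auto
  have t': "t (S - {i}) \<in> hom C (vert A (S - {i})) (vert B (S - {i}))" for i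
    using map_onD(1)[OF t] by blast
  have m: "m i \<in> hom C M (vert A (S - {i}))" and l: "l i \<in> hom C L (vert B (S - {i}))"
    if "i \<in> S" for i
    using that bd_coneD(2) Mc Lc by auto
  have eq: "t (S - {i}) \<cdot> m i \<cdot> w = l i \<cdot> c \<cdot> w" "edge B (S - {i}) S \<cdot> w' = l i \<cdot> e \<cdot> w'"
    if "i \<in> S" "w \<in> hom C Z M" "w' \<in> hom C Z (vert B S)" for i w w' Z
    using cmp_assoc[OF that(2) m t'] cmp_assoc[OF that(2) c(1) l] cmp_assoc[OF that(3) e(1) l]
      c(2) e(2) that by simp_all
  show ?thesis
  proof (rule rel_limI)
    show "rel_cone C A B t S P p (\<lambda>i. m i \<cdot> q)"
      using bd_cone_precomp[OF A Mc PD(2)] PD(1,3) eq[OF _ PD(2,1)] unfolding rel_cone_def by simp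
  next
    fix Z z0 z assume z: "rel_cone C A B t S Z z0 z"
    note zD = rel_coneD[OF z]
    obtain w where w: "w \<in> hom C Z M" "\<And>i. i \<in> S \<Longrightarrow> m i \<cdot> w = z i"
      using bd_lim_ex[OF M zD(6)] by blast
    have "e \<cdot> z0 = c \<cdot> w"
      by (rule bd_lim_eq[OF B L cmp_hom[OF zD(2) e(1)] cmp_hom[OF w(1) c(1)]])
        (use eq[OF _ w(1) zD(2)] w(2) zD(4) in simp)
    then obtain u where u: "u \<in> hom C Z P" "p \<cdot> u = z0" "q \<cdot> u = w"
      using pullback_ex[OF P] zD(2) e(1) c(1) w(1) by (auto simp: hom_def)
    then show "\<exists>u. u \<in> hom C Z P \<and> p \<cdot> u = z0 \<and> (\<forall>i \<in> S. (m i \<cdot> q) \<cdot> u = z i)"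
      using cmp_assoc[OF u(1) PD(2) m] w(2) by (intro exI[of _ u]) simp
  next
    fix Z u v assume uv: "u \<in> hom C Z P" "v \<in> hom C Z P" "p \<cdot> u = p \<cdot> v"
      "\<And>i. i \<in> S \<Longrightarrow> (m i \<cdot> q) \<cdot> u = (m i \<cdot> q) \<cdot> v"
    have "q \<cdot> u = q \<cdot> v"
      by (rule bd_lim_eq[OF A M cmp_hom[OF uv(1) PD(2)] cmp_hom[OF uv(2) PD(2)]])
        (use cmp_assoc[OF uv(1) PD(2) m] cmp_assoc[OF uv(2) PD(2) m] uv(4) in simp)
    then show "u = v" using pullback_eq[OF P] uv by blast
  qed
qed

text \<open>Over the empty set a relative cone has the single component \<open>z0\<close>, so
  \<open>vert B {}\<close> represents it. The boundary limits of \<open>A\<close> and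
  \<open>B\<close> themselves would be terminal objects here.\<close>

lemma rel_lim_empty:
  assumes "vert B {} \<in> Ob C"
  shows "rel_lim C A B t {} (vert B {}) (ident C (vert B {})) l"
  by (rule rel_limI)
    (use assms ident_hom cmp_ident_left in \<open>auto simp: rel_cone_def bd_cone_def\<close>)

end


section \<open>Limits of boundaries and extensions\<close>

context category
begin

lemma comp_reduce:
  "w \<in> hom C Z P \<Longrightarrow> p \<in> hom C P X \<Longrightarrow> f \<in> hom C X Y \<Longrightarrow> f \<cdot> p = r \<Longrightarrow> f \<cdot> p \<cdot> w = r \<cdot> w"
  using cmp_assoc[of w Z P p X f Y] by simp

lemma comp_exchange:
  "w \<in> hom C Z P \<Longrightarrow> p \<in> hom C P X \<Longrightarrow> f \<in> hom C X Y \<Longrightarrow> q \<in> hom C P X' \<Longrightarrow> g \<in> hom C X' Y' \<Longrightarrow>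
    f \<cdot> p = g \<cdot> q \<Longrightarrow> f \<cdot> p \<cdot> w = g \<cdot> q \<cdot> w"
  using cmp_assoc[of w Z P p X f Y] cmp_assoc[of w Z P q X' g Y'] by simp

lemma is_isoI:
  "f \<in> hom C x y \<Longrightarrow> g \<in> hom C y x \<Longrightarrow> g \<cdot> f = ident C x \<Longrightarrow> f \<cdot> g = ident C y \<Longrightarrow> is_iso C f"
  unfolding is_iso_def by (auto simp: hom_def)

end

section \<open>Membership of comparison arrows in \<open>E\<close>\<close>

context extension_class
begin

lemma E_comp: "f \<in> E \<Longrightarrow> g \<in> E \<Longrightarrow> f \<in> hom C x y \<Longrightarrow> g \<in> hom C y z \<Longrightarrow> g \<cdot> f \<in> E"
  using E3 by (simp add: hom_def)

lemma E_pullback: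
  assumes "f \<in> E" "f \<in> hom C x y" "g \<in> hom C z y"
  obtains P p q where "is_pullback C f g P p q" "q \<in> E"
  using E2_exists[OF assms(1), of g] E2_stable[OF assms(1), of g] assms(2,3) by (auto simp: hom_def)

text \<open>Two relative limits differ by an isomorphism, which lies in \<open>E\<close> by (E1),
  and (E3) composes it with the comparison. Goodness may therefore be tested on whichever limit is
  at hand.\<close>

lemma rel_good_comparison:
  assumes A: "cube_on C S A" and B: "cube_on C S B" and t: "map_on C S A B t"
    and good: "rel_good C E A B t S" and L: "rel_lim C A B t S L l0 l"
    and u: "u \<in> hom C (vert A S) L" "l0 \<cdot> u = t S" "\<And>i. i \<in> S \<Longrightarrow> l i \<cdot> u = edge A (S - {i}) S"
  shows "u \<in> E"
proof -
  obtain L' l0' l' u' where L': "rel_lim C A B t S L' l0' l'"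
    and u': "u' \<in> hom C (vert A S) L'" "l0' \<cdot> u' = t S"
      "\<And>i. i \<in> S \<Longrightarrow> l' i \<cdot> u' = edge A (S - {i}) S" "u' \<in> E"
    using good unfolding rel_good_def by blast
  have c: "rel_cone C A B t S L l0 l" and c': "rel_cone C A B t S L' l0' l'"
    using L L' unfolding rel_lim_def by auto
  note D = rel_coneD[OF c] and D' = rel_coneD[OF c']
  obtain f where f: "f \<in> hom C L' L" "l0 \<cdot> f = l0'" "\<And>i. i \<in> S \<Longrightarrow> l i \<cdot> f = l' i"
    using rel_lim_ex[OF L c'] by blast
  obtain g where g: "g \<in> hom C L L'" "l0' \<cdot> g = l0" "\<And>i. i \<in> S \<Longrightarrow> l' i \<cdot> g = l i"
    using rel_lim_ex[OF L' c] by blast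
  have "g \<cdot> f = ident C L'"
    by (rule rel_lim_eq[OF A B t L' cmp_hom[OF f(1) g(1)] ident_hom[OF D'(1)]])
      (use comp_reduce[OF f(1) g(1)] D' f g cmp_ident_right in metis)+
  moreover have "f \<cdot> g = ident C L"
    by (rule rel_lim_eq[OF A B t L cmp_hom[OF g(1) f(1)] ident_hom[OF D(1)]])
      (use comp_reduce[OF g(1) f(1)] D f g cmp_ident_right in metis)+
  ultimately have "f \<in> E" using E1 is_isoI f(1) g(1) by blast
  moreover have "u = f \<cdot> u'"
    by (rule rel_lim_eq[OF A B t L u(1) cmp_hom[OF u'(1) f(1)]])
      (use comp_reduce[OF u'(1) f(1)] D f u u' in metis)+
  ultimately show ?thesis using E_comp u' f(1) by simp
qed

text \<open>The anchor of the inductions on subsets: over the empty set the comparison is the arrow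
  \<open>t {}\<close> itself, since the limit is \<open>vert B {}\<close> with the identity.\<close>

lemma rel_good_empty:
  assumes "t {} \<in> hom C (vert A {}) (vert B {})" "cube_on C {} A" "cube_on C {} B"
  shows "rel_good C E A B t {} \<longleftrightarrow> t {} \<in> E"
proof -
  have B: "vert B {} \<in> Ob C" using assms(1) hom_Ob by blast
  have t: "map_on C {} A B t"
    using assms cmp_ident_left[OF assms(1)] cmp_ident_right[OF assms(1)]
    by (intro map_onI) (auto simp: cube_onD(2))
  note L = rel_lim_empty[OF B, of A t]
  have "t {} \<in> E" if "rel_good C E A B t {}"
    by (rule rel_good_comparison[OF assms(2,3) t that L])
      (use assms(1) cmp_ident_left in auto)
  then show ?thesis
    unfolding rel_good_def using L assms(1) cmp_ident_left by blast
qed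

text \<open>The comparison of \<open>A\<close> with its boundary factors through the relative limit.
  The first factor is in \<open>E\<close> because the map is good, the second is
  \<open>q\<close>.\<close>

lemma good_of_rel_lim:
  assumes A: "cube_on C S A" and B: "cube_on C S B" and t: "map_on C S A B t"
    and good: "rel_good C E A B t S" and L: "rel_lim C A B t S L l0 l"
    and M: "bd_lim C A S M m" and q: "q \<in> hom C L M" "q \<in> E" "\<And>i. i \<in> S \<Longrightarrow> m i \<cdot> q = l i"
  shows "good C E A S"
proof -
  obtain u where u: "u \<in> hom C (vert A S) L" "l0 \<cdot> u = t S"
    "\<And>i. i \<in> S \<Longrightarrow> l i \<cdot> u = edge A (S - {i}) S"
    using rel_lim_ex[OF L rel_cone_vert[OF A t]] by blast
  have "u \<in> E" using rel_good_comparison[OF A B t good L u] .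
  then have "q \<cdot> u \<in> E" using E_comp u(1) q by blast
  moreover have "m i \<cdot> q \<cdot> u = edge A (S - {i}) S" if "i \<in> S" for i
    using comp_reduce[OF u(1) q(1) _ q(3)] bd_coneD(2)[of A S M m i] M u(3) that
    unfolding bd_lim_def by simp
  ultimately show ?thesis unfolding good_def using M cmp_hom[OF u(1) q(1)] by blast
qed

text \<open>No cancellation property of \<open>E\<close> is available, so limits of boundaries are built from
  pullbacks one direction at a time.\<close>

lemma rel_lim_exists:
  assumes "finite S" "cube_on C S A" "cube_on C S B" "map_on C S A B t"
    and "\<And>T. T \<subseteq> S \<Longrightarrow> T \<noteq> {} \<Longrightarrow> good C E B T"
    and "\<And>T. T \<subset> S \<Longrightarrow> rel_good C E A B t T"
  shows "\<exists>L l0 l. rel_lim C A B t S L l0 l \<and> (S \<noteq> {} \<longrightarrow>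
    (\<exists>M m q. bd_lim C A S M m \<and> q \<in> hom C L M \<and> q \<in> E \<and> (\<forall>i \<in> S. m i \<cdot> q = l i)))"
  using assms
proof (induction "card S" arbitrary: S A B t rule: less_induct)
  case less
  note fin = less.prems(1) and A = less.prems(2) and B = less.prems(3) and t = less.prems(4)
  show ?case
  proof (cases "S = {}")
    case True
    then show ?thesis using rel_lim_empty[of B A t] cube_onD(1)[OF B] by blast
  next
    case False
    \<comment> \<open>For a proper subset the induction hypothesis supplies the relative limit
      together with a projection in \<open>E\<close> to the boundary, so the source is already known
      to be good there.\<close>
    have goodA: "good C E A T" if T: "T \<subset> S" "T \<noteq> {}" for T
    proof -
      have A': "cube_on C T A" and B': "cube_on C T B" and t': "map_on C T A B t"
        using cube_on_subset[OF A] cube_on_subset[OF B] map_on_subset[OF t] T by auto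
      have "card T < card S" "finite T"
        using T fin psubset_card_mono finite_subset by auto
      then have "\<exists>L l0 l. rel_lim C A B t T L l0 l \<and> (T \<noteq> {} \<longrightarrow>
          (\<exists>M m q. bd_lim C A T M m \<and> q \<in> hom C L M \<and> q \<in> E \<and> (\<forall>i \<in> T. m i \<cdot> q = l i)))"
        using T by (intro less.hyps A' B' t' less.prems(5,6)) auto
      then obtain L l0 l M m q where *: "rel_lim C A B t T L l0 l" "bd_lim C A T M m"
        "q \<in> hom C L M" "q \<in> E" "\<And>i. i \<in> T \<Longrightarrow> m i \<cdot> q = l i"
        using T(2) by blast
      show ?thesis
        by (rule good_of_rel_lim[OF A' B' t' less.prems(6)[OF T(1)] *])
    qed
    \<comment> \<open>The boundary limit of \<open>A\<close> at \<open>S\<close> is a relative limit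
      over the smaller set \<open>S - {k}\<close>, for the map in direction \<open>k\<close>. The
      induction hypothesis applies to this map because it only asks for goodness of \<open>A\<close>
      at proper subsets of \<open>S\<close>: \<open>T\<close> with \<open>T \<subseteq> S'\<close>,
      and \<open>insert k T\<close> with \<open>T \<subset> S'\<close>.\<close>
    obtain k where k: "k \<in> S" using False by blast
    define S' where "S' = S - {k}"
    have S: "S = insert k S'" "k \<notin> S'" "S' \<subset> S" using k by (auto simp: S'_def)
    have "\<exists>M m. bd_lim C A S M m"
    proof -
      have c: "cube_on C S' (upper_cube k A)" "cube_on C S' A"
        "map_on C S' (upper_cube k A) A (\<lambda>S. edge A S (insert k S))"
        using A cube_on_upper_cube map_on_edge cube_on_subset S by (metis, metis psubset_imp_subset, metis)
      have "card S' < card S" "finite S'" using S(3) fin psubset_card_mono finite_subset by auto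
      moreover have "good C E A T" if "T \<subseteq> S'" "T \<noteq> {}" for T
        using goodA that S(3) by blast
      moreover have "rel_good C E (upper_cube k A) A (\<lambda>S. edge A S (insert k S)) T" if "T \<subset> S'" for T
      proof -
        have "k \<notin> T" using that S(2) by blast
        then have "k \<notin> T" "insert k T \<subset> insert k S'"
          using that insert_ident[OF _ S(2)] by (simp, metis insert_mono psubset_eq)
        then have "k \<notin> T" "good C E A (insert k T)" using goodA[of "insert k T"] S(1) by simp_all
        then show ?thesis using good_insert by blast
      qed
      ultimately obtain M m0 m where
        M: "rel_lim C (upper_cube k A) A (\<lambda>S. edge A S (insert k S)) S' M m0 m"
        using less.hyps[OF _ _ c] by metis
      have "rel_lim C (upper_cube k A) A (\<lambda>S. edge A S (insert k S)) S' M m0 (m(k := m0))"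
        using M S(2) rel_lim_cong[of S' m "m(k := m0)"] by (metis fun_upd_other)
      then have "bd_lim C A S M (m(k := m0))"
        unfolding S(1) bd_lim_insert[OF S(2)] by simp
      then show ?thesis by blast
    qed
    then obtain M m where M: "bd_lim C A S M m" by blast
    obtain L l e where L: "bd_lim C B S L l" and e: "e \<in> hom C (vert B S) L" "e \<in> E"
      "\<And>i. i \<in> S \<Longrightarrow> l i \<cdot> e = edge B (S - {i}) S"
      using less.prems(5)[OF order_refl False] unfolding good_def by blast
    have Mc: "bd_cone C A S M m" using M unfolding bd_lim_def by blast
    \<comment> \<open>\<open>c\<close> is the effect of \<open>t\<close> on boundaries. The relative
      limit is the pullback of \<open>e\<close> along \<open>c\<close>, and its projection to the
      boundary of \<open>A\<close> is in \<open>E\<close> by (E2).\<close>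
    obtain c where c: "c \<in> hom C M L" "\<And>i. i \<in> S \<Longrightarrow> l i \<cdot> c = t (S - {i}) \<cdot> m i"
      using bd_lim_ex[OF L bd_cone_map[OF A B t Mc]] by blast
    obtain P p q where P: "is_pullback C e c P p q" "q \<in> E"
      using E_pullback[OF e(2,1) c(1)] by blast
    have "rel_lim C A B t S P p (\<lambda>i. m i \<cdot> q)"
      by (rule rel_lim_pullback[OF A B t M L e(1,3) c P(1)])
    then show ?thesis using M P pullbackD(2)[OF P(1) e(1) c(1)] by blast
  qed
qed

text \<open>The relative limit projects to the boundary of \<open>A\<close> by a base change of the
  comparison of \<open>B\<close>; composing with the comparison of the map gives the comparison of
  \<open>A\<close>.\<close>

lemma good_of_rel_good:
  assumes "finite S" "cube_on C S A" "cube_on C S B" "map_on C S A B t"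
    and "\<And>T. T \<subseteq> S \<Longrightarrow> T \<noteq> {} \<Longrightarrow> good C E B T"
    and "\<And>T. T \<subseteq> S \<Longrightarrow> rel_good C E A B t T"
    and "S \<noteq> {}"
  shows "good C E A S"
proof -
  have "\<exists>L l0 l. rel_lim C A B t S L l0 l \<and> (S \<noteq> {} \<longrightarrow>
      (\<exists>M m q. bd_lim C A S M m \<and> q \<in> hom C L M \<and> q \<in> E \<and> (\<forall>i \<in> S. m i \<cdot> q = l i)))"
    by (rule rel_lim_exists[OF assms(1-5)]) (use assms(6) in auto)
  then obtain L l0 l M m q where *: "rel_lim C A B t S L l0 l" "bd_lim C A S M m"
    "q \<in> hom C L M" "q \<in> E" "\<And>i. i \<in> S \<Longrightarrow> m i \<cdot> q = l i"
    using assms(7) by blast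
  show ?thesis
    by (rule good_of_rel_lim[OF assms(2-4) assms(6)[OF order_refl] *])
qed

text \<open>A lower face inherits goodness trivially, its subsets being subsets of the whole cube.
  The upper face is the source of the map in direction \<open>k\<close>, so it inherits goodness
  from the lower face and this map.\<close>

lemma good_upper_cube:
  assumes "finite S" "cube_on C (insert k S) A" "k \<notin> S" "S \<noteq> {}"
    and "\<And>T. T \<subseteq> insert k S \<Longrightarrow> T \<noteq> {} \<Longrightarrow> good C E A T"
  shows "good C E (upper_cube k A) S"
proof (rule good_of_rel_good[OF assms(1) cube_on_upper_cube[OF assms(2)] _ map_on_edge[OF assms(2)]])
  show "cube_on C S A" using assms(2) by (rule cube_on_subset) blast
  show "good C E A T" if "T \<subseteq> S" "T \<noteq> {}" for T using assms(5) that by blast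
  show "rel_good C E (upper_cube k A) A (\<lambda>S. edge A S (insert k S)) T" if "T \<subseteq> S" for T
  proof -
    have "k \<notin> T" "good C E A (insert k T)" using assms(3) assms(5)[of "insert k T"] that by auto
    then show ?thesis using good_insert by blast
  qed
qed fact

text \<open>Passing to upper faces in the directions of \<open>S\<close>, one at a time, turns the
  edge into the only edge of a one-dimensional cube, where goodness at \<open>{k}\<close> is
  membership in \<open>E\<close>.\<close>

lemma edge_in_E:
  assumes "finite S" "cube_on C (insert k S) A" "k \<notin> S"
    and "\<And>T. T \<subseteq> insert k S \<Longrightarrow> T \<noteq> {} \<Longrightarrow> good C E A T"
  shows "edge A S (insert k S) \<in> E"
  using assms
proof (induction S arbitrary: A rule: finite_induct)
  case empty
  have "rel_good C E (upper_cube k A) A (\<lambda>S. edge A S (insert k S)) {}"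
    using empty.prems(3)[of "{k}"] good_insert[of k "{}" C E A] by simp
  moreover have "cube_on C {} A" "cube_on C {} (upper_cube k A)"
    using empty.prems(1) cube_on_subset cube_on_upper_cube by blast+
  moreover have "edge A {} {k} \<in> hom C (vert (upper_cube k A) {}) (vert A {})"
    using cube_onD(3)[OF empty.prems(1), of "{k}" "{}"] by simp
  ultimately show ?case using rel_good_empty[of "\<lambda>S. edge A S (insert k S)" "upper_cube k A" A] by simp
next
  case (insert j S)
  have "cube_on C (insert k S) (upper_cube j A)"
    using insert.prems(1) by (intro cube_on_upper_cube) (simp add: insert_commute)
  moreover have "good C E (upper_cube j A) T" if T: "T \<subseteq> insert k S" "T \<noteq> {}" for T
  proof (rule good_upper_cube[OF _ _ _ T(2)])
    show "finite T" using T insert.hyps(1) finite_subset by auto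
    show "cube_on C (insert j T) A"
      by (rule cube_on_subset[OF insert.prems(1)]) (use T in auto)
    show "j \<notin> T" using T insert.hyps insert.prems(2) by auto
    show "good C E A T'" if "T' \<subseteq> insert j T" "T' \<noteq> {}" for T'
      by (rule insert.prems(3)) (use that T in auto)
  qed
  ultimately show ?case
    using insert.IH[of "upper_cube j A"] insert.prems(2) by (simp add: insert_commute)
qed

end


section \<open>Pointwise pullbacks of cubes\<close>

context category
begin

text \<open>The universal property at the smaller set supplies the edges, and joint monicity of the
  two projections makes them functorial.\<close>

lemma pullback_cube:
  assumes X: "cube_on C V X" and W: "cube_on C V W" and Y: "cube_on C V Y"
    and f: "map_on C V X Y f" and g: "map_on C V W Y g"
    and ex: "\<And>S. S \<subseteq> V \<Longrightarrow> \<exists>P p q. is_pullback C (f S) (g S) P p q"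
  obtains P p q where "cube_on C V P" "map_on C V P X p" "map_on C V P W q"
    "\<And>S. S \<subseteq> V \<Longrightarrow> is_pullback C (f S) (g S) (vert P S) (p S) (q S)"
proof -
  obtain P p q where pb: "\<And>S. S \<subseteq> V \<Longrightarrow> is_pullback C (f S) (g S) (P S) (p S) (q S)"
    using ex by metis
  have fh: "f S \<in> hom C (vert X S) (vert Y S)" and gh: "g S \<in> hom C (vert W S) (vert Y S)"
    if "S \<subseteq> V" for S using map_onD(1) f g that by blast+
  have ph: "p S \<in> hom C (P S) (vert X S)" and qh: "q S \<in> hom C (P S) (vert W S)"
    and pq: "f S \<cdot> p S = g S \<cdot> q S" and Ob: "P S \<in> Ob C"
    if "S \<subseteq> V" for S using pullbackD[OF pb fh gh] that by blast+
  have eh: "edge X S T \<in> hom C (vert X T) (vert X S)" "edge W S T \<in> hom C (vert W T) (vert W S)"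
    "edge Y S T \<in> hom C (vert Y T) (vert Y S)"
    if "T \<subseteq> V" "S \<subseteq> T" for S T using cube_onD(3) X W Y that by blast+
  have ex_d: "\<exists>u. u \<in> hom C (P T) (P S) \<and> p S \<cdot> u = edge X S T \<cdot> p T \<and> q S \<cdot> u = edge W S T \<cdot> q T"
    if T: "T \<subseteq> V" "S \<subseteq> T" for S T
  proof -
    have S: "S \<subseteq> V" using T by blast
    have "f S \<cdot> edge X S T \<cdot> p T = edge Y S T \<cdot> f T \<cdot> p T"
      using comp_exchange[OF ph eh(1) fh fh eh(3)] map_onD(2)[OF f] T S by blast
    also have "\<dots> = g S \<cdot> edge W S T \<cdot> q T"
      using comp_exchange[OF qh eh(2) gh gh eh(3)] map_onD(2)[OF g] pq T S by simp
    finally show ?thesis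
      using pullback_ex[OF pb[OF S], of "edge X S T \<cdot> p T" "P T" "edge W S T \<cdot> q T"]
        cmp_hom[OF ph eh(1)] cmp_hom[OF qh eh(2)] fh[OF S] gh[OF S] T by (simp add: hom_def)
  qed
  \<comment> \<open>Each such arrow is determined by its two projections; the choice operator only
    turns them into a function of \<open>S\<close> and \<open>T\<close>.\<close>
  define d where "d S T = (SOME u. u \<in> hom C (P T) (P S) \<and> p S \<cdot> u = edge X S T \<cdot> p T \<and>
    q S \<cdot> u = edge W S T \<cdot> q T)" for S T
  have d: "d S T \<in> hom C (P T) (P S)" "p S \<cdot> d S T = edge X S T \<cdot> p T"
    "q S \<cdot> d S T = edge W S T \<cdot> q T" if "T \<subseteq> V" "S \<subseteq> T" for S T
    using someI_ex[OF ex_d[OF that]] unfolding d_def by auto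
  let ?P = "\<lparr>vert = P, edge = d\<rparr>"
  show thesis
  proof
    show "cube_on C V ?P"
    proof (rule cube_onI; unfold cube.select_convs)
      fix S assume S: "S \<subseteq> V"
      show "P S \<in> Ob C" using Ob S .
      show "d S S = ident C (P S)"
        by (rule pullback_eq[OF pb[OF S] d(1)[OF S order_refl] ident_hom[OF Ob[OF S]]])
          (use cmp_ident_left[OF ph[OF S]] cmp_ident_right[OF ph[OF S]]
            cmp_ident_left[OF qh[OF S]] cmp_ident_right[OF qh[OF S]]
            d(2,3)[OF S order_refl] cube_onD(2)[OF X S] cube_onD(2)[OF W S] in simp_all)
    next
      fix S T assume "T \<subseteq> V" "S \<subseteq> T"
      then show "d S T \<in> hom C (P T) (P S)" by (rule d(1))
    next
      fix S T U assume U: "U \<subseteq> V" "T \<subseteq> U" "S \<subseteq> T"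
      then have T: "T \<subseteq> V" "S \<subseteq> U" "S \<subseteq> V" by auto
      note h = d(1)[OF T(1) U(3)] d(1)[OF U(1,2)]
      show "d S T \<cdot> d T U = d S U"
      proof (rule pullback_eq[OF pb[OF T(3)] cmp_hom[OF h(2,1)] d(1)[OF U(1) T(2)]])
        have "p S \<cdot> d S T \<cdot> d T U = edge X S T \<cdot> edge X T U \<cdot> p U"
          using comp_exchange[OF h(2,1) ph[OF T(3)] ph[OF T(1)] eh(1)[OF T(1) U(3)]]
            d(2)[OF T(1) U(3)] d(2)[OF U(1,2)] by simp
        then show "p S \<cdot> d S T \<cdot> d T U = p S \<cdot> d S U"
          using comp_reduce[OF ph[OF U(1)] eh(1)[OF U(1,2)] eh(1)[OF T(1) U(3)] cube_onD(4)[OF X U]]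
            d(2)[OF U(1) T(2)] by simp
        have "q S \<cdot> d S T \<cdot> d T U = edge W S T \<cdot> edge W T U \<cdot> q U"
          using comp_exchange[OF h(2,1) qh[OF T(3)] qh[OF T(1)] eh(2)[OF T(1) U(3)]]
            d(3)[OF T(1) U(3)] d(3)[OF U(1,2)] by simp
        then show "q S \<cdot> d S T \<cdot> d T U = q S \<cdot> d S U"
          using comp_reduce[OF qh[OF U(1)] eh(2)[OF U(1,2)] eh(2)[OF T(1) U(3)] cube_onD(4)[OF W U]]
            d(3)[OF U(1) T(2)] by simp
      qed
    qed
    show "map_on C V ?P X p" "map_on C V ?P W q"
      by (rule map_onI; simp add: d ph qh)+
    show "is_pullback C (f S) (g S) (vert ?P S) (p S) (q S)" if "S \<subseteq> V" for S
      using pb[OF that] by simp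
  qed
qed

text \<open>The arrows induced at the vertices are natural because the two sides of a naturality
  square agree after both projections.\<close>

lemma pullback_cube_map:
  assumes X: "cube_on C V X" and W: "cube_on C V W" and P: "cube_on C V P" and D: "cube_on C V D"
    and f: "map_on C V X Y f" and g: "map_on C V W Y g"
    and p: "map_on C V P X p" and q: "map_on C V P W q"
    and pb: "\<And>S. S \<subseteq> V \<Longrightarrow> is_pullback C (f S) (g S) (vert P S) (p S) (q S)"
    and x: "map_on C V D X x" and y: "map_on C V D W y"
    and eq: "\<And>S. S \<subseteq> V \<Longrightarrow> f S \<cdot> x S = g S \<cdot> y S"
  obtains u where "map_on C V D P u" "\<And>S. S \<subseteq> V \<Longrightarrow> p S \<cdot> u S = x S"
    "\<And>S. S \<subseteq> V \<Longrightarrow> q S \<cdot> u S = y S"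
proof -
  have "\<exists>u. u \<in> hom C (vert D S) (vert P S) \<and> p S \<cdot> u = x S \<and> q S \<cdot> u = y S" if "S \<subseteq> V" for S
    using pullback_ex[OF pb[OF that], of "x S" "vert D S" "y S"] eq[OF that] map_onD(1)[OF x that]
      map_onD(1)[OF y that] map_onD(1)[OF f that] map_onD(1)[OF g that] by (simp add: hom_def)
  then obtain u where u: "\<And>S. S \<subseteq> V \<Longrightarrow> u S \<in> hom C (vert D S) (vert P S)"
    "\<And>S. S \<subseteq> V \<Longrightarrow> p S \<cdot> u S = x S" "\<And>S. S \<subseteq> V \<Longrightarrow> q S \<cdot> u S = y S"
    by metis
  have "map_on C V D P u"
  proof (rule map_onI[OF u(1)])
    fix S T assume T: "T \<subseteq> V" "S \<subseteq> T"
    then have S: "S \<subseteq> V" by auto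
    note e = cube_onD(3)[OF X T] cube_onD(3)[OF W T] cube_onD(3)[OF P T] cube_onD(3)[OF D T]
    show "u S \<cdot> edge D S T = edge P S T \<cdot> u T"
    proof (rule pullback_eq[OF pb[OF S] cmp_hom[OF e(4) u(1)[OF S]] cmp_hom[OF u(1)[OF T(1)] e(3)]])
      have "p S \<cdot> u S \<cdot> edge D S T = x S \<cdot> edge D S T"
        by (rule comp_reduce[OF e(4) u(1)[OF S] map_onD(1)[OF p S] u(2)[OF S]])
      also have "\<dots> = edge X S T \<cdot> p T \<cdot> u T" using map_onD(2)[OF x T] u(2)[OF T(1)] by simp
      also have "\<dots> = p S \<cdot> edge P S T \<cdot> u T"
        by (rule comp_exchange[OF u(1)[OF T(1)] map_onD(1)[OF p T(1)] e(1) e(3) map_onD(1)[OF p S],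
              OF map_onD(2)[OF p T, symmetric]])
      finally show "p S \<cdot> u S \<cdot> edge D S T = p S \<cdot> edge P S T \<cdot> u T" .
      have "q S \<cdot> u S \<cdot> edge D S T = y S \<cdot> edge D S T"
        by (rule comp_reduce[OF e(4) u(1)[OF S] map_onD(1)[OF q S] u(3)[OF S]])
      also have "\<dots> = edge W S T \<cdot> q T \<cdot> u T" using map_onD(2)[OF y T] u(3)[OF T(1)] by simp
      also have "\<dots> = q S \<cdot> edge P S T \<cdot> u T"
        by (rule comp_exchange[OF u(1)[OF T(1)] map_onD(1)[OF q T(1)] e(2) e(3) map_onD(1)[OF q S],
              OF map_onD(2)[OF q T, symmetric]])
      finally show "q S \<cdot> u S \<cdot> edge D S T = q S \<cdot> edge P S T \<cdot> u T" .
    qed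
  qed
  then show thesis using that u by blast
qed

end

context extension_class
begin

text \<open>Base change: with \<open>L\<close> and \<open>R\<close> the relative limits of
  \<open>f\<close> and \<open>q\<close> at \<open>S\<close>, the comparison of \<open>q\<close> is a
  pullback of the comparison of \<open>f\<close> along an arrow from \<open>R\<close> to
  \<open>L\<close>, so (E2) applies. Goodness of \<open>W\<close> serves to construct
  \<open>R\<close>.\<close>

lemma rel_good_pullback:
  assumes fin: "finite V"
    and X: "cube_on C V X" and W: "cube_on C V W" and Y: "cube_on C V Y" and P: "cube_on C V P"
    and f: "map_on C V X Y f" and g: "map_on C V W Y g"
    and p: "map_on C V P X p" and q: "map_on C V P W q"
    and pb: "\<And>S. S \<subseteq> V \<Longrightarrow> is_pullback C (f S) (g S) (vert P S) (p S) (q S)"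
    and goodf: "\<And>S. S \<subseteq> V \<Longrightarrow> rel_good C E X Y f S"
    and goodW: "\<And>S. S \<subseteq> V \<Longrightarrow> S \<noteq> {} \<Longrightarrow> good C E W S"
    and S: "S \<subseteq> V"
  shows "rel_good C E P W q S"
  using S
proof (induction "card S" arbitrary: S rule: less_induct)
  case less
  note S = less.prems
  have XS: "cube_on C S X" and WS: "cube_on C S W" and YS: "cube_on C S Y" and PS: "cube_on C S P"
    using cube_on_subset[OF _ S] X W Y P by auto
  have fS: "map_on C S X Y f" and gS: "map_on C S W Y g" and pS: "map_on C S P X p"
    and qS: "map_on C S P W q"
    using map_on_subset[OF _ S] f g p q by auto
  have finS: "finite S" using fin S finite_subset by auto
  have "\<exists>R r0 r. rel_lim C P W q S R r0 r \<and> (S \<noteq> {} \<longrightarrow>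
      (\<exists>M m q. bd_lim C P S M m \<and> q \<in> hom C R M \<and> q \<in> E \<and> (\<forall>i \<in> S. m i \<cdot> q = r i)))"
  \<comment> \<open>The induction on the size of \<open>S\<close> enters here: \<open>R\<close> can
    be formed because the comparisons of \<open>q\<close> at proper subsets are already in
    \<open>E\<close>.\<close>
  proof (rule rel_lim_exists[OF finS PS WS qS])
    show "good C E W T" if "T \<subseteq> S" "T \<noteq> {}" for T using goodW that S by auto
    show "rel_good C E P W q T" if "T \<subset> S" for T
      using less.hyps[of T] psubset_card_mono[OF finS that] that S by auto
  qed
  then obtain R r0 r where R: "rel_lim C P W q S R r0 r" by blast
  obtain L l0 l e where L: "rel_lim C X Y f S L l0 l" and e: "e \<in> hom C (vert X S) L" "l0 \<cdot> e = f S"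
      "\<And>i. i \<in> S \<Longrightarrow> l i \<cdot> e = edge X (S - {i}) S" "e \<in> E"
    using goodf[OF S] unfolding rel_good_def by blast
  have Rc: "rel_cone C P W q S R r0 r" and Lc: "rel_cone C X Y f S L l0 l"
    using R L unfolding rel_lim_def by auto
  note RD = rel_coneD[OF Rc] and LD = rel_coneD[OF Lc]
  have sub: "S - {i} \<subseteq> S" for i by blast
  note ph = map_onD(1)[OF pS] and qh = map_onD(1)[OF qS] and fh = map_onD(1)[OF fS] and gh = map_onD(1)[OF gS]
  note XE = cube_onD(3)[OF XS order_refl sub] and WE = cube_onD(3)[OF WS order_refl sub]
    and YE = cube_onD(3)[OF YS order_refl sub] and PE = cube_onD(3)[OF PS order_refl sub]
  have pb': "is_pullback C (f T) (g T) (vert P T) (p T) (q T)" if "T \<subseteq> S" for T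
    using pb that S by auto
  \<comment> \<open>Moving the legs of \<open>R\<close> along \<open>p\<close> and \<open>g\<close>
    gives a cone for \<open>f\<close>; the arrow \<open>h\<close> that it induces is the one along
    which \<open>e\<close> gets pulled back.\<close>
  have "rel_cone C X Y f S R (g S \<cdot> r0) (\<lambda>i. p (S - {i}) \<cdot> r i)"
    unfolding rel_cone_def
  proof (intro conjI ballI)
    show "bd_cone C X S R (\<lambda>i. p (S - {i}) \<cdot> r i)"
      by (rule bd_cone_map[OF PS XS pS RD(6)])
    show "g S \<cdot> r0 \<in> hom C R (vert Y S)" using cmp_hom[OF RD(2) gh] by blast
    fix i assume i: "i \<in> S"
    have "f (S - {i}) \<cdot> p (S - {i}) \<cdot> r i = g (S - {i}) \<cdot> q (S - {i}) \<cdot> r i"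
      using comp_exchange[OF RD(3)[OF i] ph[OF sub] fh[OF sub] qh[OF sub] gh[OF sub]]
        pullbackD(3)[OF pb'[OF sub] fh[OF sub] gh[OF sub]] by blast
    also have "\<dots> = g (S - {i}) \<cdot> edge W (S - {i}) S \<cdot> r0"
      using RD(4)[OF i] by simp
    also have "\<dots> = edge Y (S - {i}) S \<cdot> g S \<cdot> r0"
      by (rule comp_exchange[OF RD(2) WE gh[OF sub] gh[OF order_refl] YE])
        (rule map_onD(2)[OF gS order_refl sub])
    finally show "f (S - {i}) \<cdot> p (S - {i}) \<cdot> r i = edge Y (S - {i}) S \<cdot> g S \<cdot> r0" .
  qed
  then obtain h where h: "h \<in> hom C R L" "l0 \<cdot> h = g S \<cdot> r0"
      "\<And>i. i \<in> S \<Longrightarrow> l i \<cdot> h = p (S - {i}) \<cdot> r i"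
    using rel_lim_ex[OF L] by blast
  obtain v where v: "v \<in> hom C (vert P S) R" "r0 \<cdot> v = q S"
      "\<And>i. i \<in> S \<Longrightarrow> r i \<cdot> v = edge P (S - {i}) S"
    using rel_lim_ex[OF R rel_cone_vert[OF PS qS]] by blast
  note pbS = pb'[OF order_refl]
  note pS' = ph[OF order_refl] and qS' = qh[OF order_refl] and fS' = fh[OF order_refl]
    and gS' = gh[OF order_refl]
  have "is_pullback C e h (vert P S) (p S) v"
  proof (rule pullbackI[OF e(1) h(1) pS' v(1)])
    show "e \<cdot> p S = h \<cdot> v"
    proof (rule rel_lim_eq[OF XS YS fS L cmp_hom[OF pS' e(1)] cmp_hom[OF v(1) h(1)]])
      have "l0 \<cdot> e \<cdot> p S = g S \<cdot> q S"
        using comp_reduce[OF pS' e(1) LD(2) e(2)] pullbackD(3)[OF pbS fS' gS'] by simp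
      also have "\<dots> = l0 \<cdot> h \<cdot> v"
        using comp_exchange[OF v(1) h(1) LD(2) RD(2) gS' h(2)] v(2) by simp
      finally show "l0 \<cdot> e \<cdot> p S = l0 \<cdot> h \<cdot> v" .
      fix i assume i: "i \<in> S"
      have "l i \<cdot> e \<cdot> p S = p (S - {i}) \<cdot> edge P (S - {i}) S"
        using comp_reduce[OF pS' e(1) LD(3)[OF i] e(3)[OF i]] map_onD(2)[OF pS order_refl sub] by simp
      also have "\<dots> = l i \<cdot> h \<cdot> v"
        using comp_exchange[OF v(1) h(1) LD(3)[OF i] RD(3)[OF i] ph[OF sub] h(3)[OF i]] v(3)[OF i] by simp
      finally show "l i \<cdot> e \<cdot> p S = l i \<cdot> h \<cdot> v" .
    qed
  next
    \<comment> \<open>The factorization \<open>y\<close> is determined by \<open>x\<close> and by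
      the leg of \<open>w\<close> at \<open>vert W S\<close>. That \<open>v\<close> sends it to
      \<open>w\<close> is tested on the legs of \<open>R\<close>; a leg into
      \<open>vert P (S - {i})\<close> is tested once more by \<open>p\<close> and
      \<open>q\<close>.\<close>
    fix Z x w assume x: "x \<in> hom C Z (vert X S)" and w: "w \<in> hom C Z R" and eq: "e \<cdot> x = h \<cdot> w"
    have "f S \<cdot> x = l0 \<cdot> h \<cdot> w"
      using comp_reduce[OF x e(1) LD(2) e(2)] eq by simp
    also have "\<dots> = g S \<cdot> r0 \<cdot> w"
      by (rule comp_exchange[OF w h(1) LD(2) RD(2) gS' h(2)])
    finally obtain y where y: "y \<in> hom C Z (vert P S)" "p S \<cdot> y = x" "q S \<cdot> y = r0 \<cdot> w"
      using pullback_ex[OF pbS, of x Z "r0 \<cdot> w"] x cmp_hom[OF w RD(2)] fS' gS' by (auto simp: hom_def)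
    have "v \<cdot> y = w"
    proof (rule rel_lim_eq[OF PS WS qS R cmp_hom[OF y(1) v(1)] w])
      show "r0 \<cdot> v \<cdot> y = r0 \<cdot> w"
        using comp_reduce[OF y(1) v(1) RD(2) v(2)] y(3) by simp
      fix i assume i: "i \<in> S"
      have ry: "r i \<cdot> v \<cdot> y = edge P (S - {i}) S \<cdot> y"
        by (rule comp_reduce[OF y(1) v(1) RD(3)[OF i] v(3)[OF i]])
      show "r i \<cdot> v \<cdot> y = r i \<cdot> w"
        unfolding ry
      proof (rule pullback_eq[OF pb'[OF sub] cmp_hom[OF y(1) PE] cmp_hom[OF w RD(3)[OF i]]])
        have "p (S - {i}) \<cdot> edge P (S - {i}) S \<cdot> y = edge X (S - {i}) S \<cdot> x"
          using comp_exchange[OF y(1) PE ph[OF sub] pS' XE map_onD(2)[OF pS order_refl sub]] y(2) by simp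
        also have "\<dots> = l i \<cdot> h \<cdot> w"
          using comp_reduce[OF x e(1) LD(3)[OF i] e(3)[OF i]] eq by simp
        also have "\<dots> = p (S - {i}) \<cdot> r i \<cdot> w"
          by (rule comp_exchange[OF w h(1) LD(3)[OF i] RD(3)[OF i] ph[OF sub] h(3)[OF i]])
        finally show "p (S - {i}) \<cdot> edge P (S - {i}) S \<cdot> y = p (S - {i}) \<cdot> r i \<cdot> w" .
        have "q (S - {i}) \<cdot> edge P (S - {i}) S \<cdot> y = edge W (S - {i}) S \<cdot> r0 \<cdot> w"
          using comp_exchange[OF y(1) PE qh[OF sub] qS' WE map_onD(2)[OF qS order_refl sub]] y(3) by simp
        also have "\<dots> = q (S - {i}) \<cdot> r i \<cdot> w"
          by (rule comp_exchange[OF w RD(2) WE RD(3)[OF i] qh[OF sub] RD(4)[OF i, symmetric]])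
        finally show "q (S - {i}) \<cdot> edge P (S - {i}) S \<cdot> y = q (S - {i}) \<cdot> r i \<cdot> w" .
      qed
    qed
    then show "\<exists>y. y \<in> hom C Z (vert P S) \<and> p S \<cdot> y = x \<and> v \<cdot> y = w" using y by blast
  next
    fix Z y y' assume y: "y \<in> hom C Z (vert P S)" "y' \<in> hom C Z (vert P S)" "p S \<cdot> y = p S \<cdot> y'"
      "v \<cdot> y = v \<cdot> y'"
    show "y = y'"
      by (rule pullback_eq[OF pbS y(1,2,3)])
        (use comp_reduce[OF y(1) v(1) RD(2) v(2)] comp_reduce[OF y(2) v(1) RD(2) v(2)] y(4) in simp)
  qed
  then have "v \<in> E" using E2_stable e(4) by blast
  then show ?case unfolding rel_good_def using R v by blast
qed

end

section \<open>The pullback square of a map of cubes and its comparison arrow\<close>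

context category
begin

context
  fixes A B P :: "('o, 'a) cube" and t p q u :: "nat set \<Rightarrow> 'a" and k :: nat and S :: "nat set"
  assumes k: "k \<notin> S" and A: "cube_on C (insert k S) A" and B: "cube_on C (insert k S) B"
    and P: "cube_on C S P"
    and t: "map_on C (insert k S) A B t" and p: "map_on C S P A p"
    and q: "map_on C S P (upper_cube k B) q" and u: "map_on C S (upper_cube k A) P u"
    and pb: "\<And>T. T \<subseteq> S \<Longrightarrow> is_pullback C (t T) (edge B T (insert k T)) (vert P T) (p T) (q T)"
    and pu: "\<And>T. T \<subseteq> S \<Longrightarrow> p T \<cdot> u T = edge A T (insert k T)"
    and qu: "\<And>T. T \<subseteq> S \<Longrightarrow> q T \<cdot> u T = t (insert k T)"
begin

text \<open>A cone for \<open>t\<close> on \<open>insert k S\<close> has components at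
  \<open>vert B (insert k S)\<close>, at \<open>vert A S\<close> (index \<open>k\<close>) and at the
  remaining maximal faces of \<open>A\<close>. The first two are compatible, so they amount to one
  arrow \<open>w\<close> into the pullback \<open>vert P S\<close>. For each remaining face, the two
  compatibilities with them amount to one equation between arrows into
  \<open>vert P (S - {i})\<close>, by joint monicity of the projections.\<close>

lemma square_rel_cone:
  assumes w: "w \<in> hom C Z (vert P S)"
  shows "rel_cone C (upper_cube k A) P u S Z w z \<longleftrightarrow>
    rel_cone C A B t (insert k S) Z (q S \<cdot> w) (z(k := p S \<cdot> w))"
proof -
  let ?z = "z(k := p S \<cdot> w)"
  have pw: "p S \<cdot> w \<in> hom C Z (vert A S)" and qw: "q S \<cdot> w \<in> hom C Z (vert B (insert k S))"
    using cmp_hom[OF w map_onD(1)[OF p order_refl]] cmp_hom[OF w map_onD(1)[OF q order_refl]] by simp_all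
  have z: "bd_cone C (upper_cube k A) S Z ?z \<longleftrightarrow> bd_cone C (upper_cube k A) S Z z"
    using k by (intro bd_cone_cong) auto
  have e: "edge B S (insert k S) \<in> hom C (vert B (insert k S)) (vert B S)"
    using cube_onD(3)[OF B] by blast
  have t': "t T \<in> hom C (vert A T) (vert B T)" if "T \<subseteq> insert k S" for T
    using map_onD(1)[OF t that] .
  have tS: "t S \<in> hom C (vert A S) (vert B S)" using t' by blast
  \<comment> \<open>The compatibility at the index \<open>k\<close> itself is the commutativity of
    the pullback square at \<open>S\<close>.\<close>
  have top: "t S \<cdot> p S \<cdot> w = edge B S (insert k S) \<cdot> q S \<cdot> w"
    using comp_exchange[OF w map_onD(1)[OF p order_refl] tS map_onD(1)[OF q order_refl] _
        pullbackD(3)[OF pb[OF order_refl] tS e]] e by simp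
  have eq: "u (S - {i}) \<cdot> z i = edge P (S - {i}) S \<cdot> w \<longleftrightarrow>
      edge A (S - {i}) (insert k (S - {i})) \<cdot> z i = edge A (S - {i}) S \<cdot> p S \<cdot> w \<and>
      t (insert k (S - {i})) \<cdot> z i = edge B (insert k (S - {i})) (insert k S) \<cdot> q S \<cdot> w"
    (is "?L \<longleftrightarrow> ?R1 \<and> ?R2")
    if zi: "z i \<in> hom C Z (vert A (insert k (S - {i})))" for i
  proof -
    let ?T = "S - {i}"
    have T: "?T \<subseteq> S" by blast
    have eP: "edge P ?T S \<in> hom C (vert P S) (vert P ?T)" using cube_onD(3)[OF P order_refl T] .
    have eA: "edge A ?T S \<in> hom C (vert A S) (vert A ?T)" using cube_onD(3)[OF A _ T] by blast
    have eB: "edge B (insert k ?T) (insert k S) \<in> hom C (vert B (insert k S)) (vert B (insert k ?T))"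
      using cube_onD(3)[OF B order_refl] T by blast
    have uT: "u ?T \<in> hom C (vert A (insert k ?T)) (vert P ?T)" using map_onD(1)[OF u T] by simp
    have pT: "p ?T \<in> hom C (vert P ?T) (vert A ?T)" using map_onD(1)[OF p T] .
    have qT: "q ?T \<in> hom C (vert P ?T) (vert B (insert k ?T))" using map_onD(1)[OF q T] by simp
    have pS: "p S \<in> hom C (vert P S) (vert A S)" using map_onD(1)[OF p order_refl] .
    have qS: "q S \<in> hom C (vert P S) (vert B (insert k S))" using map_onD(1)[OF q order_refl] by simp
    have 1: "p ?T \<cdot> u ?T \<cdot> z i = edge A ?T (insert k ?T) \<cdot> z i"
      by (rule comp_reduce[OF zi uT pT pu[OF T]])
    have 2: "q ?T \<cdot> u ?T \<cdot> z i = t (insert k ?T) \<cdot> z i"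
      by (rule comp_reduce[OF zi uT qT qu[OF T]])
    have 3: "p ?T \<cdot> edge P ?T S \<cdot> w = edge A ?T S \<cdot> p S \<cdot> w"
      by (rule comp_exchange[OF w eP pT pS eA map_onD(2)[OF p order_refl T]])
    have 4: "q ?T \<cdot> edge P ?T S \<cdot> w = edge B (insert k ?T) (insert k S) \<cdot> q S \<cdot> w"
      by (rule comp_exchange[OF w eP qT qS eB]) (use map_onD(2)[OF q order_refl T] in simp)
    show ?thesis
      using 1 2 3 4 pullback_eq[OF pb[OF T] cmp_hom[OF zi uT] cmp_hom[OF w eP]] by auto
  qed
  have 5: "insert k S - {k} = S" "i \<in> S \<Longrightarrow> i \<noteq> k" for i using k by auto
  have 6: "insert k S - {i} = insert k (S - {i})" if "i \<in> S" for i using k that by auto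
  have zi: "z i \<in> hom C Z (vert A (insert k (S - {i})))" if "bd_cone C (upper_cube k A) S Z z" "i \<in> S" for i
    using bd_coneD(2)[OF that] by simp
  have "rel_cone C A B t (insert k S) Z (q S \<cdot> w) ?z \<longleftrightarrow>
      bd_cone C (upper_cube k A) S Z z \<and>
      (\<forall>i \<in> S. edge A (S - {i}) (insert k (S - {i})) \<cdot> z i = edge A (S - {i}) S \<cdot> p S \<cdot> w) \<and>
      (\<forall>i \<in> S. t (insert k (S - {i})) \<cdot> z i = edge B (insert k (S - {i})) (insert k S) \<cdot> q S \<cdot> w)"
    unfolding rel_cone_def[of C A B t] bd_cone_insert[OF k]
    unfolding rel_cone_def[of C "upper_cube k A"] z
    using pw qw top by (simp add: 5 6)
  also have "\<dots> \<longleftrightarrow> rel_cone C (upper_cube k A) P u S Z w z"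
    unfolding rel_cone_def using w eq zi by blast
  finally show ?thesis by simp
qed

lemma square_factor:
  assumes w0: "w0 \<in> hom C L (vert P S)" and l: "\<And>i. i \<in> S \<Longrightarrow> l i \<in> hom C L (vert A (insert k (S - {i})))"
    and v: "v \<in> hom C Z L" and w: "w \<in> hom C Z (vert P S)"
  shows "w0 \<cdot> v = w \<and> (\<forall>i \<in> S. l i \<cdot> v = z i) \<longleftrightarrow>
    (q S \<cdot> w0) \<cdot> v = q S \<cdot> w \<and> (\<forall>i \<in> insert k S. (l(k := p S \<cdot> w0)) i \<cdot> v = (z(k := p S \<cdot> w)) i)"
proof -
  have "(q S \<cdot> w0) \<cdot> v = q S \<cdot> w0 \<cdot> v" "(p S \<cdot> w0) \<cdot> v = p S \<cdot> w0 \<cdot> v"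
    using cmp_assoc[OF v w0 map_onD(1)[OF p order_refl]] cmp_assoc[OF v w0 map_onD(1)[OF q order_refl]]
    by simp_all
  moreover have "w0 \<cdot> v = w" if "q S \<cdot> w0 \<cdot> v = q S \<cdot> w" "p S \<cdot> w0 \<cdot> v = p S \<cdot> w"
    using pullback_eq[OF pb[OF order_refl] cmp_hom[OF v w0] w] that by simp
  ultimately show ?thesis using k by auto
qed

text \<open>Every cone for \<open>t\<close> has the shape treated above: its condition at index
  \<open>k\<close> is the commutative square that induces \<open>w\<close>.\<close>

lemma square_rel_cone_ex:
  assumes "rel_cone C A B t (insert k S) Z z0 z"
  obtains w where "w \<in> hom C Z (vert P S)" "p S \<cdot> w = z k" "q S \<cdot> w = z0"
    "rel_cone C (upper_cube k A) P u S Z w z"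
proof -
  note D = rel_coneD[OF assms]
  have 1: "insert k S - {k} = S" using k by auto
  have "edge B S (insert k S) \<in> hom C (vert B (insert k S)) (vert B S)"
    using cube_onD(3)[OF B] by blast
  moreover have "t S \<in> hom C (vert A S) (vert B S)" using map_onD(1)[OF t] by blast
  ultimately obtain w where w: "w \<in> hom C Z (vert P S)" "p S \<cdot> w = z k" "q S \<cdot> w = z0"
    using pullback_ex[OF pb[OF order_refl], of "z k" Z z0] D(2) D(3,4)[of k] 1
    by (auto simp: hom_def)
  moreover have "rel_cone C (upper_cube k A) P u S Z w z"
    unfolding square_rel_cone[OF w(1)] using assms w(2,3) by (metis fun_upd_triv)
  ultimately show thesis using that by blast
qed

text \<open>The cones on both sides correspond bijectively, compatibly with factorizations, so the
  same object represents them and only its legs are rewritten.\<close>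

lemma square_rel_lim:
  assumes w0: "w0 \<in> hom C L (vert P S)"
  shows "rel_lim C (upper_cube k A) P u S L w0 l \<longleftrightarrow>
    rel_lim C A B t (insert k S) L (q S \<cdot> w0) (l(k := p S \<cdot> w0))"
proof (cases "rel_cone C (upper_cube k A) P u S L w0 l")
  case False
  then show ?thesis unfolding rel_lim_def square_rel_cone[OF w0] by simp
next
  case True
  have l: "l i \<in> hom C L (vert A (insert k (S - {i})))" if "i \<in> S" for i
    using rel_coneD(3)[OF True that] by simp
  note factor = square_factor[OF w0 l]
  show ?thesis
  proof
    assume R: "rel_lim C (upper_cube k A) P u S L w0 l"
    have ex: "\<exists>!v. v \<in> hom C Z L \<and> (q S \<cdot> w0) \<cdot> v = z0 \<and>
        (\<forall>i \<in> insert k S. (l(k := p S \<cdot> w0)) i \<cdot> v = z i)"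
      if z: "rel_cone C A B t (insert k S) Z z0 z" for Z z0 z
    proof -
      obtain w where w: "w \<in> hom C Z (vert P S)" "p S \<cdot> w = z k" "q S \<cdot> w = z0"
        "rel_cone C (upper_cube k A) P u S Z w z"
        using square_rel_cone_ex[OF z] by blast
      have "\<exists>!v. v \<in> hom C Z L \<and> w0 \<cdot> v = w \<and> (\<forall>i \<in> S. l i \<cdot> v = z i)"
        using R w(4) unfolding rel_lim_def by blast
      moreover have zk: "z(k := p S \<cdot> w) = z" using w(2) by simp
      have "v \<in> hom C Z L \<and> w0 \<cdot> v = w \<and> (\<forall>i \<in> S. l i \<cdot> v = z i) \<longleftrightarrow>
          v \<in> hom C Z L \<and> (q S \<cdot> w0) \<cdot> v = z0 \<and>
          (\<forall>i \<in> insert k S. (l(k := p S \<cdot> w0)) i \<cdot> v = z i)" for v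
        using factor[OF _ _ w(1), of v z] unfolding zk w(3) by blast
      ultimately show ?thesis by (simp only:)
    qed
    have "rel_cone C A B t (insert k S) L (q S \<cdot> w0) (l(k := p S \<cdot> w0))"
      using True unfolding square_rel_cone[OF w0] .
    then show "rel_lim C A B t (insert k S) L (q S \<cdot> w0) (l(k := p S \<cdot> w0))"
      unfolding rel_lim_def by (intro conjI allI impI ex)
  next
    assume R: "rel_lim C A B t (insert k S) L (q S \<cdot> w0) (l(k := p S \<cdot> w0))"
    have ex: "\<exists>!v. v \<in> hom C Z L \<and> w0 \<cdot> v = w \<and> (\<forall>i \<in> S. l i \<cdot> v = z i)"
      if z: "rel_cone C (upper_cube k A) P u S Z w z" for Z w z
    proof -
      note w = rel_coneD(2)[OF z]
      have "\<exists>!v. v \<in> hom C Z L \<and> (q S \<cdot> w0) \<cdot> v = q S \<cdot> w \<and>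
          (\<forall>i \<in> insert k S. (l(k := p S \<cdot> w0)) i \<cdot> v = (z(k := p S \<cdot> w)) i)"
        using R z unfolding rel_lim_def square_rel_cone[OF w] by blast
      moreover have "v \<in> hom C Z L \<and> w0 \<cdot> v = w \<and> (\<forall>i \<in> S. l i \<cdot> v = z i) \<longleftrightarrow>
          v \<in> hom C Z L \<and> (q S \<cdot> w0) \<cdot> v = q S \<cdot> w \<and>
          (\<forall>i \<in> insert k S. (l(k := p S \<cdot> w0)) i \<cdot> v = (z(k := p S \<cdot> w)) i)" for v
        using factor[OF _ _ w, of v z] by blast
      ultimately show ?thesis by (simp only:)
    qed
    show "rel_lim C (upper_cube k A) P u S L w0 l"
      using True unfolding rel_lim_def by (intro conjI allI impI ex)
  qed
qed

text \<open>Both sides concern the same limit object and the same arrow \<open>v\<close> into it: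
  the comparison of \<open>t\<close> at \<open>insert k S\<close> is the comparison of
  \<open>u\<close> at \<open>S\<close>. This is what lowers the dimension by one in the induction on
  higher extensions.\<close>

lemma square_rel_good:
  "rel_good C E A B t (insert k S) \<longleftrightarrow> rel_good C E (upper_cube k A) P u S"
proof -
  let ?z = "\<lambda>i. edge A (insert k S - {i}) (insert k S)"
  have 1: "insert k S - {k} = S" using k by auto
  have 6: "insert k S - {i} = insert k (S - {i})" if "i \<in> S" for i using k that by auto
  \<comment> \<open>At index \<open>k\<close> the family consists of
    \<open>edge A S (insert k S)\<close>, which is \<open>u S\<close> followed by
    \<open>p S\<close>; so \<open>square_factor\<close> applies with \<open>u S\<close> in place of
    \<open>w\<close>.\<close>
  have z: "?z(k := p S \<cdot> u S) = ?z"
    by (rule fun_upd_idem) (unfold 1 pu[OF order_refl], rule refl)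
  have uS: "u S \<in> hom C (vert A (insert k S)) (vert P S)" using map_onD(1)[OF u order_refl] by simp
  have *: "w0 \<cdot> v = u S \<and> (\<forall>i \<in> S. l i \<cdot> v = ?z i) \<longleftrightarrow>
    (q S \<cdot> w0) \<cdot> v = t (insert k S) \<and> (\<forall>i \<in> insert k S. (l(k := p S \<cdot> w0)) i \<cdot> v = ?z i)"
    if "rel_cone C (upper_cube k A) P u S L w0 l" "v \<in> hom C (vert A (insert k S)) L" for w0 l L v
    using square_factor[of w0 L l v "vert A (insert k S)" "u S" ?z] rel_coneD(2,3)[OF that(1)] that(2)
      uS unfolding z qu[OF order_refl] by simp
  show ?thesis
  proof
    assume "rel_good C E A B t (insert k S)"
    then obtain L l0 l v where L: "rel_lim C A B t (insert k S) L l0 l"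
      and v: "v \<in> hom C (vert A (insert k S)) L" "l0 \<cdot> v = t (insert k S)"
        "\<forall>i \<in> insert k S. l i \<cdot> v = ?z i" "v \<in> E"
      unfolding rel_good_def by blast
    have "rel_cone C A B t (insert k S) L l0 l" using L unfolding rel_lim_def by blast
    then obtain w where w: "w \<in> hom C L (vert P S)" "p S \<cdot> w = l k" "q S \<cdot> w = l0"
      "rel_cone C (upper_cube k A) P u S L w l"
      using square_rel_cone_ex by blast
    have l: "l(k := p S \<cdot> w) = l" using w(2) by simp
    have "rel_lim C (upper_cube k A) P u S L w l"
      unfolding square_rel_lim[OF w(1)] l w(3) by fact
    moreover have "w \<cdot> v = u S \<and> (\<forall>i \<in> S. l i \<cdot> v = ?z i)"
      using *[OF w(4) v(1)] v l w(3) by simp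
    ultimately show "rel_good C E (upper_cube k A) P u S"
      unfolding rel_good_def using v 6 by auto
  next
    assume "rel_good C E (upper_cube k A) P u S"
    then obtain L w l v where L: "rel_lim C (upper_cube k A) P u S L w l"
      and v: "v \<in> hom C (vert A (insert k S)) L" "w \<cdot> v = u S"
        "\<forall>i \<in> S. l i \<cdot> v = ?z i" "v \<in> E"
      unfolding rel_good_def using 6 by auto
    have c: "rel_cone C (upper_cube k A) P u S L w l" using L unfolding rel_lim_def by blast
    have "rel_lim C A B t (insert k S) L (q S \<cdot> w) (l(k := p S \<cdot> w))"
      using L unfolding square_rel_lim[OF rel_coneD(2)[OF c]] .
    then show "rel_good C E A B t (insert k S)"
      unfolding rel_good_def using v *[OF c v(1)] by blast
  qed
qed

end

end

text \<open>Inverse to splitting off the direction \<open>k\<close>: the upper face is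
  \<open>A\<close>, the lower face is \<open>B\<close>. An edge that changes level first runs inside
  \<open>A\<close> and then crosses by \<open>t\<close> at the smaller set.\<close>

definition cyl :: "('o, 'a) category \<Rightarrow> nat \<Rightarrow> ('o, 'a) cube \<Rightarrow> ('o, 'a) cube \<Rightarrow>
    (nat set \<Rightarrow> 'a) \<Rightarrow> ('o, 'a) cube" where
  "cyl C k A B t =
    \<lparr>vert = (\<lambda>S. if k \<in> S then vert A (S - {k}) else vert B S),
     edge = (\<lambda>S T. if k \<in> S then edge A (S - {k}) (T - {k})
       else if k \<in> T then cmp C (t S) (edge A S (T - {k})) else edge B S T)\<rparr>"

lemma (in category) cube_on_cyl:
  assumes A: "cube_on C V A" and B: "cube_on C V B" and t: "map_on C V A B t"
  shows "cube_on C (insert k V) (cyl C k A B t)"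
proof (rule cube_onI)
  show "vert (cyl C k A B t) S \<in> Ob C"
    "edge (cyl C k A B t) S S = ident C (vert (cyl C k A B t) S)" if "S \<subseteq> insert k V" for S
    using cube_onD(1,2)[OF A, of "S - {k}"] cube_onD(1,2)[OF B, of S] that
    by (auto simp: cyl_def)
next
  fix S T assume T: "T \<subseteq> insert k V" "S \<subseteq> T"
  consider "k \<in> S" "k \<in> T" | "k \<notin> S" "k \<in> T" | "k \<notin> S" "k \<notin> T" using T by blast
  then show "edge (cyl C k A B t) S T \<in> hom C (vert (cyl C k A B t) T) (vert (cyl C k A B t) S)"
  proof cases
    case 1
    then show ?thesis using cube_onD(3)[OF A, of "T - {k}" "S - {k}"] T by (auto simp: cyl_def)
  next
    case 2
    then have s: "S \<subseteq> V" "T - {k} \<subseteq> V" "S \<subseteq> T - {k}" using T by auto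
    show ?thesis
      using cmp_hom[OF cube_onD(3)[OF A s(2,3)] map_onD(1)[OF t s(1)]] 2 by (simp add: cyl_def)
  next
    case 3
    then show ?thesis using cube_onD(3)[OF B, of T S] T by (auto simp: cyl_def)
  qed
next
  fix S T U assume U: "U \<subseteq> insert k V" "T \<subseteq> U" "S \<subseteq> T"
  consider "k \<in> S" "k \<in> T" "k \<in> U" | "k \<notin> S" "k \<in> T" "k \<in> U" | "k \<notin> S" "k \<notin> T" "k \<in> U"
    | "k \<notin> S" "k \<notin> T" "k \<notin> U" using U by blast
  then show "edge (cyl C k A B t) S T \<cdot> edge (cyl C k A B t) T U = edge (cyl C k A B t) S U"
  proof cases
    case 1
    have s: "U - {k} \<subseteq> V" "T - {k} \<subseteq> U - {k}" "S - {k} \<subseteq> T - {k}" using U by auto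
    show ?thesis using cube_onD(4)[OF A s] 1 by (simp add: cyl_def)
  next
    case 2
    then have s: "U - {k} \<subseteq> V" "T - {k} \<subseteq> V" "S \<subseteq> V" "T - {k} \<subseteq> U - {k}" "S \<subseteq> T - {k}"
      using U by auto
    show ?thesis
      using cube_onD(4)[OF A s(1,4,5)] 2
        cmp_assoc[OF cube_onD(3)[OF A s(1,4)] cube_onD(3)[OF A s(2,5)] map_onD(1)[OF t s(3)]]
      by (simp add: cyl_def)
  next
    \<comment> \<open>The crossing belongs to the arrow applied first, so naturality of
      \<open>t\<close> is used to postpone it. In the preceding case it belongs to the arrow applied
      last, and associativity is enough.\<close>
    case 3
    then have s: "U - {k} \<subseteq> V" "T \<subseteq> V" "S \<subseteq> V" "T \<subseteq> U - {k}" "S \<subseteq> T" "S \<subseteq> U - {k}"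
      using U by auto
    have "edge B S T \<cdot> t T \<cdot> edge A T (U - {k}) = t S \<cdot> edge A S T \<cdot> edge A T (U - {k})"
      by (rule comp_exchange[OF cube_onD(3)[OF A s(1,4)] map_onD(1)[OF t s(2)] cube_onD(3)[OF B s(2,5)]
            cube_onD(3)[OF A s(2,5)] map_onD(1)[OF t s(3)] map_onD(2)[OF t s(2,5), symmetric]])
    then show ?thesis using cube_onD(4)[OF A s(1,4,5)] 3 by (simp add: cyl_def)
  next
    case 4
    then have s: "U \<subseteq> V" using U by auto
    show ?thesis using cube_onD(4)[OF B s U(2,3)] 4 by (simp add: cyl_def)
  qed
qed

lemma cyl_simps:
  assumes "k \<notin> T"
  shows "vert (cyl C k A B t) T = vert B T" "vert (cyl C k A B t) (insert k T) = vert A T"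
    and "S \<subseteq> T \<Longrightarrow> edge (cyl C k A B t) S T = edge B S T"
    and "S \<subseteq> T \<Longrightarrow> edge (cyl C k A B t) (insert k S) (insert k T) = edge A S T"
    and "edge (cyl C k A B t) T (insert k T) = cmp C (t T) (edge A T T)"
proof -
  show "edge (cyl C k A B t) (insert k S) (insert k T) = edge A S T" if "S \<subseteq> T"
  proof -
    have "k \<notin> S" using assms that by blast
    then show ?thesis using assms by (simp add: cyl_def)
  qed
qed (use assms in \<open>auto simp: cyl_def\<close>)


section \<open>Towers as cubes\<close>

text \<open>A tower records edges and components but no vertices, hence the comparison of edges
  only.\<close>

lemma tower_of_map_cube_cong:
  assumes "\<And>S T. T \<subseteq> {..<n} \<Longrightarrow> S \<subseteq> T \<Longrightarrow> edge A S T = edge A' S T"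
    and "\<And>S T. T \<subseteq> {..<n} \<Longrightarrow> S \<subseteq> T \<Longrightarrow> edge B S T = edge B' S T"
    and "\<And>S. S \<subseteq> {..<n} \<Longrightarrow> t S = t' S"
  shows "tower_of_map n A B t = tower_of_map n A' B' t'"
  using assms
proof (induction n arbitrary: A A' B B' t t')
  case (Suc n)
  have 1: "T \<subseteq> {..<Suc n}" "insert n T \<subseteq> {..<Suc n}" if "T \<subseteq> {..<n}" for T :: "nat set"
    using that by auto
  have 2: "edge (upper_cube n A) S T = edge (upper_cube n A') S T"
    "edge (upper_cube n B) S T = edge (upper_cube n B') S T"
    "edge A S T = edge A' S T" "edge B S T = edge B' S T"
    if "T \<subseteq> {..<n}" "S \<subseteq> T" for S T
    using Suc.prems(1,2)[OF 1(1)[OF that(1)] that(2)]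
      Suc.prems(1,2)[OF 1(2)[OF that(1)] insert_mono[OF that(2)]] by simp_all
  have 3: "edge A S (insert n S) = edge A' S (insert n S)"
    "edge B S (insert n S) = edge B' S (insert n S)" "t S = t' S" "t (insert n S) = t' (insert n S)"
    if "S \<subseteq> {..<n}" for S
    using Suc.prems(1,2)[OF 1(2)[OF that] subset_insertI] Suc.prems(3)[OF 1(1)[OF that]]
      Suc.prems(3)[OF 1(2)[OF that]] by simp_all
  have "tower_of_map n (upper_cube n A) A (\<lambda>S. edge A S (insert n S)) =
      tower_of_map n (upper_cube n A') A' (\<lambda>S. edge A' S (insert n S))"
    "tower_of_map n (upper_cube n B) B (\<lambda>S. edge B S (insert n S)) =
      tower_of_map n (upper_cube n B') B' (\<lambda>S. edge B' S (insert n S))"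
    "tower_of_map n (upper_cube n A) (upper_cube n B) (\<lambda>S. t (insert n S)) =
      tower_of_map n (upper_cube n A') (upper_cube n B') (\<lambda>S. t' (insert n S))"
    "tower_of_map n A B t = tower_of_map n A' B' t'"
    by (rule Suc.IH; use 2 3 in simp)+
  then show ?case by simp
qed simp

text \<open>Turns equations in \<open>Arr C n\<close> into equations at every vertex. Together with
  \<open>tower_of_map_surj\<close> it identifies the arrows of \<open>Arr C n\<close> between two
  cubes with natural transformations.\<close>

lemma tower_of_map_inject:
  "tower_of_map n A B s = tower_of_map n A' B' t \<Longrightarrow> S \<subseteq> {..<n} \<Longrightarrow> s S = t S"
proof (induction n arbitrary: A A' B B' s t S)
  case (Suc n)
  have 1: "tower_of_map n (upper_cube n A) (upper_cube n B) (\<lambda>S. s (insert n S)) =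
      tower_of_map n (upper_cube n A') (upper_cube n B') (\<lambda>S. t (insert n S))"
    and 2: "tower_of_map n A B s = tower_of_map n A' B' t" using Suc.prems(1) by simp_all
  show ?case
  proof (cases "n \<in> S")
    case True
    have "S - {n} \<subseteq> {..<n}" using Suc.prems(2) by auto
    from Suc.IH[OF 1 this] show ?thesis using True by (simp add: insert_absorb)
  next
    case False
    then have "S \<subseteq> {..<n}" using Suc.prems(2) by (auto simp: less_Suc_eq)
    then show ?thesis by (rule Suc.IH[OF 2])
  qed
qed simp

lemma tower_of_map_ident:
  assumes "category C" "is_cube C n A"
  shows "tower_of_map n A A (\<lambda>S. ident C (vert A S)) = ident (Arr C n) (tower_of_cube n A)"
  using assms(2)
proof (induction n arbitrary: A)
  case 0
  then show ?case by (simp add: base_cat_def)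
next
  case (Suc n)
  note U = upper_cube_is_cube[OF Suc.prems]
  have "tower_of_map n (upper_cube n A) A (\<lambda>S. edge A S (insert n S)) \<in>
      hom (Arr C n) (tower_of_cube n (upper_cube n A)) (tower_of_cube n A)"
    by (rule tower_of_map_hom[OF assms(1) U])
  then show ?case using Suc.IH[OF U(1)] Suc.IH[OF U(2)] by (simp add: arr_cat_def hom_def)
qed

lemma (in category) is_cube_cyl:
  "is_cube C n A \<Longrightarrow> is_cube C n B \<Longrightarrow> cube_map C n A B t \<Longrightarrow> is_cube C (Suc n) (cyl C n A B t)"
  using cube_on_cyl[of "{..<n}" A B t n]
  by (simp add: is_cube_iff_cube_on cube_map_iff_map_on lessThan_Suc)

lemma (in category) tower_of_cube_cyl:
  assumes A: "is_cube C n A" and t: "cube_map C n A B t"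
  shows "tower_of_cube (Suc n) (cyl C n A B t) = tower_of_map n A B t"
  unfolding tower_of_cube.simps
proof (rule tower_of_map_cube_cong)
  fix S T :: "nat set" assume T: "T \<subseteq> {..<n}" "S \<subseteq> T"
  then have "n \<notin> T" by auto
  then show "edge (upper_cube n (cyl C n A B t)) S T = edge A S T"
    "edge (cyl C n A B t) S T = edge B S T"
    using cyl_simps(3,4) T(2) by simp_all
next
  fix S :: "nat set" assume S: "S \<subseteq> {..<n}"
  then have "n \<notin> S" by auto
  then have "edge (cyl C n A B t) S (insert n S) = t S \<cdot> edge A S S" by (rule cyl_simps(5))
  also have "\<dots> = t S"
    using A t S cmp_ident_right unfolding is_cube_def cube_map_def by metis
  finally show "edge (cyl C n A B t) S (insert n S) = t S" .
qed

text \<open>Naturality within a level is given. Between levels, the edge from \<open>T\<close> to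
  \<open>S\<close> is factored through \<open>T - {n}\<close>: the crossing is handled by the
  commuting square, the rest by naturality of \<open>t0\<close>.\<close>

lemma (in category) cube_map_glue:
  assumes A: "is_cube C (Suc n) A" and B: "is_cube C (Suc n) B"
    and t1: "cube_map C n (upper_cube n A) (upper_cube n B) t1" and t0: "cube_map C n A B t0"
    and eq: "\<And>S. S \<subseteq> {..<n} \<Longrightarrow> t0 S \<cdot> edge A S (insert n S) = edge B S (insert n S) \<cdot> t1 S"
  shows "cube_map C (Suc n) A B (\<lambda>S. if n \<in> S then t1 (S - {n}) else t0 S)" (is "cube_map C _ A B ?t")
proof -
  have A: "cube_on C {..<Suc n} A" and B: "cube_on C {..<Suc n} B"
    and t1: "map_on C {..<n} (upper_cube n A) (upper_cube n B) t1" and t0: "map_on C {..<n} A B t0"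
    using assms by (simp_all only: is_cube_iff_cube_on cube_map_iff_map_on)
  have sub: "S \<subseteq> {..<Suc n} \<Longrightarrow> S - {n} \<subseteq> {..<n}"
    "S \<subseteq> {..<Suc n} \<Longrightarrow> n \<notin> S \<Longrightarrow> S \<subseteq> {..<n}" for S by (auto simp: less_Suc_eq)
  have h1: "t1 (S - {n}) \<in> hom C (vert A S) (vert B S)" if "S \<subseteq> {..<Suc n}" "n \<in> S" for S
    using map_onD(1)[OF t1 sub(1)[OF that(1)]] that(2) by (simp add: insert_absorb)
  have h0: "t0 S \<in> hom C (vert A S) (vert B S)" if "S \<subseteq> {..<Suc n}" "n \<notin> S" for S
    using map_onD(1)[OF t0 sub(2)[OF that]] .
  have "map_on C {..<Suc n} A B ?t"
  proof (rule map_onI)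
    show "?t S \<in> hom C (vert A S) (vert B S)" if "S \<subseteq> {..<Suc n}" for S
      using h1 h0 that by simp
    fix S T assume T: "T \<subseteq> {..<Suc n}" "S \<subseteq> T"
    have S: "S \<subseteq> {..<Suc n}" using T by auto
    consider "n \<in> S" "n \<in> T" | "n \<notin> S" "n \<in> T" | "n \<notin> S" "n \<notin> T" using T by blast
    then show "?t S \<cdot> edge A S T = edge B S T \<cdot> ?t T"
    proof cases
      case 1
      then show ?thesis
        using map_onD(2)[OF t1 sub(1)[OF T(1)] Diff_mono[OF T(2) order_refl]] by (simp add: insert_absorb)
    next
      case 2
      let ?T = "T - {n}"
      have T': "?T \<subseteq> {..<n}" "S \<subseteq> ?T" "S \<subseteq> {..<n}" "?T \<subseteq> T" "insert n ?T = T" "?T \<subseteq> {..<Suc n}"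
        using 2 T sub by auto
      note hA = cube_onD(3)[OF A T(1) T'(4)] cube_onD(3)[OF A T'(6,2)]
        and hB = cube_onD(3)[OF B T(1) T'(4)] cube_onD(3)[OF B T'(6,2)]
      have n: "n \<notin> ?T" by simp
      have "t0 S \<cdot> edge A S T = t0 S \<cdot> edge A S ?T \<cdot> edge A ?T T"
        using cube_onD(4)[OF A T(1) T'(4,2)] by simp
      also have "\<dots> = edge B S ?T \<cdot> t0 ?T \<cdot> edge A ?T T"
        by (rule comp_exchange[OF hA(1) hA(2) h0[OF S 2(1)] h0[OF T'(6) n] hB(2) map_onD(2)[OF t0 T'(1,2)]])
      also have "\<dots> = edge B S ?T \<cdot> edge B ?T T \<cdot> t1 ?T"
        using eq[OF T'(1)] T'(5) by simp
      also have "\<dots> = edge B S T \<cdot> t1 ?T"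
        by (rule comp_reduce[OF h1[OF T(1) 2(2)] hB cube_onD(4)[OF B T(1) T'(4,2)]])
      finally show ?thesis using 2 by simp
    next
      case 3
      then show ?thesis using map_onD(2)[OF t0 sub(2)[OF T(1)] T(2)] by simp
    qed
  qed
  then show ?thesis by (simp only: cube_map_iff_map_on)
qed

text \<open>An arrow of \<open>Arr C (Suc n)\<close> is a commutative square. Its two sides are
  natural transformations by induction, and injectivity turns its commutativity into the vertexwise
  equations needed for glueing.\<close>

lemma (in category) tower_of_map_surj:
  assumes "is_cube C n A" "is_cube C n B"
    and "f \<in> hom (Arr C n) (tower_of_cube n A) (tower_of_cube n B)"
  shows "\<exists>t. cube_map C n A B t \<and> f = tower_of_map n A B t"
  using assms
proof (induction n arbitrary: A B f)
  case 0
  then obtain g where g: "f = Mor g" "g \<in> hom C (vert A {}) (vert B {})"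
    by (auto simp: base_cat_def hom_def)
  then have "cube_map C 0 A B (\<lambda>_. g)"
    using 0 cmp_ident_left cmp_ident_right by (simp add: cube_map_def is_cube_def)
  then show ?case using g by (intro exI[of _ "\<lambda>_. g"]) simp
next
  case (Suc n)
  note A = upper_cube_is_cube[OF Suc.prems(1)] and B = upper_cube_is_cube[OF Suc.prems(2)]
  define a where "a = tower_of_map n (upper_cube n A) A (\<lambda>S. edge A S (insert n S))"
  define b where "b = tower_of_map n (upper_cube n B) B (\<lambda>S. edge B S (insert n S))"
  have a: "a \<in> hom (Arr C n) (tower_of_cube n (upper_cube n A)) (tower_of_cube n A)"
    and b: "b \<in> hom (Arr C n) (tower_of_cube n (upper_cube n B)) (tower_of_cube n B)"
    unfolding a_def b_def by (rule tower_of_map_hom[OF category_axioms A], rule tower_of_map_hom[OF category_axioms B])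
  obtain f1 f0 where f: "f = Sq a b f1 f0"
    and f1: "f1 \<in> hom (Arr C n) (tower_of_cube n (upper_cube n A)) (tower_of_cube n (upper_cube n B))"
    and f0: "f0 \<in> hom (Arr C n) (tower_of_cube n A) (tower_of_cube n B)"
    and eq: "cmp (Arr C n) f0 a = cmp (Arr C n) b f1"
    using Suc.prems(3) a b by (auto simp: arr_cat_def hom_def a_def b_def)
  obtain t1 where t1: "cube_map C n (upper_cube n A) (upper_cube n B) t1"
      "f1 = tower_of_map n (upper_cube n A) (upper_cube n B) t1"
    using Suc.IH[OF A(1) B(1) f1] by blast
  obtain t0 where t0: "cube_map C n A B t0" "f0 = tower_of_map n A B t0"
    using Suc.IH[OF A(2) B(2) f0] by blast
  have "t0 S \<cdot> edge A S (insert n S) = edge B S (insert n S) \<cdot> t1 S" if "S \<subseteq> {..<n}" for S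
    using tower_of_map_inject[OF _ that] eq unfolding a_def b_def t0 t1 tower_of_map_cmp by blast
  then have t: "cube_map C (Suc n) A B (\<lambda>S. if n \<in> S then t1 (S - {n}) else t0 S)"
    by (rule cube_map_glue[OF Suc.prems(1,2) t1(1) t0(1)])
  have 1: "n \<notin> S" "S - {n} = S" if "S \<subseteq> {..<n}" for S using that by auto
  have "f1 = tower_of_map n (upper_cube n A) (upper_cube n B)
      (\<lambda>S. if n \<in> insert n S then t1 (insert n S - {n}) else t0 (insert n S))"
    unfolding t1(2) by (rule tower_of_map_cong) (simp add: 1)
  moreover have "f0 = tower_of_map n A B (\<lambda>S. if n \<in> S then t1 (S - {n}) else t0 S)"
    unfolding t0(2) by (rule tower_of_map_cong) (simp add: 1)
  ultimately show ?case using t f unfolding a_def b_def by (intro exI conjI) (assumption, simp)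
qed

text \<open>The pullback in the definition of the higher classes has an unspecified object as its
  vertex; this presents it as a cube. An object of the next stage is an arrow of the present one,
  hence a natural transformation, and its cylinder is the cube.\<close>

lemma (in category) tower_of_cube_surj:
  assumes "x \<in> Ob (Arr C n)"
  shows "\<exists>A. is_cube C n A \<and> x = tower_of_cube n A"
  using assms
proof (induction n arbitrary: x)
  case 0
  then obtain y where y: "x = Obj y" "y \<in> Ob C" by (auto simp: base_cat_def)
  let ?A = "\<lparr>vert = (\<lambda>_. y), edge = (\<lambda>_ _. ident C y)\<rparr>"
  have "is_cube C 0 ?A"
    using y(2) ident_hom cmp_ident_left[OF ident_hom[OF y(2)]] by (simp add: is_cube_def)
  then show ?case using y by (intro exI[of _ ?A]) simp
next
  case (Suc n)
  interpret A: category "Arr C n" by (rule category_Arr[OF category_axioms])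
  have x: "x \<in> Ar (Arr C n)" using Suc.prems by (simp add: arr_cat_def)
  obtain A where A: "is_cube C n A" "src (Arr C n) x = tower_of_cube n A"
    using Suc.IH[OF A.src_Ob[OF x]] by blast
  obtain B where B: "is_cube C n B" "tgt (Arr C n) x = tower_of_cube n B"
    using Suc.IH[OF A.tgt_Ob[OF x]] by blast
  obtain t where t: "cube_map C n A B t" "x = tower_of_map n A B t"
    using tower_of_map_surj[OF A(1) B(1), of x] x A(2) B(2) by (auto simp: hom_def)
  show ?case
    using is_cube_cyl[OF A(1) B(1) t(1)] tower_of_cube_cyl[OF A(1) t(1)] t(2) by metis
qed

section \<open>Pullbacks in iterated arrow categories\<close>

lemma hom_arr_cat:
  "f \<in> hom (arr_cat D) a b \<longleftrightarrow> (\<exists>f1 f0. f = Sq a b f1 f0 \<and> a \<in> Ar D \<and> b \<in> Ar D \<and>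
    f1 \<in> hom D (src D a) (src D b) \<and> f0 \<in> hom D (tgt D a) (tgt D b) \<and> cmp D f0 a = cmp D b f1)"
  by (auto simp: hom_def arr_cat_def)

lemma cmp_arr_cat:
  "cmp (arr_cat D) (Sq b c g1 g0) (Sq a b' f1 f0) = Sq a c (cmp D g1 f1) (cmp D g0 f0)"
  by (simp add: arr_cat_def)

text \<open>The pullbacks of sources and of targets supply the two components of a factorization;
  these form a commutative square because the projections of the pullback of targets are jointly
  monic.\<close>

lemma pullback_arr_cat:
  assumes "category D"
    and f: "Sq a c f1 f0 \<in> hom (arr_cat D) a c" and g: "Sq b c g1 g0 \<in> hom (arr_cat D) b c"
    and p: "Sq r a p1 p0 \<in> hom (arr_cat D) r a" and q: "Sq r b q1 q0 \<in> hom (arr_cat D) r b"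
    and pb1: "is_pullback D f1 g1 (src D r) p1 q1" and pb0: "is_pullback D f0 g0 (tgt D r) p0 q0"
  shows "is_pullback (arr_cat D) (Sq a c f1 f0) (Sq b c g1 g0) r (Sq r a p1 p0) (Sq r b q1 q0)"
proof -
  interpret category D by fact
  interpret AC: category "arr_cat D" by (rule category_arr_cat) fact
  have f': "f1 \<in> hom D (src D a) (src D c)" "f0 \<in> hom D (tgt D a) (tgt D c)"
    and g': "g1 \<in> hom D (src D b) (src D c)" "g0 \<in> hom D (tgt D b) (tgt D c)"
    and p': "p1 \<in> hom D (src D r) (src D a)" "p0 \<in> hom D (tgt D r) (tgt D a)" "cmp D p0 r = cmp D a p1"
    and q': "q1 \<in> hom D (src D r) (src D b)" "q0 \<in> hom D (tgt D r) (tgt D b)" "cmp D q0 r = cmp D b q1"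
    and Ar: "a \<in> Ar D" "b \<in> Ar D" "r \<in> Ar D"
    using f g p q unfolding hom_arr_cat by auto
  have par: "x \<in> hom D (src D x) (tgt D x)" if "x \<in> Ar D" for x using that by (simp add: hom_def)
  show ?thesis
  proof (rule AC.pullbackI[OF f g p q])
    show "cmp (arr_cat D) (Sq a c f1 f0) (Sq r a p1 p0) = cmp (arr_cat D) (Sq b c g1 g0) (Sq r b q1 q0)"
      using pullbackD(3)[OF pb1 f'(1) g'(1)] pullbackD(3)[OF pb0 f'(2) g'(2)] by (simp add: cmp_arr_cat)
  next
    fix z s t
    assume s: "s \<in> hom (arr_cat D) z a" and t: "t \<in> hom (arr_cat D) z b"
      and eq: "cmp (arr_cat D) (Sq a c f1 f0) s = cmp (arr_cat D) (Sq b c g1 g0) t"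
    obtain s1 s0 where s': "s = Sq z a s1 s0" "s1 \<in> hom D (src D z) (src D a)"
      "s0 \<in> hom D (tgt D z) (tgt D a)" "cmp D s0 z = cmp D a s1" and z: "z \<in> Ar D"
      using s unfolding hom_arr_cat by auto
    obtain t1 t0 where t': "t = Sq z b t1 t0" "t1 \<in> hom D (src D z) (src D b)"
      "t0 \<in> hom D (tgt D z) (tgt D b)" "cmp D t0 z = cmp D b t1"
      using t unfolding hom_arr_cat by auto
    have eq': "cmp D f1 s1 = cmp D g1 t1" "cmp D f0 s0 = cmp D g0 t0"
      using eq unfolding s'(1) t'(1) cmp_arr_cat by simp_all
    obtain u1 where u1: "u1 \<in> hom D (src D z) (src D r)" "cmp D p1 u1 = s1" "cmp D q1 u1 = t1"
      using pullback_ex[OF pb1, of s1 "src D z" t1] s'(2) t'(2) eq'(1) f' g' by (auto simp: hom_def)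
    obtain u0 where u0: "u0 \<in> hom D (tgt D z) (tgt D r)" "cmp D p0 u0 = s0" "cmp D q0 u0 = t0"
      using pullback_ex[OF pb0, of s0 "tgt D z" t0] s'(3) t'(3) eq'(2) f' g' by (auto simp: hom_def)
    have "cmp D u0 z = cmp D r u1"
    proof (rule pullback_eq[OF pb0 cmp_hom[OF par[OF z] u0(1)] cmp_hom[OF u1(1) par[OF Ar(3)]]])
      show "cmp D p0 (cmp D u0 z) = cmp D p0 (cmp D r u1)"
        using comp_reduce[OF par[OF z] u0(1) p'(2) u0(2)] s'(4) u1(2)
          comp_exchange[OF u1(1) par[OF Ar(3)] p'(2) p'(1) par[OF Ar(1)] p'(3)] by simp
      show "cmp D q0 (cmp D u0 z) = cmp D q0 (cmp D r u1)"
        using comp_reduce[OF par[OF z] u0(1) q'(2) u0(3)] t'(4) u1(3)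
          comp_exchange[OF u1(1) par[OF Ar(3)] q'(2) q'(1) par[OF Ar(2)] q'(3)] by simp
    qed
    then have "Sq z r u1 u0 \<in> hom (arr_cat D) z r" using u0 u1 z Ar unfolding hom_arr_cat by simp
    then show "\<exists>u. u \<in> hom (arr_cat D) z r \<and> cmp (arr_cat D) (Sq r a p1 p0) u = s \<and>
        cmp (arr_cat D) (Sq r b q1 q0) u = t"
      using u0 u1 s'(1) t'(1) by (intro exI[of _ "Sq z r u1 u0"]) (simp add: cmp_arr_cat)
  next
    fix z u v
    assume "u \<in> hom (arr_cat D) z r" "v \<in> hom (arr_cat D) z r"
      and eq: "cmp (arr_cat D) (Sq r a p1 p0) u = cmp (arr_cat D) (Sq r a p1 p0) v"
        "cmp (arr_cat D) (Sq r b q1 q0) u = cmp (arr_cat D) (Sq r b q1 q0) v"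
    then obtain u1 u0 v1 v0 where uv: "u = Sq z r u1 u0" "v = Sq z r v1 v0"
      "u1 \<in> hom D (src D z) (src D r)" "u0 \<in> hom D (tgt D z) (tgt D r)"
      "v1 \<in> hom D (src D z) (src D r)" "v0 \<in> hom D (tgt D z) (tgt D r)"
      unfolding hom_arr_cat by blast
    show "u = v"
      using eq pullback_eq[OF pb1 uv(3,5)] pullback_eq[OF pb0 uv(4,6)] unfolding uv(1,2) cmp_arr_cat
      by simp
  qed
qed

lemma pullback_base_cat:
  assumes "category C" "is_pullback C f g P p q"
  shows "is_pullback (base_cat C) (Mor f) (Mor g) (Obj P) (Mor p) (Mor q)"
proof -
  interpret category C by fact
  interpret B: category "base_cat C" by (rule category_base_cat) fact
  have h: "h \<in> hom (base_cat C) x y \<longleftrightarrow> (\<exists>h' x' y'. h = Mor h' \<and> x = Obj x' \<and> y = Obj y' \<and> h' \<in> hom C x' y')"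
    for h x y by (auto simp: base_cat_def hom_def)
  have c: "cmp (base_cat C) (Mor k) (Mor h) = Mor (cmp C k h)" for k h by (simp add: base_cat_def)
  have f: "f \<in> hom C (src C f) (tgt C f)" and g: "g \<in> hom C (src C g) (tgt C f)"
    using assms(2) unfolding is_pullback_def hom_def by auto
  note PD = pullbackD[OF assms(2) f g]
  show ?thesis
  proof (rule B.pullbackI[of _ "Obj (src C f)" "Obj (tgt C f)" _ "Obj (src C g)"])
    show "\<exists>u. u \<in> hom (base_cat C) Z (Obj P) \<and> cmp (base_cat C) (Mor p) u = s \<and>
        cmp (base_cat C) (Mor q) u = t"
      if st: "s \<in> hom (base_cat C) Z (Obj (src C f))" "t \<in> hom (base_cat C) Z (Obj (src C g))"
        "cmp (base_cat C) (Mor f) s = cmp (base_cat C) (Mor g) t" for Z s t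
    proof -
      obtain Z' s' t' where *: "Z = Obj Z'" "s = Mor s'" "t = Mor t'" "s' \<in> hom C Z' (src C f)"
        "t' \<in> hom C Z' (src C g)" using st unfolding h by auto
      moreover have "cmp C f s' = cmp C g t'" using st(3) unfolding * c by simp
      ultimately obtain u where "u \<in> hom C Z' P" "cmp C p u = s'" "cmp C q u = t'"
        using pullback_ex[OF assms(2)] by blast
      then show ?thesis using * by (intro exI[of _ "Mor u"]) (auto simp: h c)
    qed
    show "u = v" if "u \<in> hom (base_cat C) Z (Obj P)" "v \<in> hom (base_cat C) Z (Obj P)"
      "cmp (base_cat C) (Mor p) u = cmp (base_cat C) (Mor p) v"
      "cmp (base_cat C) (Mor q) u = cmp (base_cat C) (Mor q) v" for Z u v
      using that pullback_eq[OF assms(2)] unfolding h by (auto simp: c)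
  qed (use f g PD in \<open>auto simp: h c\<close>)
qed

text \<open>The levelwise description of pullbacks in an arrow category is iterated down to single
  vertices.\<close>

lemma pullback_tower:
  assumes "category C" "is_cube C n X" "is_cube C n W" "is_cube C n Y" "is_cube C n P"
    and "cube_map C n X Y f" "cube_map C n W Y g" "cube_map C n P X p" "cube_map C n P W q"
    and "\<And>S. S \<subseteq> {..<n} \<Longrightarrow> is_pullback C (f S) (g S) (vert P S) (p S) (q S)"
  shows "is_pullback (Arr C n) (tower_of_map n X Y f) (tower_of_map n W Y g)
    (tower_of_cube n P) (tower_of_map n P X p) (tower_of_map n P W q)"
  using assms(2-)
proof (induction n arbitrary: X W Y P f g p q)
  case 0
  then show ?case using pullback_base_cat[OF assms(1) "0.prems"(9)[of "{}"]] by simp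
next
  case (Suc n)
  note U = upper_cube_is_cube[OF Suc.prems(1)] upper_cube_is_cube[OF Suc.prems(2)]
    upper_cube_is_cube[OF Suc.prems(3)] upper_cube_is_cube[OF Suc.prems(4)]
  note M = cube_map_upper(1,2)[OF Suc.prems(5)] cube_map_upper(1,2)[OF Suc.prems(6)]
    cube_map_upper(1,2)[OF Suc.prems(7)] cube_map_upper(1,2)[OF Suc.prems(8)]
  have sub: "S \<subseteq> {..<Suc n}" "insert n S \<subseteq> {..<Suc n}" if "S \<subseteq> {..<n}" for S :: "nat set"
    using that by auto
  have 1: "is_pullback (Arr C n)
      (tower_of_map n (upper_cube n X) (upper_cube n Y) (\<lambda>S. f (insert n S)))
      (tower_of_map n (upper_cube n W) (upper_cube n Y) (\<lambda>S. g (insert n S)))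
      (tower_of_cube n (upper_cube n P))
      (tower_of_map n (upper_cube n P) (upper_cube n X) (\<lambda>S. p (insert n S)))
      (tower_of_map n (upper_cube n P) (upper_cube n W) (\<lambda>S. q (insert n S)))"
    by (rule Suc.IH) (use U M Suc.prems(9)[OF sub(2)] in simp_all)
  have 0: "is_pullback (Arr C n) (tower_of_map n X Y f) (tower_of_map n W Y g)
      (tower_of_cube n P) (tower_of_map n P X p) (tower_of_map n P W q)"
    by (rule Suc.IH) (use U M Suc.prems(9)[OF sub(1)] in simp_all)
  note h = tower_of_map_hom[OF assms(1), of "Suc n"]
  have r: "tower_of_map n (upper_cube n P) P (\<lambda>S. edge P S (insert n S)) \<in>
      hom (Arr C n) (tower_of_cube n (upper_cube n P)) (tower_of_cube n P)"
    by (rule tower_of_map_hom[OF assms(1) U(10-12)])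
  show ?case
    using pullback_arr_cat[OF category_Arr[OF assms(1), of n]] h[OF Suc.prems(1,3,5)]
      h[OF Suc.prems(2,3,6)] h[OF Suc.prems(4,1,7)] h[OF Suc.prems(4,2,8)] 0 1 r
    by (simp add: hom_def)
qed


section \<open>Higher extensions\<close>

lemma bd_cone_cube_cong:
  assumes "\<And>T. T \<subseteq> S \<Longrightarrow> vert A T = vert A' T"
    and "\<And>T U. U \<subseteq> S \<Longrightarrow> T \<subseteq> U \<Longrightarrow> edge A T U = edge A' T U"
  shows "bd_cone C A S Z z \<longleftrightarrow> bd_cone C A' S Z z"
proof -
  have 1: "vert A (S - {i}) = vert A' (S - {i})" for i using assms(1) by blast
  have 2: "edge A (S - {i, j}) (S - {i}) = edge A' (S - {i, j}) (S - {i})"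
    "edge A (S - {i, j}) (S - {j}) = edge A' (S - {i, j}) (S - {j})" for i j
    by (rule assms(2); blast)+
  show ?thesis unfolding bd_cone_def 1 2 ..
qed

lemma good_cube_cong:
  assumes "\<And>T. T \<subseteq> S \<Longrightarrow> vert A T = vert A' T"
    and "\<And>T U. U \<subseteq> S \<Longrightarrow> T \<subseteq> U \<Longrightarrow> edge A T U = edge A' T U"
  shows "good C E A S \<longleftrightarrow> good C E A' S"
proof -
  have 1: "vert A S = vert A' S" using assms(1) by blast
  have 2: "edge A (S - {i}) S = edge A' (S - {i}) S" for i using assms(2) by blast
  have 3: "bd_cone C A S Z z \<longleftrightarrow> bd_cone C A' S Z z" for Z z
    by (rule bd_cone_cube_cong) (use assms in auto)
  show ?thesis unfolding good_def bd_lim_def 1 2 3 ..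
qed

lemma rel_good_cube_cong:
  assumes "\<And>T. T \<subseteq> S \<Longrightarrow> vert A T = vert A' T"
    and "\<And>T U. U \<subseteq> S \<Longrightarrow> T \<subseteq> U \<Longrightarrow> edge A T U = edge A' T U"
    and "\<And>T. T \<subseteq> S \<Longrightarrow> vert B T = vert B' T"
    and "\<And>T U. U \<subseteq> S \<Longrightarrow> T \<subseteq> U \<Longrightarrow> edge B T U = edge B' T U"
    and "\<And>T. T \<subseteq> S \<Longrightarrow> t T = t' T"
  shows "rel_good C E A B t S \<longleftrightarrow> rel_good C E A' B' t' S"
proof -
  have 1: "vert A S = vert A' S" "vert B S = vert B' S" "t S = t' S" "t (S - {i}) = t' (S - {i})" for i
    by (rule assms; blast)+
  have 2: "edge A (S - {i}) S = edge A' (S - {i}) S" "edge B (S - {i}) S = edge B' (S - {i}) S" for i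
    by (rule assms; blast)+
  have 3: "bd_cone C A S Z z \<longleftrightarrow> bd_cone C A' S Z z" for Z z
    by (rule bd_cone_cube_cong) (use assms in auto)
  show ?thesis unfolding rel_good_def rel_lim_def rel_cone_def 1 2 3 ..
qed

lemma good_cyl:
  assumes "k \<notin> S"
  shows "good C E (cyl C k A B t) S \<longleftrightarrow> good C E B S"
proof (rule good_cube_cong)
  fix T U assume "U \<subseteq> S" "T \<subseteq> U"
  moreover from this have "k \<notin> U" using assms by blast
  ultimately show "edge (cyl C k A B t) T U = edge B T U" by (intro cyl_simps(3))
next
  fix T assume "T \<subseteq> S"
  then have "k \<notin> T" using assms by blast
  then show "vert (cyl C k A B t) T = vert B T" by (rule cyl_simps(1))
qed

lemma (in category) edge_cyl_insert:
  assumes A: "cube_on C V A" and t: "map_on C V A B t" and T: "T \<subseteq> V" "k \<notin> T"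
  shows "edge (cyl C k A B t) T (insert k T) = t T"
  using cyl_simps(5)[OF T(2), of C A B t] cube_onD(2)[OF A T(1)] cmp_ident_right[OF map_onD(1)[OF t T(1)]]
  by simp

lemma (in category) good_cyl_insert:
  assumes k: "k \<notin> S" and A: "cube_on C S A" and t: "map_on C S A B t"
  shows "good C E (cyl C k A B t) (insert k S) \<longleftrightarrow> rel_good C E A B t S"
  unfolding good_insert[OF k]
proof (rule rel_good_cube_cong)
  fix T assume T: "T \<subseteq> S"
  then have "k \<notin> T" using k by blast
  then show "vert (upper_cube k (cyl C k A B t)) T = vert A T" "vert (cyl C k A B t) T = vert B T"
    "edge (cyl C k A B t) T (insert k T) = t T"
    using cyl_simps(1,2) edge_cyl_insert[OF A t T] by simp_all
  fix U assume U: "U \<subseteq> T"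
  show "edge (upper_cube k (cyl C k A B t)) U T = edge A U T" "edge (cyl C k A B t) U T = edge B U T"
    using cyl_simps(3,4)[OF \<open>k \<notin> T\<close> U] by simp_all
qed

text \<open>Subsets are sorted by whether they contain \<open>k\<close>: those that do not belong to
  the lower face, and those that do concern the map in direction \<open>k\<close>.\<close>

lemma good_insert_all:
  assumes "k \<notin> V"
  shows "(\<forall>S \<subseteq> insert k V. S \<noteq> {} \<longrightarrow> good C E A S) \<longleftrightarrow>
    (\<forall>S \<subseteq> V. S \<noteq> {} \<longrightarrow> good C E A S) \<and>
    (\<forall>S \<subseteq> V. rel_good C E (upper_cube k A) A (\<lambda>S. edge A S (insert k S)) S)" (is "?L \<longleftrightarrow> ?R")
proof -
  have 1: "k \<notin> S" if "S \<subseteq> V" for S using assms that by blast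
  show ?thesis
  proof
    assume L: ?L
    show ?R
    proof (intro conjI allI impI)
      show "good C E A S" if "S \<subseteq> V" "S \<noteq> {}" for S using L that by (simp add: subset_insertI2)
      show "rel_good C E (upper_cube k A) A (\<lambda>S. edge A S (insert k S)) S" if "S \<subseteq> V" for S
        using L insert_mono[OF that, of k] unfolding good_insert[OF 1[OF that], symmetric] by simp
    qed
  next
    assume R: ?R
    show ?L
    proof (intro allI impI)
      fix S assume S: "S \<subseteq> insert k V" "S \<noteq> {}"
      show "good C E A S"
      proof (cases "k \<in> S")
        case True
        then have *: "S = insert k (S - {k})" "S - {k} \<subseteq> V" using S(1) by auto
        have "good C E A (insert k (S - {k}))"
          unfolding good_insert[OF 1[OF *(2)]] using R *(2) by simp
        then show ?thesis using *(1) by simp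
      next
        case False
        then have "S \<subseteq> V" using S(1) by blast
        then show ?thesis using R S(2) by simp
      qed
    qed
  qed
qed

lemma (in category) map_on_comp:
  assumes A: "cube_on C V A" and B: "cube_on C V B" and D: "cube_on C V D"
    and s: "map_on C V A B s" and t: "map_on C V B D t"
  shows "map_on C V A D (\<lambda>S. t S \<cdot> s S)"
proof (rule map_onI)
  show "t S \<cdot> s S \<in> hom C (vert A S) (vert D S)" if "S \<subseteq> V" for S
    using cmp_hom map_onD(1) s t that by metis
  fix S T assume T: "T \<subseteq> V" "S \<subseteq> T"
  then have S: "S \<subseteq> V" by blast
  note h = map_onD(1)[OF s] map_onD(1)[OF t]
  have "(t S \<cdot> s S) \<cdot> edge A S T = t S \<cdot> edge B S T \<cdot> s T"
    using cmp_assoc[OF cube_onD(3)[OF A T] h(1)[OF S] h(2)[OF S]] map_onD(2)[OF s T] by simp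
  also have "\<dots> = edge D S T \<cdot> t T \<cdot> s T"
    by (rule comp_exchange[OF h(1)[OF T(1)] cube_onD(3)[OF B T] h(2)[OF S] h(2)[OF T(1)]
          cube_onD(3)[OF D T] map_onD(2)[OF t T]])
  finally show "(t S \<cdot> s S) \<cdot> edge A S T = edge D S T \<cdot> t T \<cdot> s T" .
qed

section \<open>Uniqueness of pullbacks up to isomorphism\<close>

lemma (in category) pullback_iso:
  assumes pb: "is_pullback C f g P p q" and r: "r \<in> hom C Q P" and s: "s \<in> hom C P Q"
    and "r \<cdot> s = ident C P" "s \<cdot> r = ident C Q" "p \<cdot> r = p'" "q \<cdot> r = q'"
  shows "is_pullback C f g Q p' q'"
proof -
  have f: "f \<in> hom C (src C f) (tgt C f)" and g: "g \<in> hom C (src C g) (tgt C f)"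
    using pb unfolding is_pullback_def hom_def by auto
  note PD = pullbackD[OF pb f g]
  show ?thesis
  proof (rule pullbackI[OF f g])
    show "p' \<in> hom C Q (src C f)" "q' \<in> hom C Q (src C g)" using cmp_hom[OF r] PD assms by auto
    show "f \<cdot> p' = g \<cdot> q'" using comp_exchange[OF r PD(1) f PD(2) g PD(3)] assms by simp
  next
    fix Z x y assume "x \<in> hom C Z (src C f)" "y \<in> hom C Z (src C g)" "f \<cdot> x = g \<cdot> y"
    then obtain u where u: "u \<in> hom C Z P" "p \<cdot> u = x" "q \<cdot> u = y" using pullback_ex[OF pb] by blast
    have "r \<cdot> s \<cdot> u = u" using comp_reduce[OF u(1) s r assms(4)] cmp_ident_left[OF u(1)] by simp
    then have "p' \<cdot> s \<cdot> u = x" "q' \<cdot> s \<cdot> u = y"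
      using cmp_assoc[OF cmp_hom[OF u(1) s] r] PD(1,2) u assms(6,7) by metis+
    then show "\<exists>u. u \<in> hom C Z Q \<and> p' \<cdot> u = x \<and> q' \<cdot> u = y" using cmp_hom[OF u(1) s] by blast
  next
    fix Z u v assume uv: "u \<in> hom C Z Q" "v \<in> hom C Z Q" "p' \<cdot> u = p' \<cdot> v" "q' \<cdot> u = q' \<cdot> v"
    have "p \<cdot> r \<cdot> u = p \<cdot> r \<cdot> v" "q \<cdot> r \<cdot> u = q \<cdot> r \<cdot> v"
      using comp_reduce[OF uv(1) r PD(1) assms(6)] comp_reduce[OF uv(2) r PD(1) assms(6)]
        comp_reduce[OF uv(1) r PD(2) assms(7)] comp_reduce[OF uv(2) r PD(2) assms(7)] uv(3,4) by simp_all
    then have "r \<cdot> u = r \<cdot> v" using pullback_eq[OF pb cmp_hom[OF uv(1) r] cmp_hom[OF uv(2) r]] by blast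
    then have "s \<cdot> r \<cdot> u = s \<cdot> r \<cdot> v" by simp
    then show "u = v"
      using comp_reduce[OF uv(1) r s assms(5)] comp_reduce[OF uv(2) r s assms(5)]
        cmp_ident_left[OF uv(1)] cmp_ident_left[OF uv(2)] by simp
  qed
qed

lemma (in category) pullback_unique:
  assumes pb: "is_pullback C f g P p q" and pb': "is_pullback C f g Q p' q'"
  obtains r s where "r \<in> hom C Q P" "s \<in> hom C P Q" "r \<cdot> s = ident C P" "s \<cdot> r = ident C Q"
    "p \<cdot> r = p'" "q \<cdot> r = q'"
proof -
  have f: "f \<in> hom C (src C f) (tgt C f)" and g: "g \<in> hom C (src C g) (tgt C f)"
    using pb unfolding is_pullback_def hom_def by auto
  note PD = pullbackD[OF pb f g] and QD = pullbackD[OF pb' f g]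
  obtain r where r: "r \<in> hom C Q P" "p \<cdot> r = p'" "q \<cdot> r = q'"
    using pullback_ex[OF pb QD(1-3)] by blast
  obtain s where s: "s \<in> hom C P Q" "p' \<cdot> s = p" "q' \<cdot> s = q"
    using pullback_ex[OF pb' PD(1-3)] by blast
  have "r \<cdot> s = ident C P"
    by (rule pullback_eq[OF pb cmp_hom[OF s(1) r(1)] ident_hom[OF PD(4)]])
      (use comp_reduce[OF s(1) r(1) PD(1) r(2)] comp_reduce[OF s(1) r(1) PD(2) r(3)] s
        cmp_ident_right PD in auto)
  moreover have "s \<cdot> r = ident C Q"
    by (rule pullback_eq[OF pb' cmp_hom[OF r(1) s(1)] ident_hom[OF QD(4)]])
      (use comp_reduce[OF r(1) s(1) QD(1) s(2)] comp_reduce[OF r(1) s(1) QD(2) s(3)] r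
        cmp_ident_right QD in auto)
  ultimately show thesis using that r s by blast
qed

section \<open>The categories of extensions as full subcategories\<close>

lemma Ext_simps [simp]:
  "src (Ext C E n) = src (Arr C n)" "tgt (Ext C E n) = tgt (Arr C n)"
  "cmp (Ext C E n) = cmp (Arr C n)" "ident (Ext C E n) = ident (Arr C n)"
  by (cases n; simp add: full_subcat_def)+

lemma Ob_Ext_subset: "Ob (Ext C E n) \<subseteq> Ob (Arr C n)"
  by (cases n) (simp_all add: full_subcat_def)

lemma Ob_Ext_Suc: "x \<in> Ob (Ext C E (Suc n)) \<longleftrightarrow> x \<in> Ar (Arr C n) \<and> x \<in> E_iter C E n"
  by (auto simp: full_subcat_def arr_cat_def)

lemma Ar_Ext:
  assumes "category C"
  shows "f \<in> Ar (Ext C E n) \<longleftrightarrow> f \<in> Ar (Arr C n) \<and> src (Arr C n) f \<in> Ob (Ext C E n) \<and>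
    tgt (Arr C n) f \<in> Ob (Ext C E n)"
proof -
  interpret category "Arr C n" by (rule category_Arr[OF assms])
  show ?thesis using src_Ob tgt_Ob by (cases n) (auto simp: full_subcat_def)
qed

lemma hom_Ext:
  assumes "category C"
  shows "f \<in> hom (Ext C E n) x y \<longleftrightarrow> f \<in> hom (Arr C n) x y \<and> x \<in> Ob (Ext C E n) \<and> y \<in> Ob (Ext C E n)"
  unfolding hom_def by (auto simp: Ar_Ext[OF assms])

lemma category_Ext:
  assumes "category C"
  shows "category (Ext C E n)"
proof -
  interpret category "Arr C n" by (rule category_Arr[OF assms])
  show ?thesis
  proof
    show "ident (Ext C E n) x \<in> hom (Ext C E n) x x" if "x \<in> Ob (Ext C E n)" for x
      using that ident_hom[of x] Ob_Ext_subset[of C E n] by (auto simp: hom_Ext[OF assms])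
  qed (use cmp_hom cmp_ident_left cmp_ident_right cmp_assoc in \<open>auto simp: hom_Ext[OF assms] Ar_Ext[OF assms]\<close>)
qed

text \<open>By fullness, the factorizations in \<open>Arr C n\<close> are arrows of the subcategory
  as soon as their ends belong to it. A pullback given in \<open>Ext C E n\<close> is related to the
  pointwise one by uniqueness instead.\<close>

lemma pullback_Ext:
  assumes "category C" "is_pullback (Arr C n) f g P p q" "f \<in> Ar (Ext C E n)" "g \<in> Ar (Ext C E n)"
    and "P \<in> Ob (Ext C E n)"
  shows "is_pullback (Ext C E n) f g P p q"
proof -
  interpret A: category "Arr C n" by (rule category_Arr[OF assms(1)])
  interpret X: category "Ext C E n" by (rule category_Ext[OF assms(1)])
  have t: "tgt (Arr C n) f = tgt (Arr C n) g" using assms(2) unfolding is_pullback_def by blast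
  have f: "f \<in> hom (Arr C n) (src (Arr C n) f) (tgt (Arr C n) f)"
    and g: "g \<in> hom (Arr C n) (src (Arr C n) g) (tgt (Arr C n) f)"
    using assms(3,4) t by (auto simp: hom_def Ar_Ext[OF assms(1)])
  note PD = A.pullbackD[OF assms(2) f g]
  have Ob: "src (Arr C n) f \<in> Ob (Ext C E n)" "src (Arr C n) g \<in> Ob (Ext C E n)"
    "tgt (Arr C n) f \<in> Ob (Ext C E n)"
    using assms(3,4) by (simp_all add: Ar_Ext[OF assms(1)])
  show ?thesis
  proof (rule X.pullbackI)
    show "f \<in> hom (Ext C E n) (src (Arr C n) f) (tgt (Arr C n) f)"
      "g \<in> hom (Ext C E n) (src (Arr C n) g) (tgt (Arr C n) f)"
      "p \<in> hom (Ext C E n) P (src (Arr C n) f)" "q \<in> hom (Ext C E n) P (src (Arr C n) g)"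
      using f g PD Ob assms(5) by (simp_all add: hom_Ext[OF assms(1)])
    show "cmp (Ext C E n) f p = cmp (Ext C E n) g q" using PD by simp
    show "\<exists>u. u \<in> hom (Ext C E n) Z P \<and> cmp (Ext C E n) p u = s \<and> cmp (Ext C E n) q u = t"
      if "s \<in> hom (Ext C E n) Z (src (Arr C n) f)" "t \<in> hom (Ext C E n) Z (src (Arr C n) g)"
        "cmp (Ext C E n) f s = cmp (Ext C E n) g t" for Z s t
      using A.pullback_ex[OF assms(2), of s Z t] that assms(5) by (auto simp: hom_Ext[OF assms(1)])
    show "u = v" if "u \<in> hom (Ext C E n) Z P" "v \<in> hom (Ext C E n) Z P"
      "cmp (Ext C E n) p u = cmp (Ext C E n) p v" "cmp (Ext C E n) q u = cmp (Ext C E n) q v" for Z u v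
      using A.pullback_eq[OF assms(2), of u Z v] that by (simp add: hom_Ext[OF assms(1)])
  qed
qed

lemma E_iter_Ar:
  assumes "category C" "E \<subseteq> Ar C"
  shows "E_iter C E n \<subseteq> Ar (Ext C E n)"
proof (cases n)
  case 0
  then show ?thesis using assms(2) by (auto simp: base_cat_def)
next
  case (Suc m)
  show ?thesis
  proof
    fix x assume "x \<in> E_iter C E n"
    then obtain a b f1 f0 where x: "x = Sq a b f1 f0" "x \<in> Ar (arr_cat (Ext C E m))"
      "a \<in> E_iter C E m" "b \<in> E_iter C E m"
      unfolding Suc by (auto simp: higher_class_def)
    then have "x \<in> Ar (arr_cat (Arr C m))"
      by (auto simp: arr_cat_def hom_Ext[OF assms(1)] Ar_Ext[OF assms(1)])
    then show "x \<in> Ar (Ext C E n)"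
      using x unfolding Suc by (simp add: full_subcat_def) (simp add: arr_cat_def)
  qed
qed

text \<open>Goodness of the cylinder of \<open>t\<close> at all nonempty subsets, sorted by whether
  the new direction occurs. The empty set is excluded for \<open>B\<close>, where it would ask for a
  terminal object, but kept for \<open>t\<close>, where it says that \<open>t {}\<close> is in
  \<open>E\<close>.\<close>

definition good_map ::
    "('o, 'a) category \<Rightarrow> 'a set \<Rightarrow> nat \<Rightarrow> ('o, 'a) cube \<Rightarrow> ('o, 'a) cube \<Rightarrow> (nat set \<Rightarrow> 'a) \<Rightarrow> bool"
  where
  "good_map C E n A B t \<longleftrightarrow> (\<forall>S \<subseteq> {..<n}. S \<noteq> {} \<longrightarrow> good C E B S) \<and>
     (\<forall>S \<subseteq> {..<n}. rel_good C E A B t S)"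

section \<open>Higher extensions described by conditions on subsets\<close>

context extension_class
begin

lemma good_map_edge:
  "good_map C E n (upper_cube n A) A (\<lambda>S. edge A S (insert n S)) \<longleftrightarrow>
    (\<forall>S \<subseteq> {..<Suc n}. S \<noteq> {} \<longrightarrow> good C E A S)"
  unfolding good_map_def lessThan_Suc by (rule good_insert_all[symmetric]) simp

lemma good_map_source:
  assumes "is_cube C n A" "is_cube C n B" "cube_map C n A B t" "good_map C E n A B t"
    and "S \<subseteq> {..<n}" "S \<noteq> {}"
  shows "good C E A S"
proof (rule good_of_rel_good)
  show "finite S" using assms(5) finite_subset by blast
  show "cube_on C S A" "cube_on C S B" "map_on C S A B t"
    using assms unfolding is_cube_iff_cube_on cube_map_iff_map_on
    by (auto intro: cube_on_subset map_on_subset)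
  show "good C E B T" if "T \<subseteq> S" "T \<noteq> {}" for T
    using assms(4,5) that unfolding good_map_def by simp
  show "rel_good C E A B t T" if "T \<subseteq> S" for T
    using assms(4,5) that unfolding good_map_def by simp
qed fact

text \<open>Here the symmetry in the directions is used. The cylinder of \<open>t\<close> is a good
  cube with the new direction \<open>Suc n\<close>; its upper face in direction \<open>n\<close> is
  good by \<open>good_upper_cube\<close>; and this face is, up to the order of the two directions,
  the cylinder of the map to be treated.\<close>

lemma good_map_upper:
  assumes A: "is_cube C (Suc n) A" and B: "is_cube C (Suc n) B" and t: "cube_map C (Suc n) A B t"
    and good: "good_map C E (Suc n) A B t"
  shows "good_map C E n (upper_cube n A) (upper_cube n B) (\<lambda>S. t (insert n S))"
proof -
  let ?k = "Suc n" and ?K = "cyl C (Suc n) A B t"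
  have A: "cube_on C {..<Suc n} A" and B: "cube_on C {..<Suc n} B" and t: "map_on C {..<Suc n} A B t"
    using assms by (simp_all only: is_cube_iff_cube_on cube_map_iff_map_on)
  have K: "cube_on C (insert ?k {..<Suc n}) ?K" by (rule cube_on_cyl[OF A B t])
  have k: "?k \<notin> {..<Suc n}" by simp
  have goodK: "good C E ?K S" if S: "S \<subseteq> insert ?k {..<Suc n}" "S \<noteq> {}" for S
  proof (cases "?k \<in> S")
    case True
    then have *: "S = insert ?k (S - {?k})" "S - {?k} \<subseteq> {..<Suc n}" "?k \<notin> S - {?k}" using S(1) by auto
    have "rel_good C E A B t (S - {?k})" using good *(2) unfolding good_map_def by blast
    then have "good C E ?K (insert ?k (S - {?k}))"
      using good_cyl_insert[OF *(3) cube_on_subset[OF A *(2)] map_on_subset[OF t *(2)]] by simp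
    then show ?thesis using *(1) by simp
  next
    case False
    then have "S \<subseteq> {..<Suc n}" using S(1) by blast
    then have "good C E B S" using good S(2) unfolding good_map_def by blast
    then show ?thesis by (rule good_cyl[OF False, THEN iffD2])
  qed
  have goodU: "good C E (upper_cube n ?K) S" if S: "S \<subseteq> insert ?k {..<n}" "S \<noteq> {}" for S
  proof (rule good_upper_cube[OF _ _ _ S(2)])
    show "finite S" using S finite_subset by blast
    have *: "insert n S \<subseteq> insert ?k {..<Suc n}" using S by auto
    show "cube_on C (insert n S) ?K" using cube_on_subset[OF K *] .
    show "n \<notin> S" using S by auto
    show "good C E ?K T" if "T \<subseteq> insert n S" "T \<noteq> {}" for T
      by (rule goodK) (use that * in auto)
  qed
  show ?thesis
    unfolding good_map_def
  proof (intro conjI allI impI)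
    fix S assume S: "S \<subseteq> {..<n}"
    have kT: "?k \<notin> insert n T" if "T \<subseteq> S" for T using that S by auto
    have nT: "insert n T \<subseteq> {..<Suc n}" if "T \<subseteq> S" for T using that S by auto
    have "?k \<notin> S" using kT[OF order_refl] by blast
    show "good C E (upper_cube n B) S" if "S \<noteq> {}"
    proof -
      have "good C E (upper_cube n ?K) S" using goodU S that by blast
      moreover have "good C E (upper_cube n ?K) S \<longleftrightarrow> good C E (upper_cube n B) S"
      proof (rule good_cube_cong)
        show "vert (upper_cube n ?K) T = vert (upper_cube n B) T" if "T \<subseteq> S" for T
          using cyl_simps(1)[OF kT[OF that]] by simp
        show "edge (upper_cube n ?K) T U = edge (upper_cube n B) T U" if "U \<subseteq> S" "T \<subseteq> U" for T U
          using cyl_simps(3)[OF kT[OF that(1)] insert_mono[OF that(2)]] by simp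
      qed
      ultimately show ?thesis by simp
    qed
    \<comment> \<open>The face in direction \<open>n\<close> is now split in direction
      \<open>Suc n\<close>. The two insertions commute, so the resulting map is the upper part of
      \<open>t\<close>.\<close>
    have "good C E (upper_cube n ?K) (insert ?k S)" by (rule goodU) (use S in auto)
    then have "rel_good C E (upper_cube ?k (upper_cube n ?K)) (upper_cube n ?K)
        (\<lambda>S. edge (upper_cube n ?K) S (insert ?k S)) S"
      using good_insert[OF \<open>?k \<notin> S\<close>] by blast
    moreover have "rel_good C E (upper_cube ?k (upper_cube n ?K)) (upper_cube n ?K)
        (\<lambda>S. edge (upper_cube n ?K) S (insert ?k S)) S \<longleftrightarrow>
      rel_good C E (upper_cube n A) (upper_cube n B) (\<lambda>S. t (insert n S)) S"
    proof (rule rel_good_cube_cong)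
      fix T assume T: "T \<subseteq> S"
      show "vert (upper_cube ?k (upper_cube n ?K)) T = vert (upper_cube n A) T"
        using cyl_simps(2)[OF kT[OF T]] by (simp add: insert_commute)
      show "vert (upper_cube n ?K) T = vert (upper_cube n B) T"
        using cyl_simps(1)[OF kT[OF T]] by simp
      show "edge (upper_cube n ?K) T (insert ?k T) = t (insert n T)"
        using edge_cyl_insert[OF A t nT[OF T] kT[OF T]] by (simp add: insert_commute)
      fix U assume U: "U \<subseteq> T"
      show "edge (upper_cube ?k (upper_cube n ?K)) U T = edge (upper_cube n A) U T"
        using cyl_simps(4)[OF kT[OF T] insert_mono[OF U]] by (simp add: insert_commute)
      show "edge (upper_cube n ?K) U T = edge (upper_cube n B) U T"
        using cyl_simps(3)[OF kT[OF T] insert_mono[OF U]] by simp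
    qed
    ultimately show "rel_good C E (upper_cube n A) (upper_cube n B) (\<lambda>S. t (insert n S)) S" by simp
  qed
qed

text \<open>Goodness of \<open>B\<close> puts its edges in direction \<open>n\<close> into
  \<open>E\<close>, so they can be pulled back along \<open>t\<close> vertex by vertex. The
  projection \<open>p\<close> is then a base change of a good map, and since \<open>A\<close> is
  good on the lower face, so is \<open>P\<close>. This will place \<open>P\<close> in
  \<open>Ext C E n\<close>.\<close>

lemma square_pullback:
  assumes A: "is_cube C (Suc n) A" and B: "is_cube C (Suc n) B" and t: "cube_map C (Suc n) A B t"
    and goodA: "\<forall>S \<subseteq> {..<n}. S \<noteq> {} \<longrightarrow> good C E A S"
    and goodB: "\<forall>S \<subseteq> {..<Suc n}. S \<noteq> {} \<longrightarrow> good C E B S"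
  obtains P p q u where "is_cube C n P" "cube_map C n P A p" "cube_map C n P (upper_cube n B) q"
    "cube_map C n (upper_cube n A) P u"
    "\<And>S. S \<subseteq> {..<n} \<Longrightarrow> is_pullback C (t S) (edge B S (insert n S)) (vert P S) (p S) (q S)"
    "\<And>S. S \<subseteq> {..<n} \<Longrightarrow> p S \<cdot> u S = edge A S (insert n S)"
    "\<And>S. S \<subseteq> {..<n} \<Longrightarrow> q S \<cdot> u S = t (insert n S)"
    "\<forall>S \<subseteq> {..<n}. S \<noteq> {} \<longrightarrow> good C E P S"
proof -
  note UA = upper_cube_is_cube[OF A, unfolded is_cube_iff_cube_on cube_map_iff_map_on]
    and UB = upper_cube_is_cube[OF B, unfolded is_cube_iff_cube_on cube_map_iff_map_on]
    and Ut = cube_map_upper(1,2)[OF t, unfolded is_cube_iff_cube_on cube_map_iff_map_on]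
  let ?b = "\<lambda>S. edge B S (insert n S)"
  have bE: "?b S \<in> E" if S: "S \<subseteq> {..<n}" for S
  proof (rule edge_in_E)
    show "finite S" using S finite_subset by blast
    have "insert n S \<subseteq> {..<Suc n}" using S by auto
    then show "cube_on C (insert n S) B" using B cube_on_subset unfolding is_cube_iff_cube_on by blast
    show "n \<notin> S" using S by auto
    show "good C E B T" if "T \<subseteq> insert n S" "T \<noteq> {}" for T
      using goodB that \<open>insert n S \<subseteq> {..<Suc n}\<close> by (meson order_trans)
  qed
  have "\<exists>P p q. is_pullback C (t S) (?b S) P p q" if "S \<subseteq> {..<n}" for S
    using E_pullback[OF bE[OF that] map_onD(1)[OF UB(3) that] map_onD(1)[OF Ut(2) that]] pullback_sym
    by metis
  then obtain P p q where P: "cube_on C {..<n} P" "map_on C {..<n} P A p"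
    "map_on C {..<n} P (upper_cube n B) q"
    "\<And>S. S \<subseteq> {..<n} \<Longrightarrow> is_pullback C (t S) (?b S) (vert P S) (p S) (q S)"
    using pullback_cube[OF UA(2) UB(1,2) Ut(2) UB(3)] by metis
  obtain u where u: "map_on C {..<n} (upper_cube n A) P u"
      "\<And>S. S \<subseteq> {..<n} \<Longrightarrow> p S \<cdot> u S = edge A S (insert n S)"
      "\<And>S. S \<subseteq> {..<n} \<Longrightarrow> q S \<cdot> u S = t (insert n S)"
    using pullback_cube_map[OF UA(2) UB(1) P(1) UA(1) Ut(2) UB(3) P(2-4) UA(3) Ut(1)]
      cube_map_upper(3)[OF t] by metis
  \<comment> \<open>The square is read with its sides exchanged: the good map is the one given by
    the edges of \<open>B\<close>, and \<open>t\<close> is the map along which it is pulled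
    back.\<close>
  have goodp: "rel_good C E P A p S" if "S \<subseteq> {..<n}" for S
  proof (rule rel_good_pullback[OF finite_lessThan UB(1) UA(2) UB(2) P(1) UB(3) Ut(2) P(3,2)])
    show "is_pullback C (?b S) (t S) (vert P S) (q S) (p S)" if "S \<subseteq> {..<n}" for S
      using pullback_sym[OF P(4)[OF that]] .
    show "rel_good C E (upper_cube n B) B ?b S" if "S \<subseteq> {..<n}" for S
      using goodB that unfolding good_map_edge[symmetric] good_map_def by blast
    show "good C E A S" if "S \<subseteq> {..<n}" "S \<noteq> {}" for S using goodA that by blast
  qed fact
  have "good_map C E n P A p" using goodp goodA unfolding good_map_def by blast
  then have "\<forall>S \<subseteq> {..<n}. S \<noteq> {} \<longrightarrow> good C E P S"
    using good_map_source[of n P A p] P(1,2) UA(2)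
    unfolding is_cube_iff_cube_on cube_map_iff_map_on by blast
  then show thesis
    using that[of P p q u] P u unfolding is_cube_iff_cube_on cube_map_iff_map_on by blast
qed

text \<open>Objects and arrows are handled together because the pullback in the higher class lives
  in \<open>Ext C E n\<close>, so goodness of its vertex must be recognized as membership there. In
  the step, a square corresponds to a map of cubes: subsets without \<open>n\<close> are covered by
  \<open>b\<close> and \<open>f0\<close>, subsets with \<open>n\<close> by the comparison arrow
  through \<open>square_rel_good\<close>. Conversely, \<open>good_map_source\<close> and
  \<open>good_map_upper\<close> give the sides \<open>a\<close> and \<open>f1\<close>.\<close>

lemma E_iter_and_Ob_Ext_iff_good:
  "(\<forall>A B t. is_cube C n A \<longrightarrow> is_cube C n B \<longrightarrow> cube_map C n A B t \<longrightarrow>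
     (tower_of_map n A B t \<in> E_iter C E n \<longleftrightarrow> good_map C E n A B t)) \<and>
   (\<forall>A. is_cube C n A \<longrightarrow>
     (tower_of_cube n A \<in> Ob (Ext C E n) \<longleftrightarrow> (\<forall>S \<subseteq> {..<n}. S \<noteq> {} \<longrightarrow> good C E A S)))"
proof (induction n)
  case 0
  have "tower_of_map 0 A B t \<in> E_iter C E 0 \<longleftrightarrow> good_map C E 0 A B t"
    if "is_cube C 0 A" "is_cube C 0 B" "cube_map C 0 A B t" for A B t
    using rel_good_empty[of t A B] that
    unfolding good_map_def is_cube_iff_cube_on cube_map_iff_map_on
    by (auto dest: map_onD(1))
  moreover have "tower_of_cube 0 A \<in> Ob (Ext C E 0)" if "is_cube C 0 A" for A
    using tower_of_cube_Ob[OF category_axioms that] by simp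
  ultimately show ?case by simp
next
  case (Suc n)
  have IH: "tower_of_map n A B t \<in> E_iter C E n \<longleftrightarrow> good_map C E n A B t"
    if "is_cube C n A" "is_cube C n B" "cube_map C n A B t" for A B t using Suc that by blast
  have IHo: "tower_of_cube n A \<in> Ob (Ext C E n) \<longleftrightarrow> (\<forall>S \<subseteq> {..<n}. S \<noteq> {} \<longrightarrow> good C E A S)"
    if "is_cube C n A" for A using Suc that by blast
  interpret X: category "Ext C E n" by (rule category_Ext[OF category_axioms])
  note homX = hom_Ext[OF category_axioms, of _ E n]
  have EAr: "E_iter C E n \<subseteq> Ar (Ext C E n)" by (rule E_iter_Ar[OF category_axioms E_Ar])
  have edge: "tower_of_map n (upper_cube n A) A (\<lambda>S. edge A S (insert n S)) \<in> E_iter C E n \<longleftrightarrow>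
      (\<forall>S \<subseteq> {..<Suc n}. S \<noteq> {} \<longrightarrow> good C E A S)" if "is_cube C (Suc n) A" for A
    using IH[OF upper_cube_is_cube[OF that]] good_map_edge by simp
  have "tower_of_cube (Suc n) A \<in> Ob (Ext C E (Suc n)) \<longleftrightarrow>
      (\<forall>S \<subseteq> {..<Suc n}. S \<noteq> {} \<longrightarrow> good C E A S)" if "is_cube C (Suc n) A" for A
    using edge[OF that] tower_of_cube_Ob[OF category_axioms that] unfolding Ob_Ext_Suc
    by (simp add: arr_cat_def)
  moreover have "tower_of_map (Suc n) A B t \<in> E_iter C E (Suc n) \<longleftrightarrow> good_map C E (Suc n) A B t"
    if A: "is_cube C (Suc n) A" and B: "is_cube C (Suc n) B" and t: "cube_map C (Suc n) A B t" for A B t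
  proof -
    note UA = upper_cube_is_cube[OF A] and UB = upper_cube_is_cube[OF B] and Ut = cube_map_upper[OF t]
    define a where "a = tower_of_map n (upper_cube n A) A (\<lambda>S. edge A S (insert n S))"
    define b where "b = tower_of_map n (upper_cube n B) B (\<lambda>S. edge B S (insert n S))"
    define f1 where "f1 = tower_of_map n (upper_cube n A) (upper_cube n B) (\<lambda>S. t (insert n S))"
    define f0 where "f0 = tower_of_map n A B t"
    have T: "tower_of_map (Suc n) A B t = Sq a b f1 f0" by (simp add: a_def b_def f1_def f0_def)
    note H = tower_of_map_hom[OF category_axioms]
    have h: "a \<in> hom (Arr C n) (tower_of_cube n (upper_cube n A)) (tower_of_cube n A)"
      "b \<in> hom (Arr C n) (tower_of_cube n (upper_cube n B)) (tower_of_cube n B)"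
      "f1 \<in> hom (Arr C n) (tower_of_cube n (upper_cube n A)) (tower_of_cube n (upper_cube n B))"
      "f0 \<in> hom (Arr C n) (tower_of_cube n A) (tower_of_cube n B)"
      unfolding a_def b_def f1_def f0_def using H UA UB Ut by blast+
    have sq: "cmp (Arr C n) f0 a = cmp (Arr C n) b f1"
    proof -
      have "tower_of_cube (Suc n) A = a" "tower_of_cube (Suc n) B = b" by (simp_all add: a_def b_def)
      then have "Sq a b f1 f0 \<in> hom (arr_cat (Arr C n)) a b" using H[OF A B t] unfolding T by simp
      then show ?thesis unfolding hom_arr_cat by blast
    qed
    have st: "src (Arr C n) a = tower_of_cube n (upper_cube n A)" "src (Arr C n) b = tower_of_cube n (upper_cube n B)"
      "tgt (Arr C n) a = tower_of_cube n A" "tgt (Arr C n) b = tower_of_cube n B"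
      using h by (simp_all add: hom_def)
    have aE: "a \<in> E_iter C E n \<longleftrightarrow> (\<forall>S \<subseteq> {..<Suc n}. S \<noteq> {} \<longrightarrow> good C E A S)"
      and bE: "b \<in> E_iter C E n \<longleftrightarrow> (\<forall>S \<subseteq> {..<Suc n}. S \<noteq> {} \<longrightarrow> good C E B S)"
      and f1E: "f1 \<in> E_iter C E n \<longleftrightarrow> good_map C E n (upper_cube n A) (upper_cube n B) (\<lambda>S. t (insert n S))"
      and f0E: "f0 \<in> E_iter C E n \<longleftrightarrow> good_map C E n A B t"
      unfolding a_def b_def f1_def f0_def using edge[OF A] edge[OF B] IH[OF UA(1) UB(1) Ut(1)]
        IH[OF UA(2) UB(2) Ut(2)] by blast+
    have mem: "Sq a b f1 f0 \<in> E_iter C E (Suc n) \<longleftrightarrow>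
        a \<in> E_iter C E n \<and> b \<in> E_iter C E n \<and> f1 \<in> E_iter C E n \<and> f0 \<in> E_iter C E n \<and>
        (\<exists>P p q u. is_pullback (Ext C E n) f0 b P p q \<and> u \<in> hom (Ext C E n) (src (Arr C n) a) P \<and>
          cmp (Arr C n) p u = a \<and> cmp (Arr C n) q u = f1 \<and> u \<in> E_iter C E n)"
    proof -
      have "Sq a b f1 f0 \<in> Ar (arr_cat (Ext C E n))" if "a \<in> E_iter C E n" "b \<in> E_iter C E n"
        using that EAr h sq st unfolding arr_cat_def
        by (auto simp: homX Ar_Ext[OF category_axioms])
      then show ?thesis by (auto simp: higher_class_def)
    qed
    show ?thesis
    proof
      assume good: "good_map C E (Suc n) A B t"
      have goodA: "\<forall>S \<subseteq> {..<Suc n}. S \<noteq> {} \<longrightarrow> good C E A S"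
        using good_map_source[OF A B t good] by blast
      have goodB: "\<forall>S \<subseteq> {..<Suc n}. S \<noteq> {} \<longrightarrow> good C E B S"
        using good unfolding good_map_def by blast
      have n: "S \<subseteq> {..<Suc n}" "insert n S \<subseteq> {..<Suc n}" if "S \<subseteq> {..<n}" for S using that by auto
      have goodA': "\<forall>S \<subseteq> {..<n}. S \<noteq> {} \<longrightarrow> good C E A S" using goodA n by blast
      have "good_map C E n A B t" using good n(1) unfolding good_map_def by simp
      then have E: "a \<in> E_iter C E n" "b \<in> E_iter C E n" "f1 \<in> E_iter C E n" "f0 \<in> E_iter C E n"
        using aE bE f1E f0E goodA goodB good_map_upper[OF A B t good] by blast+
      obtain P p q u where P: "is_cube C n P" "cube_map C n P A p" "cube_map C n P (upper_cube n B) q"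
        "cube_map C n (upper_cube n A) P u"
        "\<And>S. S \<subseteq> {..<n} \<Longrightarrow> is_pullback C (t S) (edge B S (insert n S)) (vert P S) (p S) (q S)"
        "\<And>S. S \<subseteq> {..<n} \<Longrightarrow> p S \<cdot> u S = edge A S (insert n S)"
        "\<And>S. S \<subseteq> {..<n} \<Longrightarrow> q S \<cdot> u S = t (insert n S)"
        "\<forall>S \<subseteq> {..<n}. S \<noteq> {} \<longrightarrow> good C E P S"
        using square_pullback[OF A B t goodA' goodB] by blast
      have POb: "tower_of_cube n P \<in> Ob (Ext C E n)" using IHo[OF P(1)] P(8) by blast
      have "is_pullback (Arr C n) f0 b (tower_of_cube n P) (tower_of_map n P A p)
          (tower_of_map n P (upper_cube n B) q)"
        unfolding f0_def b_def
        by (rule pullback_tower[OF category_axioms UA(2) UB(1,2) P(1) Ut(2) UB(3) P(2,3,5)])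
      then have pb: "is_pullback (Ext C E n) f0 b (tower_of_cube n P) (tower_of_map n P A p)
          (tower_of_map n P (upper_cube n B) q)"
        by (rule pullback_Ext[OF category_axioms]) (use E EAr POb in auto)
      have "rel_good C E (upper_cube n A) P u S" if S: "S \<subseteq> {..<n}" for S
      proof -
        have nS: "n \<notin> S" using S by blast
        have "rel_good C E A B t (insert n S)" using good n(2)[OF S] unfolding good_map_def by blast
        moreover have "rel_good C E A B t (insert n S) \<longleftrightarrow> rel_good C E (upper_cube n A) P u S"
        proof (rule square_rel_good[OF nS])
          show "cube_on C (insert n S) A" "cube_on C (insert n S) B" "map_on C (insert n S) A B t"
            using A B t cube_on_subset map_on_subset n(2)[OF S]
            unfolding is_cube_iff_cube_on cube_map_iff_map_on by metis+
          show "cube_on C S P" "map_on C S P A p" "map_on C S P (upper_cube n B) q"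
            "map_on C S (upper_cube n A) P u"
            using P(1-4) cube_on_subset map_on_subset S
            unfolding is_cube_iff_cube_on cube_map_iff_map_on by metis+
        qed (use P(5-7) S in auto)
        ultimately show ?thesis by simp
      qed
      then have "good_map C E n (upper_cube n A) P u" using P(8) unfolding good_map_def by blast
      then have uE: "tower_of_map n (upper_cube n A) P u \<in> E_iter C E n"
        using IH[OF UA(1) P(1,4)] by blast
      have "cmp (Arr C n) (tower_of_map n P A p) (tower_of_map n (upper_cube n A) P u) = a"
        "cmp (Arr C n) (tower_of_map n P (upper_cube n B) q) (tower_of_map n (upper_cube n A) P u) = f1"
        unfolding tower_of_map_cmp a_def f1_def by (rule tower_of_map_cong; use P(6,7) in simp)+
      moreover have "tower_of_map n (upper_cube n A) P u \<in> hom (Ext C E n) (src (Arr C n) a) (tower_of_cube n P)"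
        using H[OF UA(1) P(1,4)] uE EAr POb st(1) E(1) by (auto simp: homX Ar_Ext[OF category_axioms])
      ultimately show "tower_of_map (Suc n) A B t \<in> E_iter C E (Suc n)"
        unfolding T mem using E pb uE by blast
    next
      assume "tower_of_map (Suc n) A B t \<in> E_iter C E (Suc n)"
      then obtain P0 p0 q0 u0 where E: "a \<in> E_iter C E n" "b \<in> E_iter C E n" "f1 \<in> E_iter C E n" "f0 \<in> E_iter C E n"
        and pb0: "is_pullback (Ext C E n) f0 b P0 p0 q0"
        and u0: "u0 \<in> hom (Ext C E n) (src (Arr C n) a) P0" "cmp (Arr C n) p0 u0 = a"
          "cmp (Arr C n) q0 u0 = f1" "u0 \<in> E_iter C E n"
        unfolding T mem by blast
      have n: "S \<subseteq> {..<Suc n}" "insert n S \<subseteq> {..<Suc n}" if "S \<subseteq> {..<n}" for S using that by auto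
      have goodA: "\<forall>S \<subseteq> {..<n}. S \<noteq> {} \<longrightarrow> good C E A S" using aE E(1) n(1) by simp
      have goodB: "\<forall>S \<subseteq> {..<Suc n}. S \<noteq> {} \<longrightarrow> good C E B S" using bE E(2) by blast
      obtain P p q u' where P: "is_cube C n P" "cube_map C n P A p" "cube_map C n P (upper_cube n B) q"
        "cube_map C n (upper_cube n A) P u'"
        "\<And>S. S \<subseteq> {..<n} \<Longrightarrow> is_pullback C (t S) (edge B S (insert n S)) (vert P S) (p S) (q S)"
        "\<And>S. S \<subseteq> {..<n} \<Longrightarrow> p S \<cdot> u' S = edge A S (insert n S)"
        "\<And>S. S \<subseteq> {..<n} \<Longrightarrow> q S \<cdot> u' S = t (insert n S)"
        "\<forall>S \<subseteq> {..<n}. S \<noteq> {} \<longrightarrow> good C E P S"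
        using square_pullback[OF A B t goodA goodB] by blast
      have POb: "tower_of_cube n P \<in> Ob (Ext C E n)" using IHo[OF P(1)] P(8) by blast
      have "is_pullback (Arr C n) f0 b (tower_of_cube n P) (tower_of_map n P A p)
          (tower_of_map n P (upper_cube n B) q)"
        unfolding f0_def b_def
        by (rule pullback_tower[OF category_axioms UA(2) UB(1,2) P(1) Ut(2) UB(3) P(2,3,5)])
      then have pb: "is_pullback (Ext C E n) f0 b (tower_of_cube n P) (tower_of_map n P A p)
          (tower_of_map n P (upper_cube n B) q)"
        by (rule pullback_Ext[OF category_axioms]) (use E EAr POb in auto)
      \<comment> \<open>The given pullback \<open>P0\<close> is known only by its universal property
        in \<open>Ext C E n\<close>. Its isomorphism with the pointwise pullback, once read off at
        every vertex, shows that \<open>P0\<close> is itself pointwise.\<close>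
      obtain r0 s0 where rs: "r0 \<in> hom (Ext C E n) P0 (tower_of_cube n P)"
        "s0 \<in> hom (Ext C E n) (tower_of_cube n P) P0"
        "cmp (Arr C n) r0 s0 = ident (Arr C n) (tower_of_cube n P)"
        "cmp (Arr C n) s0 r0 = ident (Arr C n) P0"
        "cmp (Arr C n) (tower_of_map n P A p) r0 = p0"
        "cmp (Arr C n) (tower_of_map n P (upper_cube n B) q) r0 = q0"
        using X.pullback_unique[OF pb pb0] unfolding Ext_simps by blast
      have "P0 \<in> Ob (Arr C n)" using pb0 Ob_Ext_subset unfolding is_pullback_def by blast
      then obtain Q where Q: "is_cube C n Q" "P0 = tower_of_cube n Q" using tower_of_cube_surj by blast
      obtain r where r: "cube_map C n Q P r" "r0 = tower_of_map n Q P r"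
        using tower_of_map_surj[OF Q(1) P(1), of r0] rs(1) Q(2) unfolding homX by blast
      obtain s where s: "cube_map C n P Q s" "s0 = tower_of_map n P Q s"
        using tower_of_map_surj[OF P(1) Q(1), of s0] rs(2) Q(2) unfolding homX by blast
      obtain u where u: "cube_map C n (upper_cube n A) Q u" "u0 = tower_of_map n (upper_cube n A) Q u"
        using tower_of_map_surj[OF UA(1) Q(1), of u0] u0(1) Q(2) st(1) unfolding homX by auto
      let ?p = "\<lambda>S. p S \<cdot> r S" and ?q = "\<lambda>S. q S \<cdot> r S"
      have p0: "p0 = tower_of_map n Q A ?p" and q0: "q0 = tower_of_map n Q (upper_cube n B) ?q"
        using rs(5,6) unfolding r(2) tower_of_map_cmp by simp_all
      note rs' = rs(3,4)[unfolded r(2) s(2) Q(2) tower_of_map_cmp tower_of_map_ident[OF category_axioms P(1), symmetric]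
          tower_of_map_ident[OF category_axioms Q(1), symmetric]]
      have rs1: "r S \<cdot> s S = ident C (vert P S)" "s S \<cdot> r S = ident C (vert Q S)" if "S \<subseteq> {..<n}" for S
        using tower_of_map_inject[OF rs'(1) that] tower_of_map_inject[OF rs'(2) that] by simp_all
      have pu: "?p S \<cdot> u S = edge A S (insert n S)" "?q S \<cdot> u S = t (insert n S)" if "S \<subseteq> {..<n}" for S
        using tower_of_map_inject[OF u0(2)[unfolded p0 u(2) a_def tower_of_map_cmp] that]
          tower_of_map_inject[OF u0(3)[unfolded q0 u(2) f1_def tower_of_map_cmp] that] by simp_all
      have pbQ: "is_pullback C (t S) (edge B S (insert n S)) (vert Q S) (?p S) (?q S)" if "S \<subseteq> {..<n}" for S
        by (rule pullback_iso[OF P(5)[OF that] _ _ rs1[OF that] refl refl])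
          (rule map_onD(1)[OF r(1)[unfolded cube_map_iff_map_on] that],
           rule map_onD(1)[OF s(1)[unfolded cube_map_iff_map_on] that])
      have maps: "cube_map C n Q A ?p" "cube_map C n Q (upper_cube n B) ?q"
        using map_on_comp P(1-3) Q(1) r(1) UA(2) UB(1) unfolding is_cube_iff_cube_on cube_map_iff_map_on
        by blast+
      have goodu: "good_map C E n (upper_cube n A) Q u" using IH[OF UA(1) Q(1) u(1)] u0(4) u(2) by blast
      have "rel_good C E A B t (insert n S)" if S: "S \<subseteq> {..<n}" for S
      proof -
        have nS: "n \<notin> S" using S by blast
        have "rel_good C E (upper_cube n A) Q u S" using goodu S unfolding good_map_def by blast
        moreover have "rel_good C E A B t (insert n S) \<longleftrightarrow> rel_good C E (upper_cube n A) Q u S"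
        proof (rule square_rel_good[OF nS])
          show "cube_on C (insert n S) A" "cube_on C (insert n S) B" "map_on C (insert n S) A B t"
            using A B t cube_on_subset map_on_subset n(2)[OF S]
            unfolding is_cube_iff_cube_on cube_map_iff_map_on by metis+
          show "cube_on C S Q" "map_on C S Q A ?p" "map_on C S Q (upper_cube n B) ?q"
            "map_on C S (upper_cube n A) Q u"
            using Q(1) maps u(1) cube_on_subset map_on_subset S
            unfolding is_cube_iff_cube_on cube_map_iff_map_on by metis+
        qed (use pbQ pu S in auto)
        ultimately show ?thesis by simp
      qed
      moreover have "rel_good C E A B t S" if "S \<subseteq> {..<n}" for S
        using f0E E(4) that unfolding good_map_def by blast
      ultimately have "rel_good C E A B t S" if "S \<subseteq> {..<Suc n}" for S
        using that by (metis Diff_insert_absorb lessThan_Suc mk_disjoint_insert subset_insert subset_insert_iff)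
      then show "good_map C E (Suc n) A B t" using goodB unfolding good_map_def by blast
    qed
  qed
  ultimately show ?case by blast
qed

lemma is_extension_iff_good:
  assumes "is_cube C (Suc n) A"
  shows "is_extension C E (Suc n) (tower_of_cube (Suc n) A) \<longleftrightarrow>
    (\<forall>S \<subseteq> {..<Suc n}. S \<noteq> {} \<longrightarrow> good C E A S)"
  using E_iter_and_Ob_Ext_iff_good[of n] upper_cube_is_cube[OF assms] good_map_edge[of n A]
  by (simp add: is_extension_def)

end


section \<open>Resolutions\<close>

text \<open>For \<open>x \<in> S\<close> this is the index of the face operator that deletes
  \<open>x\<close>.\<close>

definition rank :: "nat set \<Rightarrow> nat \<Rightarrow> nat" where
  "rank S x = card {y \<in> S. y < x}"

lemma rank_less:
  assumes "finite S" "x \<in> S" "x < y"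
  shows "rank S x < rank S y"
  unfolding rank_def by (rule psubset_card_mono) (use assms in auto)

lemma bij_betw_rank:
  assumes "finite S"
  shows "bij_betw (rank S) S {..<card S}"
proof -
  have inj: "inj_on (rank S) S"
  proof (rule inj_onI)
    show "x = y" if "x \<in> S" "y \<in> S" "rank S x = rank S y" for x y
      using rank_less[OF assms, of x y] rank_less[OF assms, of y x] that
      by (cases x y rule: linorder_cases) auto
  qed
  have "rank S x < card S" if "x \<in> S" for x
    unfolding rank_def by (rule psubset_card_mono) (use assms that in auto)
  then have "rank S ` S \<subseteq> {..<card S}" by blast
  then have "rank S ` S = {..<card S}"
    by (rule card_subset_eq[OF finite_lessThan]) (simp add: card_image[OF inj])
  then show ?thesis using inj by (simp add: bij_betw_def)
qed

text \<open>The drop by one after deleting a smaller element is the \<open>j - 1\<close> of the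
  semi-simplicial identity.\<close>

lemma rank_remove:
  assumes "finite S" "x \<in> S" "y \<in> S"
  shows "y < x \<Longrightarrow> rank (S - {x}) y = rank S y"
    and "x < y \<Longrightarrow> rank (S - {x}) y = rank S y - 1"
proof -
  have *: "{z \<in> S - {x}. z < y} = {z \<in> S. z < y} - {x}" by auto
  show "rank (S - {x}) y = rank S y" if "y < x"
    using that unfolding rank_def * by simp
  show "rank (S - {x}) y = rank S y - 1" if "x < y"
    using that assms unfolding rank_def * by (simp add: card_Diff_singleton)
qed

section \<open>Edges of the cube of a semi-simplicial object as face operators\<close>

context augmented_semisimplicial
begin

text \<open>The map of ordinals misses exactly one number by counting, and it misses the position of
  \<open>x\<close> because the entry of the enumeration of \<open>T\<close> there is
  \<open>x\<close>. So it is a coface map, on which the action is a single face.\<close>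

lemma edge_arr_cube:
  assumes "finite T" "x \<in> T"
  shows "edge (arr_cube C A) (T - {x}) T = face A (card T - 1) (rank T x)"
proof -
  define m where "m = card (T - {x})"
  define i where "i = rank T x"
  let ?\<phi> = "incl_map (T - {x}) T"
  have T: "card T = Suc m" using assms card_Suc_Diff1 unfolding m_def by fastforce
  have i: "i < Suc m" using bij_betwE[OF bij_betw_rank[OF assms(1)]] assms(2) unfolding i_def T by simp
  have inj: "ord_inj m (Suc m) ?\<phi>"
    using incl_map_ord_inj[of T "T - {x}"] assms(1) unfolding T m_def[symmetric] by blast
  let ?M = "{..<Suc m} - ?\<phi> ` {..<m}"
  have "i \<notin> ?\<phi> ` {..<m}"
  proof
    assume "i \<in> ?\<phi> ` {..<m}"
    then obtain k where k: "k < m" "i = ?\<phi> k" by blast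
    have "sorted_list_of_set T ! i = x"
      using sorted_list_nth_rank[OF assms] unfolding i_def rank_def .
    then have "sorted_list_of_set (T - {x}) ! k = x"
      using sorted_list_nth_incl_map[of T "T - {x}" k] assms(1) k unfolding m_def by simp
    moreover have "sorted_list_of_set (T - {x}) ! k \<in> T - {x}"
      using nth_mem[of k "sorted_list_of_set (T - {x})"] k assms(1) unfolding m_def by simp
    ultimately show False by simp
  qed
  moreover have "card ?M = 1" using ord_inj_card[OF inj] by simp
  ultimately have M: "?M = {i}" using i by (metis DiffI card_1_singletonE lessThan_iff singletonD)
  have "?\<phi> k = (if k < i then k else Suc k)" if "k < m" for k
    using ord_inj_skip[OF inj that] unfolding M by simp
  then have "act C A m (Suc m) ?\<phi> = act C A m (Suc m) (\<lambda>k. if k < i then k else Suc k)"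
    by (rule act_cong)
  also have "\<dots> = face A m i" using act_face i by simp
  finally show ?thesis by (simp add: arr_cube_def T m_def[symmetric] i_def)
qed

lemma vert_arr_cube: "vert (arr_cube C A) S = pt A (card S)"
  by (simp add: arr_cube_def)

section \<open>Boundary limits as simplicial kernels\<close>

context
  fixes S :: "nat set" and m :: nat
  assumes card: "card S = Suc (Suc m)"
begin

lemma finite_S: "finite S"
  using card card.infinite by fastforce

lemma rank_bij: "bij_betw (rank S) S {..Suc m}"
  using bij_betw_rank[OF finite_S] unfolding card lessThan_Suc_atMost .

lemma ball_rank: "(\<forall>x \<in> S. P (rank S x)) \<longleftrightarrow> (\<forall>i \<le> m + 1. P i)"
proof -
  have "(\<forall>x \<in> S. P (rank S x)) \<longleftrightarrow> (\<forall>i \<in> rank S ` S. P i)" by blast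
  then show ?thesis unfolding bij_betw_imp_surj_on[OF rank_bij] by (simp add: Ball_def)
qed

lemma card_remove: "x \<in> S \<Longrightarrow> card (S - {x}) = Suc m"
  using card finite_S by simp

text \<open>The set \<open>S - {x, y}\<close> is reached by deleting in either order. If the smaller
  element \<open>x\<close> is gone first, then \<open>y\<close> has moved down by one
  position.\<close>

lemma edge_arr_cube2:
  assumes "x \<in> S" "y \<in> S" "x < y"
  shows "edge (arr_cube C A) (S - {x, y}) (S - {x}) = face A m (rank S y - 1)"
    and "edge (arr_cube C A) (S - {x, y}) (S - {y}) = face A m (rank S x)"
proof -
  have *: "S - {x, y} = S - {x} - {y}" "S - {x, y} = S - {y} - {x}" by auto
  show "edge (arr_cube C A) (S - {x, y}) (S - {x}) = face A m (rank S y - 1)"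
    unfolding *(1)
    by (subst edge_arr_cube) (use finite_S assms card_remove rank_remove(2) in auto)
  show "edge (arr_cube C A) (S - {x, y}) (S - {y}) = face A m (rank S x)"
    unfolding *(2)
    by (subst edge_arr_cube) (use finite_S assms card_remove rank_remove(1) in auto)
qed

text \<open>The boundary condition runs over all ordered pairs of distinct directions, but
  exchanging the two only reverses the equation. The pairs with \<open>x < y\<close> give exactly
  the equations of a simplicial kernel under the bijection \<open>rank S\<close>.\<close>

lemma bd_cone_arr_cube:
  "bd_cone C (arr_cube C A) S Z (\<lambda>x. k (rank S x)) \<longleftrightarrow> kernel_cone C (pt A (Suc m)) m (face A m) Z k"
proof -
  let ?P = "\<lambda>i j. i < j \<longrightarrow> face A m i \<cdot> k j = face A m (j - 1) \<cdot> k i"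
  let ?Q = "\<lambda>x y. edge (arr_cube C A) (S - {x, y}) (S - {x}) \<cdot> k (rank S x) =
    edge (arr_cube C A) (S - {x, y}) (S - {y}) \<cdot> k (rank S y)"
  have less: "rank S x < rank S y \<longleftrightarrow> x < y" if "x \<in> S" "y \<in> S" for x y
    using rank_less[OF finite_S] that by (metis less_asym linorder_neqE_nat less_irrefl)
  have "(\<forall>x \<in> S. \<forall>y \<in> S. x \<noteq> y \<longrightarrow> ?Q x y) \<longleftrightarrow> (\<forall>x \<in> S. \<forall>y \<in> S. x < y \<longrightarrow> ?Q x y)"
  proof (intro iffI ballI impI)
    fix x y assume *: "\<forall>x \<in> S. \<forall>y \<in> S. x < y \<longrightarrow> ?Q x y" and xy: "x \<in> S" "y \<in> S" "x \<noteq> y"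
    show "?Q x y"
    proof (cases "x < y")
      case True
      then show ?thesis using * xy by blast
    next
      case False
      then have "?Q y x" using * xy by simp
      then show ?thesis unfolding insert_commute[of y x] by (rule sym)
    qed
  next
    fix x y assume "\<forall>x \<in> S. \<forall>y \<in> S. x \<noteq> y \<longrightarrow> ?Q x y" "x \<in> S" "y \<in> S" "x < y"
    then show "?Q x y" using less_imp_neq by blast
  qed
  also have "\<dots> \<longleftrightarrow> (\<forall>x \<in> S. \<forall>y \<in> S. ?P (rank S x) (rank S y))"
    by (intro ball_cong refl) (auto simp: less edge_arr_cube2)
  also have "\<dots> \<longleftrightarrow> (\<forall>i \<le> m + 1. \<forall>j \<le> m + 1. ?P i j)"
    unfolding ball_rank[of "\<lambda>j. ?P _ j"] ball_rank[of "\<lambda>i. \<forall>j \<le> m + 1. ?P i j"] ..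
  also have "\<dots> \<longleftrightarrow> (\<forall>i j. i < j \<and> j \<le> m + 1 \<longrightarrow> face A m i \<cdot> k j = face A m (j - 1) \<cdot> k i)"
  proof (intro iffI allI impI)
    fix i j assume *: "\<forall>i \<le> m + 1. \<forall>j \<le> m + 1. ?P i j" and "i < j \<and> j \<le> m + 1"
    then have "i \<le> m + 1" "j \<le> m + 1" "i < j" by simp_all
    then show "face A m i \<cdot> k j = face A m (j - 1) \<cdot> k i" using * by blast
  qed blast
  finally have 1: "(\<forall>x \<in> S. \<forall>y \<in> S. x \<noteq> y \<longrightarrow> ?Q x y) \<longleftrightarrow> \<dots>" .
  have 2: "(\<forall>x \<in> S. k (rank S x) \<in> hom C Z (vert (arr_cube C A) (S - {x}))) \<longleftrightarrow>
      (\<forall>i \<le> m + 1. k i \<in> hom C Z (pt A (Suc m)))"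
    unfolding ball_rank[symmetric]
    by (intro ball_cong refl) (simp only: vert_arr_cube card_remove)
  show ?thesis unfolding bd_cone_def kernel_cone_def 1 2 by blast
qed

lemma rank_section: obtains e where "\<And>x. x \<in> S \<Longrightarrow> e (rank S x) = x"
  using that[of "inv_into S (rank S)"] bij_betw_imp_inj_on[OF rank_bij] by simp

text \<open>Families indexed by \<open>S\<close> and families indexed by positions determine each
  other. The section \<open>e\<close> of \<open>rank S\<close> moves an arbitrary boundary cone to
  positions.\<close>

lemma bd_lim_arr_cube:
  "bd_lim C (arr_cube C A) S K (\<lambda>x. k (rank S x)) \<longleftrightarrow>
    simplicial_kernel C (pt A (Suc m)) (pt A m) m (face A m) K k" (is "?L \<longleftrightarrow> ?R")
proof -
  have eq: "(\<forall>x \<in> S. k (rank S x) \<cdot> u = g (rank S x)) \<longleftrightarrow> (\<forall>i \<le> m + 1. k i \<cdot> u = g i)" for u g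
    by (rule ball_rank)
  obtain e where e: "\<And>x. x \<in> S \<Longrightarrow> e (rank S x) = x" using rank_section by blast
  show ?thesis
  proof
    assume L: ?L
    have "\<exists>!u. u \<in> hom C Z K \<and> (\<forall>i \<le> m + 1. k i \<cdot> u = g i)"
      if "kernel_cone C (pt A (Suc m)) m (face A m) Z g" for Z g
    proof -
      have "bd_cone C (arr_cube C A) S Z (\<lambda>x. g (rank S x))"
        using that by (simp only: bd_cone_arr_cube)
      then have "\<exists>!u. u \<in> hom C Z K \<and> (\<forall>x \<in> S. k (rank S x) \<cdot> u = g (rank S x))"
        using L unfolding bd_lim_def by blast
      then show ?thesis unfolding eq .
    qed
    then show ?R
      using L face_hom unfolding simplicial_kernel_def bd_lim_def bd_cone_arr_cube by simp
  next
    assume R: ?R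
    have "\<exists>!u. u \<in> hom C Z K \<and> (\<forall>x \<in> S. k (rank S x) \<cdot> u = z x)"
      if z: "bd_cone C (arr_cube C A) S Z z" for Z z
    proof -
      have "bd_cone C (arr_cube C A) S Z (\<lambda>x. z (e (rank S x))) \<longleftrightarrow> bd_cone C (arr_cube C A) S Z z"
        by (rule bd_cone_cong) (simp add: e)
      then have "kernel_cone C (pt A (Suc m)) m (face A m) Z (\<lambda>i. z (e i))"
        using z bd_cone_arr_cube[of Z "\<lambda>i. z (e i)"] by simp
      then have "\<exists>!u. u \<in> hom C Z K \<and> (\<forall>i \<le> m + 1. k i \<cdot> u = z (e i))"
        using R unfolding simplicial_kernel_def by blast
      then have "\<exists>!u. u \<in> hom C Z K \<and> (\<forall>x \<in> S. k (rank S x) \<cdot> u = z (e (rank S x)))"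
        unfolding eq[of _ "\<lambda>i. z (e i)"] .
      then show ?thesis by (simp add: e)
    qed
    then show ?L
      using R unfolding simplicial_kernel_def bd_lim_def bd_cone_arr_cube by simp
  qed
qed

lemma bd_lim_cong:
  assumes "\<And>x. x \<in> S \<Longrightarrow> l x = l' x"
  shows "bd_lim C B S L l \<longleftrightarrow> bd_lim C B S L l'"
  unfolding bd_lim_def by (intro conj_cong bd_cone_cong assms) (simp_all add: assms)

text \<open>The right-hand side depends on \<open>S\<close> only through its size, so all subsets
  with \<open>m + 2\<close> elements impose one and the same condition, that of a resolution in
  dimension \<open>m + 1\<close>.\<close>

lemma good_arr_cube:
  "good C E (arr_cube C A) S \<longleftrightarrow>
    (\<exists>K k u. simplicial_kernel C (pt A (Suc m)) (pt A m) m (face A m) K k \<and>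
        u \<in> hom C (pt A (Suc (Suc m))) K \<and>
        (\<forall>i \<le> m + 1. k i \<cdot> u = face A (Suc m) i) \<and> u \<in> E)"
proof -
  obtain e where e: "\<And>x. x \<in> S \<Longrightarrow> e (rank S x) = x" using rank_section by blast
  have edge: "edge (arr_cube C A) (S - {x}) S = face A (Suc m) (rank S x)" if "x \<in> S" for x
    using edge_arr_cube[OF finite_S that] card by simp
  have eq: "(\<forall>x \<in> S. k (rank S x) \<cdot> u = edge (arr_cube C A) (S - {x}) S) \<longleftrightarrow>
      (\<forall>i \<le> m + 1. k i \<cdot> u = face A (Suc m) i)" for k u
    unfolding ball_rank[symmetric] by (simp add: edge)
  have v: "vert (arr_cube C A) S = pt A (Suc (Suc m))" by (simp add: vert_arr_cube card)
  show ?thesis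
  proof
    assume "good C E (arr_cube C A) S"
    then obtain L l u where L: "bd_lim C (arr_cube C A) S L l" "u \<in> hom C (pt A (Suc (Suc m))) L"
        "\<forall>x \<in> S. l x \<cdot> u = edge (arr_cube C A) (S - {x}) S" "u \<in> E"
      unfolding good_def v by blast
    let ?k = "\<lambda>i. l (e i)"
    have "bd_lim C (arr_cube C A) S L (\<lambda>x. ?k (rank S x)) \<longleftrightarrow> bd_lim C (arr_cube C A) S L l"
      by (rule bd_lim_cong) (simp add: e)
    then have "simplicial_kernel C (pt A (Suc m)) (pt A m) m (face A m) L ?k"
      using L(1) bd_lim_arr_cube[of L ?k] by simp
    moreover have "\<forall>i \<le> m + 1. ?k i \<cdot> u = face A (Suc m) i"
      using L(3) eq[of ?k u] by (simp add: e)
    ultimately show "\<exists>K k u. simplicial_kernel C (pt A (Suc m)) (pt A m) m (face A m) K k \<and>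
        u \<in> hom C (pt A (Suc (Suc m))) K \<and> (\<forall>i \<le> m + 1. k i \<cdot> u = face A (Suc m) i) \<and> u \<in> E"
      using L by blast
  next
    assume "\<exists>K k u. simplicial_kernel C (pt A (Suc m)) (pt A m) m (face A m) K k \<and>
        u \<in> hom C (pt A (Suc (Suc m))) K \<and> (\<forall>i \<le> m + 1. k i \<cdot> u = face A (Suc m) i) \<and> u \<in> E"
    then obtain K k u where "simplicial_kernel C (pt A (Suc m)) (pt A m) m (face A m) K k"
        "u \<in> hom C (pt A (Suc (Suc m))) K" "\<forall>i \<le> m + 1. k i \<cdot> u = face A (Suc m) i" "u \<in> E"
      by blast
    then show "good C E (arr_cube C A) S"
      unfolding good_def v bd_lim_arr_cube[symmetric] eq[symmetric] by blast
  qed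
qed

end

end

text \<open>Size one stands apart, since the bottom object \<open>K_0\<close> is the augmentation by
  convention and no simplicial kernel. Splitting off the only direction reduces goodness to the map
  over the empty set, which is the augmentation face.\<close>

lemma good_arr_cube_singleton:
  assumes "extension_class C E" "augmented_semisimplicial C A"
  shows "good C E (arr_cube C A) {x} \<longleftrightarrow> face A 0 0 \<in> E"
proof -
  interpret extension_class C E by fact
  interpret augmented_semisimplicial C A by fact
  let ?Q = "arr_cube C A" and ?t = "\<lambda>S. edge (arr_cube C A) S (insert x S)"
  have Q: "cube_on C {..<Suc x} ?Q" using arr_cube_is_cube unfolding is_cube_iff_cube_on .
  have x: "insert x {} \<subseteq> {..<Suc x}" by simp
  have "good C E ?Q {x} \<longleftrightarrow> rel_good C E (upper_cube x ?Q) ?Q ?t {}"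
    by (rule good_insert) simp
  also have "\<dots> \<longleftrightarrow> ?t {} \<in> E"
  proof (rule rel_good_empty)
    show "?t {} \<in> hom C (vert (upper_cube x ?Q) {}) (vert ?Q {})"
      using map_onD(1)[OF map_on_edge[OF cube_on_subset[OF Q x]]] by blast
    show "cube_on C {} (upper_cube x ?Q)" "cube_on C {} ?Q"
      using cube_on_upper_cube[OF cube_on_subset[OF Q x]] cube_on_subset[OF Q] by blast+
  qed
  also have "?t {} = face A 0 0"
  proof -
    have "rank {x} x = 0" unfolding rank_def by (metis (mono_tags, lifting) Collect_empty_eq card.empty less_irrefl singletonD)
    then show ?thesis using edge_arr_cube[of "{x}" x] by simp
  qed
  finally show ?thesis .
qed

theorem theorem2p17:
  fixes C :: "('o, 'a) category" and E :: "'a set" and A :: "('o, 'a) semisimplicial"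
  assumes "extension_class C E"
    and "augmented_semisimplicial C A"
  shows "is_resolution C E A \<longleftrightarrow> (\<forall>n \<ge> 1. is_extension C E n (arr C n A))"
proof -
  interpret extension_class C E by fact
  interpret augmented_semisimplicial C A by fact
  have "(\<forall>n \<ge> 1. is_extension C E n (arr C n A)) \<longleftrightarrow> (\<forall>n. is_extension C E (Suc n) (arr C (Suc n) A))"
    by (metis One_nat_def Suc_le_D Suc_le_mono le0)
  also have "\<dots> \<longleftrightarrow> (\<forall>n. \<forall>S \<subseteq> {..<Suc n}. S \<noteq> {} \<longrightarrow> good C E (arr_cube C A) S)"
    using is_extension_iff_good[OF arr_cube_is_cube] by (simp add: arr_def)
  also have "\<dots> \<longleftrightarrow> (\<forall>S. finite S \<longrightarrow> S \<noteq> {} \<longrightarrow> good C E (arr_cube C A) S)"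
  \<comment> \<open>Goodness at \<open>S\<close> does not refer to \<open>n\<close>, and every
    finite set of naturals lies in some initial segment.\<close>
  proof (intro iffI allI impI)
    fix S :: "nat set"
    assume all: "\<forall>n. \<forall>S \<subseteq> {..<Suc n}. S \<noteq> {} \<longrightarrow> good C E (arr_cube C A) S" and S: "finite S" "S \<noteq> {}"
    have "S \<subseteq> {..<Suc (Max S)}" using S by (auto simp: less_Suc_eq_le)
    then show "good C E (arr_cube C A) S" using all S by blast
  qed (auto dest: finite_subset[OF _ finite_lessThan])
  also have "\<dots> \<longleftrightarrow> is_resolution C E A"
  proof
    assume all: "\<forall>S. finite S \<longrightarrow> S \<noteq> {} \<longrightarrow> good C E (arr_cube C A) S"
    show "is_resolution C E A"
      unfolding is_resolution_def
    proof (intro conjI allI)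
      show "face A 0 0 \<in> E"
      proof -
        have "good C E (arr_cube C A) {0}" using all by simp
        then show ?thesis by (simp only: good_arr_cube_singleton[OF assms])
      qed
      show "\<exists>K k u. simplicial_kernel C (pt A (Suc m)) (pt A m) m (face A m) K k \<and>
          u \<in> hom C (pt A (Suc (Suc m))) K \<and>
          (\<forall>i \<le> m + 1. cmp C (k i) u = face A (Suc m) i) \<and> u \<in> E" for m
      proof -
        \<comment> \<open>One representative of each size suffices; \<open>m + 2\<close> directions
          belong to the kernel of the \<open>m + 1\<close> faces from \<open>pt A (Suc m)\<close> to
          \<open>pt A m\<close>.\<close>
        have "good C E (arr_cube C A) {..<Suc (Suc m)}"
          using all finite_lessThan[of "Suc (Suc m)"] by blast
        then show ?thesis by (simp only: good_arr_cube[OF card_lessThan])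
      qed
    qed
  next
    assume res: "is_resolution C E A"
    show "\<forall>S. finite S \<longrightarrow> S \<noteq> {} \<longrightarrow> good C E (arr_cube C A) S"
    proof (intro allI impI)
      fix S :: "nat set" assume S: "finite S" "S \<noteq> {}"
      then have "card S \<noteq> 0" by simp
      then consider "card S = 1" | m where "card S = Suc (Suc m)"
        by (metis One_nat_def not0_implies_Suc)
      then show "good C E (arr_cube C A) S"
      proof cases
        case 1
        then obtain x where "S = {x}" using card_1_singletonE by blast
        then show ?thesis
          using res good_arr_cube_singleton[OF assms] unfolding is_resolution_def by simp
      next
        case 2
        then show ?thesis using res good_arr_cube[OF 2] unfolding is_resolution_def by blast
      qed
    qed
  qed
  finally show ?thesis by blast
qed

end
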